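(* Let $f:X'\to X$ be a proper map of toric varieties, with corresponding fans $\Sigma'$ in $N'$ and $\Sigma$ in $N$ and corresponding map $\phi:N'\to N$. Let $\Psi'$ and $\Psi$ be choices of complements for $\Sigma'$ and $\Sigma$, such that if $\phi(\sigma')\subset\sigma$ with $\sigma'\in\Sigma'$ and $\sigma\in\Sigma$ of the same codimension (in $N'_{\mathbb{Q}}$ and $N_{\mathbb{Q}}$ respectively), then $\phi^*(\Psi(\sigma))\subset\Psi'(\sigma')$. Let $D$ be a $\mathbb{Q}$-Cartier divisor on $X$. Let $\sigma'\in\Sigma'$. Then $$f_*\bigl(f^*(D)\cdot[V(\sigma')]\bigr)=D\cdot f_*([V(\sigma')]).$$
   Context: Setting. $N$ is a free abelian group of rank $n$, $M=\operatorname{Hom}(N,\mathbb{Z})$, $N_{\mathbb{Q}}=\mathbb{Q}\otimes N$, $M_{\mathbb{Q}}=\mathbb{Q}\otimes M$, $\Sigma$ is a fan of strongly convex rational polyhedral cones in $N_{\mathbb{Q}}$, and $X=X(\Sigma)$ is the associated toric variety. For cones, $\tau\succ\sigma$ means $\sigma$ is a proper face of $\tau$, and $\tau\to\sigma$ means $\sigma$ is a facet of $\tau$. For $\sigma\in\Sigma$, $N_\sigma$ is the subgroup of $N$ generated by $\sigma\cap N$. Write $M(\sigma)=\sigma^\perp\subset M_{\mathbb{Q}}$, $M_\tau=M_{\mathbb{Q}}/M(\tau)$, and for $\sigma\prec\tau$, $M(\sigma)_\tau=M(\sigma)/M(\tau)$, which is dual to $\mathbb{Q}\otimes(N_\tau/N_\sigma)$;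 $\langle\cdot,\cdot\rangle$ denotes the duality pairings. If $\tau\to\sigma$, $n_{\tau,\sigma}$ is the generator of $N_\tau/N_\sigma\cong\mathbb{Z}$ lying in the image of $\tau$. For $\sigma\in\Sigma$ of dimension $n-k$, $V(\sigma)$ is the associated $k$-dimensional torus-invariant subvariety; $Z_k(X)_{\mathbb{Q}}$ is the $\mathbb{Q}$-vector space with basis the $[V(\sigma)]$, $\dim\sigma=n-k$. An (equivariant) $\mathbb{Q}$-Cartier divisor $D$ on $X$ is a collection of local equations $m_\sigma\in M_\sigma$ ($\sigma\in\Sigma$) such that for $\tau\prec\sigma$ the natural map $M_\sigma\to M_\tau$ sends $m_\sigma$ to $m_\tau$. A choice of complements $\Psi$ for $\Sigma$ assigns to each $\sigma\in\Sigma$ a linear subspace $\Psi(\sigma)\subset M_{\mathbb{Q}}$ of dimension $\dim\sigma$ such that $\Psi(\sigma)\cap M(\sigma)=0$, and $\Psi(\tau)\subset\Psi(\sigma)$ whenever $\tau\prec\sigma$. Let $\pi_\sigma:M_{\mathbb{Q}}\to M(\sigma)$ be the projection along $\Psi(\sigma)$; for $\tau\succ\sigma$ it induces $\pi_\sigma:M_\tau\to M(\sigma)_\tau$. The action is $D\cdot[V(\sigma)]=\sum_{\tau\to\sigma}\langle\pi_\sigma(m_\tau),n_{\tau,\sigma}\rangle[V(\tau)]$, extended linearly. The same notions apply to $N'$ (free abelian of rank $n'$), $M'=\operatorname{Hom}(N',\mathbb{Z})$, $\Sigma'$, $X'=X(\Sigma')$, $\Psi'$; the action on $X$ uses $\Psi$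 and the action on $X'$ uses $\Psi'$. Maps. A map of toric varieties always means one induced by a map of fans $\phi:(N',\Sigma')\to(N,\Sigma)$, i.e. a group homomorphism $\phi:N'\to N$ such that the image of every cone of $\Sigma'$ is contained in some cone of $\Sigma$. The induced equivariant map $f:X'\to X$ is proper iff $\phi^{-1}(|\Sigma|)=|\Sigma'|$ (with $|\cdot|$ the support). $\phi^*:M\to M'$ (and $M_{\mathbb{Q}}\to M'_{\mathbb{Q}}$) is the dual map. For $\gamma'\in\Sigma'$, let $c(\gamma')$ be the smallest cone of $\Sigma$ containing $\phi(\gamma')$. The pullback $f^*(D)$ is the $\mathbb{Q}$-Cartier divisor on $X'$ whose local equation on $\gamma'$ is the image of $m_{c(\gamma')}$ under the map $M_{c(\gamma')}\to M'_{\gamma'}$ induced by $\phi^*$. Push forward. $f_*$ is the usual push forward of cycles: for a subvariety $Z$ of $X'$ with $W$ the closure of its image, $f_*([Z])=0$ if $\dim W<\dim Z$, and $f_*([Z])=[k(Z):k(W)][W]$ (degree of function fields) if the dimensions are equal. For invariant cycles, supposing for convenience that $\Sigma$ is not contained in any proper subspace of $N_{\mathbb{Q}}$, this is described as follows: with $\gamma=c(\gamma')$, $f_*([V(\gamma')])=0$ if $\operatorname{codim}\gamma<\operatorname{codim}\gamma'$, and $f_*([V(\gamma')])=[\,\gamma'^\perp\cap M':\phi^*(\gamma^\perp\cap M)\,]\,[V(\gamma)]$ (lattice index) if the codimensions are equal; it is extended $\mathbb{Q}$-linearly.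
   Formalization: It is additionally assumed that f_*([V(σ')]) is a torus-invariant cycle, since otherwise D·f_*([V(σ')]) is undefined (e.g. the diagonal A^1→A^2 with σ'=0); this is automatic when codim c(σ') ≤ codim σ'. *)

theory Defs
  imports
    Complex_Main
    "HOL-Library.Function_Algebras"
    "HOL-Library.Set_Algebras"
begin

class rat_vector = ab_group_add +
  fixes scaleQ :: "rat \<Rightarrow> 'a \<Rightarrow> 'a"  (infixr \<open>*\<^sub>Q\<close> 75)
  assumes scaleQ_add_right: "a *\<^sub>Q (x + y) = a *\<^sub>Q x + a *\<^sub>Q y"
    and scaleQ_add_left: "(a + b) *\<^sub>Q x = a *\<^sub>Q x + b *\<^sub>Q x"
    and scaleQ_scaleQ: "a *\<^sub>Q b *\<^sub>Q x = (a * b) *\<^sub>Q x"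
    and scaleQ_one: "1 *\<^sub>Q x = x"

interpretation Q: vector_space "scaleQ :: rat \<Rightarrow> 'a \<Rightarrow> 'a::rat_vector"
  by unfold_locales
    (simp_all add: scaleQ_add_right scaleQ_add_left scaleQ_scaleQ scaleQ_one)

instantiation rat :: rat_vector
begin
definition scaleQ_rat_def: "a *\<^sub>Q (x :: rat) = a * x"
instance by standard (simp_all add: scaleQ_rat_def algebra_simps)
end

instantiation "fun" :: (type, rat_vector) rat_vector
begin
definition scaleQ_fun_def: "a *\<^sub>Q (f :: 'a \<Rightarrow> 'b) = (\<lambda>x. a *\<^sub>Q f x)"
instance
  by standard
    (simp_all add: scaleQ_fun_def fun_eq_iff scaleQ_add_right scaleQ_add_left
      scaleQ_scaleQ scaleQ_one)
end

abbreviation qlinear :: "('a::rat_vector \<Rightarrow> 'b::rat_vector) \<Rightarrow> bool" where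
  "qlinear \<equiv> Vector_Spaces.linear scaleQ scaleQ"


section \<open>Lattices and duals\<close>

text \<open>
  A free abelian group of finite rank is given as a lattice \<open>N\<close> in a rational vector space;
  since a \<open>\<int>\<close>-basis of \<open>N\<close> is a \<open>\<rat>\<close>-basis of the whole type \<open>'v\<close>, the type \<open>'v\<close> itself plays
  the role of \<open>\<rat> \<otimes> N\<close>, and the rank of \<open>N\<close> is the dimension of \<open>UNIV\<close>. Rank 0 is allowed.
\<close>

definition is_lattice :: "'v::rat_vector set \<Rightarrow> bool" where
  "is_lattice N \<longleftrightarrow> (\<exists>B. finite B \<and> Q.independent B \<and> Q.span B = UNIV \<and>
     N = {\<Sum>b\<in>B. of_int (k b) *\<^sub>Q b | k :: 'v \<Rightarrow> int. True})"

text \<open>\<open>M_Q\<close> is the space of all \<open>\<rat>\<close>-linear forms on \<open>'v\<close>, and \<open>M = Hom(N, \<int>)\<close> is the set of those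
  that are integral on \<open>N\<close>.\<close>

definition dualQ :: "('v::rat_vector \<Rightarrow> rat) set" where
  "dualQ = {u. qlinear u}"

definition dual_lattice :: "'v::rat_vector set \<Rightarrow> ('v \<Rightarrow> rat) set" where
  "dual_lattice N = {u \<in> dualQ. \<forall>x\<in>N. u x \<in> \<int>}"

definition perp :: "'v::rat_vector set \<Rightarrow> ('v \<Rightarrow> rat) set" where
  "perp \<sigma> = {u \<in> dualQ. \<forall>x\<in>\<sigma>. u x = 0}"

definition subgrp :: "'a::ab_group_add set \<Rightarrow> bool" where
  "subgrp H \<longleftrightarrow> 0 \<in> H \<and> (\<forall>x\<in>H. \<forall>y\<in>H. x - y \<in> H)"

text \<open>The set \<open>A / B\<close> of cosets, for a subgroup \<open>B\<close> of \<open>A\<close>.\<close>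

definition cosets :: "'a::ab_group_add set \<Rightarrow> 'a set \<Rightarrow> 'a set set" where
  "cosets A B = (\<lambda>a. a +o B) ` A"

text \<open>The index \<open>[A : B]\<close>; it is 0 if the actual index is infinite.\<close>

definition lattice_index :: "'a::ab_group_add set \<Rightarrow> 'a set \<Rightarrow> nat" where
  "lattice_index A B = card (cosets A B)"


section \<open>Cones and fans\<close>

text \<open>Over \<open>\<rat>\<close>, generators can be rescaled into \<open>N\<close>, so every polyhedral cone is rational.\<close>

definition polyhedral_cone :: "'v::rat_vector set \<Rightarrow> bool" where
  "polyhedral_cone \<sigma> \<longleftrightarrow> (\<exists>S. finite S \<and>
     \<sigma> = {\<Sum>s\<in>S. a s *\<^sub>Q s | a :: 'v \<Rightarrow> rat. \<forall>s\<in>S. 0 \<le> a s})"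

definition strongly_convex :: "'v::rat_vector set \<Rightarrow> bool" where
  "strongly_convex \<sigma> \<longleftrightarrow> (\<forall>x. x \<in> \<sigma> \<and> - x \<in> \<sigma> \<longrightarrow> x = 0)"

definition face :: "'v::rat_vector set \<Rightarrow> 'v set \<Rightarrow> bool" where
  "face \<tau> \<sigma> \<longleftrightarrow> (\<exists>u\<in>dualQ. (\<forall>x\<in>\<sigma>. 0 \<le> u x) \<and> \<tau> = {x \<in> \<sigma>. u x = 0})"

definition proper_face :: "'v::rat_vector set \<Rightarrow> 'v set \<Rightarrow> bool" where
  "proper_face \<tau> \<sigma> \<longleftrightarrow> face \<tau> \<sigma> \<and> \<tau> \<noteq> \<sigma>"

definition facet :: "'v::rat_vector set \<Rightarrow> 'v set \<Rightarrow> bool" where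
  "facet \<tau> \<sigma> \<longleftrightarrow> face \<tau> \<sigma> \<and> Q.dim \<sigma> = Q.dim \<tau> + 1"

definition codim :: "'v::rat_vector set \<Rightarrow> nat" where
  "codim \<sigma> = Q.dim (UNIV :: 'v set) - Q.dim \<sigma>"

definition fan :: "'v::rat_vector set set \<Rightarrow> bool" where
  "fan \<Sigma> \<longleftrightarrow> finite \<Sigma> \<and>
     (\<forall>\<sigma>\<in>\<Sigma>. polyhedral_cone \<sigma> \<and> strongly_convex \<sigma>) \<and>
     (\<forall>\<sigma>\<in>\<Sigma>. \<forall>\<tau>. face \<tau> \<sigma> \<longrightarrow> \<tau> \<in> \<Sigma>) \<and>
     (\<forall>\<sigma>\<in>\<Sigma>. \<forall>\<tau>\<in>\<Sigma>. face (\<sigma> \<inter> \<tau>) \<sigma> \<and> face (\<sigma> \<inter> \<tau>) \<tau>)"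

definition cone_lattice :: "'v::rat_vector set \<Rightarrow> 'v set \<Rightarrow> 'v set" where
  "cone_lattice N \<sigma> = subgrp hull (\<sigma> \<inter> N)"

text \<open>\<open>n_{\<tau>,\<sigma>}\<close>, as a coset in \<open>N_\<tau> / N_\<sigma>\<close>, for a facet \<open>\<sigma>\<close> of \<open>\<tau>\<close>.\<close>

definition normal_gen :: "'v::rat_vector set \<Rightarrow> 'v set \<Rightarrow> 'v set \<Rightarrow> 'v set" where
  "normal_gen N \<tau> \<sigma> = (THE C. \<exists>v\<in>cone_lattice N \<tau>. C = v +o cone_lattice N \<sigma> \<and>
     (\<forall>w\<in>cone_lattice N \<tau>. \<exists>k::int. w \<in> (of_int k *\<^sub>Q v) +o cone_lattice N \<sigma>) \<and>
     C \<inter> \<tau> \<noteq> {})"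

text \<open>The pairing of \<open>M(\<sigma>) / M(\<tau>)\<close> with \<open>N_\<tau> / N_\<sigma>\<close>; it does not depend on representatives.\<close>

definition pairing :: "('v::rat_vector \<Rightarrow> rat) set \<Rightarrow> 'v set \<Rightarrow> rat" where
  "pairing U C = the_elem {u v | u v. u \<in> U \<and> v \<in> C}"


section \<open>Divisors and complements\<close>

text \<open>The local equation \<open>D \<sigma>\<close> is a coset in \<open>M_\<sigma> = M_Q / M(\<sigma>)\<close>; the natural map \<open>M_\<sigma> \<rightarrow> M_\<tau>\<close> adds
  \<open>M(\<tau>)\<close> to a coset of \<open>M(\<sigma>)\<close>. Values of \<open>D\<close> (and of \<open>\<Psi>\<close> below) outside \<open>\<Sigma>\<close> are irrelevant.\<close>

definition q_cartier :: "'v::rat_vector set set \<Rightarrow> ('v set \<Rightarrow> ('v \<Rightarrow> rat) set) \<Rightarrow> bool" where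
  "q_cartier \<Sigma> D \<longleftrightarrow> (\<forall>\<sigma>\<in>\<Sigma>. D \<sigma> \<in> cosets dualQ (perp \<sigma>)) \<and>
     (\<forall>\<sigma>\<in>\<Sigma>. \<forall>\<tau>\<in>\<Sigma>. proper_face \<tau> \<sigma> \<longrightarrow> D \<sigma> + perp \<tau> = D \<tau>)"

definition complements :: "'v::rat_vector set set \<Rightarrow> ('v set \<Rightarrow> ('v \<Rightarrow> rat) set) \<Rightarrow> bool" where
  "complements \<Sigma> \<Psi> \<longleftrightarrow>
     (\<forall>\<sigma>\<in>\<Sigma>. Q.subspace (\<Psi> \<sigma>) \<and> \<Psi> \<sigma> \<subseteq> dualQ \<and> Q.dim (\<Psi> \<sigma>) = Q.dim \<sigma> \<and>
        \<Psi> \<sigma> \<inter> perp \<sigma> = {0}) \<and>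
     (\<forall>\<sigma>\<in>\<Sigma>. \<forall>\<tau>\<in>\<Sigma>. proper_face \<tau> \<sigma> \<longrightarrow> \<Psi> \<tau> \<subseteq> \<Psi> \<sigma>)"

definition proj :: "('v::rat_vector set \<Rightarrow> ('v \<Rightarrow> rat) set) \<Rightarrow> 'v set \<Rightarrow>
    ('v \<Rightarrow> rat) \<Rightarrow> ('v \<Rightarrow> rat)" where
  "proj \<Psi> \<sigma> u = (THE w. w \<in> perp \<sigma> \<and> u - w \<in> \<Psi> \<sigma>)"


section \<open>Cycles and the action of divisors\<close>

text \<open>
  A pair \<open>(\<sigma>, L)\<close>, with \<open>\<sigma> \<in> \<Sigma>\<close> and \<open>L\<close> a subspace of \<open>N_Q\<close> containing \<open>\<sigma>\<close>, stands for the following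
  subvariety of \<open>X(\<Sigma>)\<close>: the closure of the subtorus with cocharacter space \<open>L / span \<sigma>\<close> of the orbit
  of \<open>\<sigma>\<close>, an orbit which is itself a torus with cocharacter space \<open>N_Q / span \<sigma>\<close>. Different pairs
  are different subvarieties, and \<open>V(\<sigma>)\<close> is \<open>(\<sigma>, UNIV)\<close>. The subvarieties with \<open>L \<noteq> UNIV\<close> are not
  torus-invariant, but they do occur as images of invariant subvarieties under toric maps.
  A cycle with rational coefficients is given by its coefficient function.
\<close>

type_synonym 'v cycle = "'v set \<times> 'v set \<Rightarrow> rat"

definition prime_cycle :: "'v set \<Rightarrow> 'v set \<Rightarrow> 'v cycle" where
  "prime_cycle \<sigma> L = (\<lambda>p. if p = (\<sigma>, L) then 1 else 0)"

definition V_cycle :: "'v set \<Rightarrow> 'v cycle" where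
  "V_cycle \<sigma> = prime_cycle \<sigma> UNIV"

text \<open>The sum over all \<open>k\<close> of the spaces \<open>Z_k(X)_Q\<close>.\<close>

definition invariant_cycle :: "'v set set \<Rightarrow> 'v cycle \<Rightarrow> bool" where
  "invariant_cycle \<Sigma> z \<longleftrightarrow> (\<forall>\<sigma> L. z (\<sigma>, L) \<noteq> 0 \<longrightarrow> \<sigma> \<in> \<Sigma> \<and> L = UNIV)"

definition V_action :: "'v::rat_vector set \<Rightarrow> 'v set set \<Rightarrow> ('v set \<Rightarrow> ('v \<Rightarrow> rat) set) \<Rightarrow>
    ('v set \<Rightarrow> ('v \<Rightarrow> rat) set) \<Rightarrow> 'v set \<Rightarrow> 'v cycle" where
  "V_action N \<Sigma> \<Psi> D \<sigma> =
     (\<Sum>\<tau> | \<tau> \<in> \<Sigma> \<and> facet \<sigma> \<tau>. pairing (proj \<Psi> \<sigma> ` D \<tau>) (normal_gen N \<tau> \<sigma>) *\<^sub>Q V_cycle \<tau>)"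

text \<open>Meaningful for invariant cycles only, like the action itself.\<close>

definition action :: "'v::rat_vector set \<Rightarrow> 'v set set \<Rightarrow> ('v set \<Rightarrow> ('v \<Rightarrow> rat) set) \<Rightarrow>
    ('v set \<Rightarrow> ('v \<Rightarrow> rat) set) \<Rightarrow> 'v cycle \<Rightarrow> 'v cycle" where
  "action N \<Sigma> \<Psi> D z = (\<Sum>\<sigma>\<in>\<Sigma>. z (\<sigma>, UNIV) *\<^sub>Q V_action N \<Sigma> \<Psi> D \<sigma>)"


section \<open>Toric maps\<close>

text \<open>A homomorphism \<open>N' \<rightarrow> N\<close> is given by its \<open>\<rat>\<close>-linear extension \<open>\<phi>\<close>.\<close>

definition fan_map :: "'w::rat_vector set \<Rightarrow> 'w set set \<Rightarrow> 'v::rat_vector set \<Rightarrow> 'v set set \<Rightarrow>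
    ('w \<Rightarrow> 'v) \<Rightarrow> bool" where
  "fan_map N' \<Sigma>' N \<Sigma> \<phi> \<longleftrightarrow> qlinear \<phi> \<and> \<phi> ` N' \<subseteq> N \<and> (\<forall>\<sigma>'\<in>\<Sigma>'. \<exists>\<sigma>\<in>\<Sigma>. \<phi> ` \<sigma>' \<subseteq> \<sigma>)"

definition proper_fan_map :: "'w::rat_vector set \<Rightarrow> 'w set set \<Rightarrow> 'v::rat_vector set \<Rightarrow>
    'v set set \<Rightarrow> ('w \<Rightarrow> 'v) \<Rightarrow> bool" where
  "proper_fan_map N' \<Sigma>' N \<Sigma> \<phi> \<longleftrightarrow> fan_map N' \<Sigma>' N \<Sigma> \<phi> \<and> \<phi> -` (\<Union>\<Sigma>) = \<Union>\<Sigma>'"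

definition dual_map :: "('w \<Rightarrow> 'v) \<Rightarrow> ('v \<Rightarrow> rat) \<Rightarrow> ('w \<Rightarrow> rat)" where
  "dual_map \<phi> u = u \<circ> \<phi>"

definition min_cone :: "'v set set \<Rightarrow> ('w \<Rightarrow> 'v) \<Rightarrow> 'w set \<Rightarrow> 'v set" where
  "min_cone \<Sigma> \<phi> \<gamma>' = (LEAST \<gamma>. \<gamma> \<in> \<Sigma> \<and> \<phi> ` \<gamma>' \<subseteq> \<gamma>)"

definition pullback :: "'v::rat_vector set set \<Rightarrow> ('w::rat_vector \<Rightarrow> 'v) \<Rightarrow>
    ('v set \<Rightarrow> ('v \<Rightarrow> rat) set) \<Rightarrow> 'w set \<Rightarrow> ('w \<Rightarrow> rat) set" where
  "pullback \<Sigma> \<phi> D \<gamma>' = dual_map \<phi> ` D (min_cone \<Sigma> \<phi> \<gamma>') + perp \<gamma>'"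

text \<open>
  The map on orbits of \<open>\<gamma>'\<close> and \<open>\<gamma> = min_cone \<Sigma> \<phi> \<gamma>'\<close> is the homomorphism of tori dual to
  \<open>\<phi>\<^sup>* : \<gamma>\<^sup>\<bottom> \<inter> M \<rightarrow> \<gamma>'\<^sup>\<bottom> \<inter> M'\<close>. The closure \<open>W\<close> of the image of \<open>V(\<gamma>')\<close> is therefore \<open>(\<gamma>, L)\<close> with
  \<open>L = \<phi>(N'_Q) + span \<gamma>\<close>, and the index \<open>[\<gamma>'\<^sup>\<bottom> \<inter> M' : \<phi>\<^sup>*(\<gamma>\<^sup>\<bottom> \<inter> M)]\<close> is finite if and only if
  \<open>dim W = dim V(\<gamma>')\<close>, in which case it is the degree of function fields. An infinite index counts as 0,
  which is the right coefficient when \<open>dim W < dim V(\<gamma>')\<close>. In the last case below \<open>W\<close> is not invariant.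
\<close>

definition V_pushforward :: "'w::rat_vector set \<Rightarrow> 'v::rat_vector set \<Rightarrow> 'v set set \<Rightarrow>
    ('w \<Rightarrow> 'v) \<Rightarrow> 'w set \<Rightarrow> 'v cycle" where
  "V_pushforward N' N \<Sigma> \<phi> \<gamma>' =
     (let \<gamma> = min_cone \<Sigma> \<phi> \<gamma>';
          deg = of_nat (lattice_index (perp \<gamma>' \<inter> dual_lattice N')
                  (dual_map \<phi> ` (perp \<gamma> \<inter> dual_lattice N)))
      in if codim \<gamma> < codim \<gamma>' then 0
         else if codim \<gamma> = codim \<gamma>' then deg *\<^sub>Q V_cycle \<gamma>
         else deg *\<^sub>Q prime_cycle \<gamma> (range \<phi> + Q.span \<gamma>))"

text \<open>The linear extension to invariant cycles on \<open>X(\<Sigma>')\<close>.\<close>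

definition pushforward :: "'w::rat_vector set \<Rightarrow> 'w set set \<Rightarrow> 'v::rat_vector set \<Rightarrow> 'v set set \<Rightarrow>
    ('w \<Rightarrow> 'v) \<Rightarrow> 'w cycle \<Rightarrow> 'v cycle" where
  "pushforward N' \<Sigma>' N \<Sigma> \<phi> z = (\<Sum>\<gamma>'\<in>\<Sigma>'. z (\<gamma>', UNIV) *\<^sub>Q V_pushforward N' N \<Sigma> \<phi> \<gamma>')"

end

(* Write c(tau') for the smallest cone of Sigma containing phi(tau'). If phi has infinite index on
   the orbit of sigma', so that f_*[V(sigma')] = 0, then every facet relation tau' -> sigma' that
   survives the pushforward has span tau' = phi^-1(span c(sigma')). By properness there are either no
   such tau' or exactly two, on opposite sides of sigma', and their contributions cancel.
   Otherwise phi induces an isomorphism N'_Q / span sigma' -> N_Q / span c(sigma') (after the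
   codimensions are matched using invariance of f_*[V(sigma')]), and by properness c is a bijection from
   the surviving tau' onto the cones tau having c(sigma') as a facet. If phi maps the lattice normal of
   tau' to m times the one of tau, then by compatibility of the complements the coefficient of tau' is
   m times that of tau, while the degree for sigma' is m times the degree for tau'. *)

theory Submission
  imports Defs "HOL-Library.FuncSet"
begin

text \<open>The case split rests on one linear condition: every vector mapped into the span of
  \<open>mc \<sigma>'\<close> lies in the span of \<open>\<sigma>'\<close>. It is equivalent to a
  finite index, and all dimension counts use this condition instead of the lattices. In both cases
  properness enters through the same construction, \<open>lift_cone\<close>, which finds a cone of
  \<open>\<Sigma>'\<close> with facet \<open>\<sigma>'\<close> on a prescribed side. In the
  contracted case the direction is opposite to a surviving cone and the target is
  \<open>mc \<sigma>'\<close> itself; in the finite case the direction is lifted from a point of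
  \<open>\<tau>\<close>. No topology is used over the rationals: relative interiors are encoded by
  absorption, closedness comes from Farkas' lemma, and limits are replaced by a pigeonhole argument
  on a ray and finitely many cones. The two contracted terms cancel as multiples of one and the same
  cycle, which need not be invariant. The factor \<open>m\<close> in the finite case appears as the
  image of evaluation at the lattice normal of \<open>\<tau>'\<close>: all integers on the dual
  lattice upstairs, the multiples of \<open>m\<close> on the forms pulled back from below.\<close>

interpretation QQ: vector_space_pair
  "scaleQ :: rat \<Rightarrow> 'a \<Rightarrow> 'a::rat_vector" "scaleQ :: rat \<Rightarrow> 'b \<Rightarrow> 'b::rat_vector"
  by unfold_locales

lemma scaleQ_fun_apply [simp]: "(a *\<^sub>Q f) x = a *\<^sub>Q f x"
  by (simp add: scaleQ_fun_def)

lemma scaleQ_rat [simp]: "a *\<^sub>Q (x :: rat) = a * x"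
  by (simp add: scaleQ_rat_def)

lemma sum_fun_apply: "(\<Sum>i\<in>I. f i) x = (\<Sum>i\<in>I. f i x)" for f :: "'i \<Rightarrow> 'a \<Rightarrow> 'b::comm_monoid_add"
  by (induction I rule: infinite_finite_induct) auto

section \<open>Linear forms\<close>

lemma dualQ_linear: "u \<in> dualQ \<Longrightarrow> qlinear u"
  by (simp add: dualQ_def)

lemma dualQ_simps:
  assumes "u \<in> dualQ"
  shows "u (x + y) = u x + u y" "u (x - y) = u x - u y" "u (- x) = - u x"
    "u 0 = 0" "u (a *\<^sub>Q x) = a * u x" "u (sum h I) = (\<Sum>i\<in>I. u (h i))"
  using dualQ_linear[OF assms]
  by (simp_all add: QQ.linear_add QQ.linear_diff QQ.linear_neg QQ.linear_0 QQ.linear_scale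
      QQ.linear_sum)

lemma subspace_dualQ: "Q.subspace (dualQ :: ('v::rat_vector \<Rightarrow> rat) set)"
  by (rule Q.subspaceI)
    (auto simp: dualQ_def Vector_Spaces.linear_iff Q.vector_space_axioms algebra_simps)

lemma subspace_perp: "Q.subspace (perp \<sigma>)"
  using subspace_dualQ by (auto simp: perp_def Q.subspace_def)

lemma dualQ_compose: "u \<in> dualQ \<Longrightarrow> qlinear \<phi> \<Longrightarrow> u \<circ> \<phi> \<in> dualQ"
  unfolding dualQ_def mem_Collect_eq by (rule Vector_Spaces.linear_compose)

lemma perp_dualQ: "u \<in> perp \<sigma> \<Longrightarrow> u \<in> dualQ"
  by (simp add: perp_def)

lemma dualQ_span_zero:
  assumes "u \<in> dualQ" "\<forall>x\<in>S. u x = 0" "x \<in> Q.span S"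
  shows "u x = 0"
  using assms(3)
  by (induction rule: Q.span_induct_alt) (use assms in \<open>auto simp: dualQ_simps\<close>)

lemma perp_span: "perp (Q.span S) = perp S"
  using dualQ_span_zero[of _ S] by (auto simp: perp_def Q.span_base)

lemma perp_span_zero: "u \<in> perp S \<Longrightarrow> x \<in> Q.span S \<Longrightarrow> u x = 0"
  using dualQ_span_zero by (auto simp: perp_def)

lemma dualQ_extend:
  assumes "Q.independent B"
  obtains u where "u \<in> dualQ" "\<forall>b\<in>B. u b = f b"
  using QQ.linear_independent_extend[OF assms, of f] by (auto simp: dualQ_def)

lemma separate_subspace:
  assumes "x \<notin> Q.span S"
  obtains u where "u \<in> perp S" "u x = 1"
proof -
  obtain B where B: "B \<subseteq> S" "Q.independent B" "S \<subseteq> Q.span B"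
    using Q.maximal_independent_subset[of S] by blast
  have "Q.span B = Q.span S"
    using B by (meson Q.span_mono Q.span_minimal Q.subspace_span subset_antisym)
  then have "x \<notin> Q.span B"
    using assms by simp
  then have "Q.independent (insert x B)"
    using B by (simp add: Q.independent_insertI)
  then obtain u where u: "u \<in> dualQ" "\<forall>b\<in>insert x B. u b = (if b = x then 1 else 0)"
    using dualQ_extend[of "insert x B" "\<lambda>b. if b = x then 1 else 0"] by blast
  have "\<forall>b\<in>B. u b = 0"
    using u(2) \<open>x \<notin> Q.span B\<close> Q.span_base by fastforce
  then have "\<forall>s\<in>S. u s = 0"
    using B(3) dualQ_span_zero[OF u(1)] by blast
  then show thesis
    using that[of u] u by (auto simp: perp_def)
qed

section \<open>Farkas' lemma\<close>

text \<open>If the inductive form \<open>u\<close> is negative on the new vector \<open>z\<close>, then all vectors are projected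
  along \<open>z\<close> into the kernel of \<open>u\<close>, and a form separating the projections is corrected by a multiple
  of \<open>u\<close> so that it vanishes on \<open>z\<close>.\<close>

lemma farkas:
  fixes f :: "'i \<Rightarrow> 'v::rat_vector"
  assumes "finite I"
  shows "(\<exists>a. (\<forall>i\<in>I. 0 \<le> a i) \<and> y = (\<Sum>i\<in>I. a i *\<^sub>Q f i)) \<or>
    (\<exists>u\<in>dualQ. (\<forall>i\<in>I. 0 \<le> u (f i)) \<and> u y < 0)"
  using assms
\<comment> \<open>The vectors are generalized because they get replaced by their projections
  \<open>g \<circ> f\<close>; they form an indexed family since distinct vectors may have equal
  projections.\<close>
proof (induction I arbitrary: f y rule: finite_induct)
  case empty
  show ?case
  proof (cases "y = 0")
    case False
    then have "- y \<notin> Q.span {}" by simp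
    then obtain u where "u \<in> perp {}" "u (- y) = 1"
      by (rule separate_subspace)
    then show ?thesis
      by (intro disjI2 bexI[of _ u]) (auto simp: dualQ_simps perp_def)
  qed simp
next
  case (insert j I)
  have "(\<exists>a. (\<forall>i\<in>insert j I. 0 \<le> a i) \<and> y = (\<Sum>i\<in>insert j I. a i *\<^sub>Q f i))"
    if "\<forall>i\<in>I. 0 \<le> a i" "0 \<le> c" "y = c *\<^sub>Q f j + (\<Sum>i\<in>I. a i *\<^sub>Q f i)" for a c
  proof (intro exI[of _ "a(j := c)"] conjI)
    have "(\<Sum>i\<in>I. (a(j := c)) i *\<^sub>Q f i) = (\<Sum>i\<in>I. a i *\<^sub>Q f i)"
      using insert.hyps by (intro sum.cong) auto
    then show "y = (\<Sum>i\<in>insert j I. (a(j := c)) i *\<^sub>Q f i)"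
      using that insert.hyps by simp
  qed (use that in auto)
  note combine = this
  show ?case
  proof (cases "\<exists>a. (\<forall>i\<in>I. 0 \<le> a i) \<and> y = (\<Sum>i\<in>I. a i *\<^sub>Q f i)")
    case True
    then show ?thesis
      using combine[of _ 0] by auto
  next
    case False
    then obtain u where u: "u \<in> dualQ" "\<forall>i\<in>I. 0 \<le> u (f i)" "u y < 0"
      using insert.IH[of y f] by blast
    show ?thesis
    proof (cases "0 \<le> u (f j)")
      case True
      then show ?thesis
        using u by auto
    next
      case neg: False
      define z where "z = (- (1 / u (f j))) *\<^sub>Q f j"
      have uz: "u z = - 1"
        using neg u(1) by (simp add: z_def dualQ_simps)
      define g where "g = (\<lambda>x. x + u x *\<^sub>Q z)"
      from insert.IH[of "g y" "g \<circ> f"] show ?thesis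
      proof (elim disjE exE bexE conjE)
        fix a
        assume a: "\<forall>i\<in>I. 0 \<le> a i" "g y = (\<Sum>i\<in>I. a i *\<^sub>Q (g \<circ> f) i)"
        \<comment> \<open>The multiples of \<open>z\<close> in the expansion of \<open>g y\<close>
          collect to this \<open>c\<close>. It is nonnegative since \<open>u y < 0\<close>, and
          \<open>z\<close> is a positive multiple of \<open>f j\<close>.\<close>
        define c where "c = (\<Sum>i\<in>I. a i * u (f i)) - u y"
        have "0 \<le> (\<Sum>i\<in>I. a i * u (f i))"
          using a u by (intro sum_nonneg) auto
        then have c: "0 \<le> c"
          using u(3) by (simp add: c_def)
        have "y = (\<Sum>i\<in>I. a i *\<^sub>Q f i) + (\<Sum>i\<in>I. (a i * u (f i)) *\<^sub>Q z) - u y *\<^sub>Q z"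
          using a(2) by (simp add: g_def scaleQ_add_right scaleQ_scaleQ sum.distrib algebra_simps)
        also have "\<dots> = c *\<^sub>Q z + (\<Sum>i\<in>I. a i *\<^sub>Q f i)"
          by (simp add: c_def Q.scale_left_diff_distrib Q.scale_sum_left)
        also have "c *\<^sub>Q z = (c * (- (1 / u (f j)))) *\<^sub>Q f j"
          by (simp add: z_def scaleQ_scaleQ)
        finally show ?thesis
          using combine[of a "c * (- (1 / u (f j)))"] a c neg by (auto simp: divide_nonneg_neg mult_nonneg_nonpos divide_nonpos_neg)
      next
        fix v
        assume v: "v \<in> dualQ" "\<forall>i\<in>I. 0 \<le> v ((g \<circ> f) i)" "v (g y) < 0"
        define w where "w = v + (v z) *\<^sub>Q u"
        have w: "w \<in> dualQ"
          unfolding w_def by (intro Q.subspace_add Q.subspace_scale subspace_dualQ u v)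
        have "w x = v (g x)" for x
          using v(1) by (simp add: w_def g_def dualQ_simps)
        moreover have "w (f j) = 0"
        proof -
          have "w z = 0"
            using uz by (simp add: w_def)
          moreover have "w z = - (1 / u (f j)) * w (f j)"
            using w by (simp add: z_def dualQ_simps)
          ultimately show ?thesis
            using neg by auto
        qed
        ultimately have "(\<forall>i\<in>insert j I. 0 \<le> w (f i)) \<and> w y < 0"
          using v by auto
        then show ?thesis
          using w by blast
      qed
    qed
  qed
qed

section \<open>Cones\<close>

lemma cone_zero: "polyhedral_cone \<sigma> \<Longrightarrow> 0 \<in> \<sigma>"
  by (auto simp: polyhedral_cone_def intro!: exI[of _ "\<lambda>_. 0"])

lemma cone_add: 
  assumes "polyhedral_cone \<sigma>" "x \<in> \<sigma>" "y \<in> \<sigma>"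
  shows "x + y \<in> \<sigma>"
proof -
  from assms(1) obtain S where S: "finite S" "\<sigma> = {\<Sum>s\<in>S. a s *\<^sub>Q s | a. \<forall>s\<in>S. 0 \<le> a s}"
    by (auto simp: polyhedral_cone_def)
  obtain a b where "x = (\<Sum>s\<in>S. a s *\<^sub>Q s)" "\<forall>s\<in>S. 0 \<le> a s"
    "y = (\<Sum>s\<in>S. b s *\<^sub>Q s)" "\<forall>s\<in>S. 0 \<le> b s"
    using assms(2,3) unfolding S(2) by auto
  then have "x + y = (\<Sum>s\<in>S. (a s + b s) *\<^sub>Q s) \<and> (\<forall>s\<in>S. 0 \<le> a s + b s)"
    by (simp add: scaleQ_add_left sum.distrib)
  then show ?thesis
    unfolding S(2) by (intro CollectI exI[of _ "\<lambda>s. a s + b s"])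
qed

lemma cone_scale: 
  assumes "polyhedral_cone \<sigma>" "x \<in> \<sigma>" "0 \<le> c"
  shows "c *\<^sub>Q x \<in> \<sigma>"
proof -
  from assms(1) obtain S where S: "finite S" "\<sigma> = {\<Sum>s\<in>S. a s *\<^sub>Q s | a. \<forall>s\<in>S. 0 \<le> a s}"
    by (auto simp: polyhedral_cone_def)
  obtain a where "x = (\<Sum>s\<in>S. a s *\<^sub>Q s)" "\<forall>s\<in>S. 0 \<le> a s"
    using assms(2) unfolding S(2) by auto
  then have "c *\<^sub>Q x = (\<Sum>s\<in>S. (c * a s) *\<^sub>Q s) \<and> (\<forall>s\<in>S. 0 \<le> c * a s)"
    using assms(3) by (simp add: Q.scale_sum_right scaleQ_scaleQ)
  then show ?thesis
    unfolding S(2) by (intro CollectI exI[of _ "\<lambda>s. c * a s"])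
qed

lemma cone_span_diff:
  assumes "polyhedral_cone \<sigma>" "x \<in> Q.span \<sigma>"
  obtains y z where "y \<in> \<sigma>" "z \<in> \<sigma>" "x = y - z"
proof -
  have "\<exists>y\<in>\<sigma>. \<exists>z\<in>\<sigma>. x = y - z"
    using assms(2)
  proof (induction rule: Q.span_induct_alt)
    case base
    show ?case
      using cone_zero[OF assms(1)] by force
  next
    case (step c s t)
    then obtain y z where yz: "y \<in> \<sigma>" "z \<in> \<sigma>" "t = y - z" by blast
    show ?case
    proof (cases "0 \<le> c")
      case True
      then show ?thesis
        using yz step(1) assms(1)
        by (intro bexI[of _ "c *\<^sub>Q s + y"] bexI[of _ z]) (auto intro: cone_add cone_scale)
    next
      case False
      then have "(- c) *\<^sub>Q s + z \<in> \<sigma>"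
        using yz step(1) assms(1) by (intro cone_add cone_scale) auto
      moreover have "c *\<^sub>Q s + t = y - ((- c) *\<^sub>Q s + z)"
        using yz by simp
      ultimately show ?thesis
        using yz(1) by blast
    qed
  qed
  then show thesis
    using that by blast
qed

lemma cone_separate:
  assumes "polyhedral_cone \<sigma>" "y \<notin> \<sigma>"
  obtains u where "u \<in> dualQ" "\<forall>x\<in>\<sigma>. 0 \<le> u x" "u y < 0"
proof -
  from assms(1) obtain S where S: "finite S" "\<sigma> = {\<Sum>s\<in>S. a s *\<^sub>Q s | a. \<forall>s\<in>S. 0 \<le> a s}"
    by (auto simp: polyhedral_cone_def)
  obtain u where u: "u \<in> dualQ" "\<forall>s\<in>S. 0 \<le> u s" "u y < 0"
    using farkas[OF S(1), of y "\<lambda>s. s"] assms(2) unfolding S(2) by blast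
  then have "\<forall>x\<in>\<sigma>. 0 \<le> u x"
    unfolding S(2) by (auto simp: dualQ_simps intro!: sum_nonneg)
  then show thesis
    using that u by blast
qed

text \<open>An algebraic form of the relative interior.\<close>

definition rint :: "'v::rat_vector set \<Rightarrow> 'v set" where
  "rint \<sigma> = {p \<in> \<sigma>. \<forall>x\<in>\<sigma>. \<exists>k. k *\<^sub>Q p - x \<in> \<sigma>}"

text \<open>Replaces openness of the relative interior. Write \<open>x = y - z\<close> with
  \<open>y\<close> and \<open>z\<close> in \<open>\<sigma>\<close>: some multiple of
  \<open>p\<close> dominates \<open>z\<close>, and larger multiples only add elements of
  \<open>\<sigma>\<close>.\<close>

lemma rint_absorb:
  assumes "polyhedral_cone \<sigma>" "p \<in> rint \<sigma>" "x \<in> Q.span \<sigma>"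
  obtains k0 where "\<And>k. k0 \<le> k \<Longrightarrow> x + k *\<^sub>Q p \<in> \<sigma>"
proof -
  obtain y z where yz: "y \<in> \<sigma>" "z \<in> \<sigma>" "x = y - z"
    using cone_span_diff[OF assms(1,3)] .
  obtain k0 where k0: "k0 *\<^sub>Q p - z \<in> \<sigma>"
    using assms(2) yz(2) unfolding rint_def by blast
  have p: "p \<in> \<sigma>"
    using assms(2) by (simp add: rint_def)
  show thesis
  proof (rule that[of k0])
    fix k assume "k0 \<le> k"
    then have "(k0 *\<^sub>Q p - z) + (y + (k - k0) *\<^sub>Q p) \<in> \<sigma>"
      using k0 yz p assms(1) by (intro cone_add cone_scale) auto
    moreover have "(k0 *\<^sub>Q p - z) + (y + (k - k0) *\<^sub>Q p) = x + k *\<^sub>Q p"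
      using yz by (simp add: Q.scale_left_diff_distrib)
    ultimately show "x + k *\<^sub>Q p \<in> \<sigma>" by simp
  qed
qed

lemma rint_nonempty:
  assumes "polyhedral_cone \<sigma>"
  obtains p where "p \<in> rint \<sigma>"
proof -
  from assms obtain S where S: "finite S" "\<sigma> = {\<Sum>s\<in>S. a s *\<^sub>Q s | a. \<forall>s\<in>S. 0 \<le> a s}"
    by (auto simp: polyhedral_cone_def)
  \<comment> \<open>The sum of the generators: the sum of all coefficients of a point
    \<open>x\<close> dominates each of them and serves as the multiple \<open>k\<close>.\<close>
  define p where "p = (\<Sum>s\<in>S. 1 *\<^sub>Q s)"
  have "\<exists>k. k *\<^sub>Q p - x \<in> \<sigma>" if x: "x \<in> \<sigma>" for x
  proof -
    obtain a where a: "x = (\<Sum>s\<in>S. a s *\<^sub>Q s)" "\<forall>s\<in>S. 0 \<le> a s"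
      using x unfolding S(2) by blast
    define k where "k = (\<Sum>s\<in>S. a s)"
    have "\<forall>s\<in>S. 0 \<le> k - a s"
      using a S(1) by (auto simp: k_def intro!: member_le_sum)
    moreover have "k *\<^sub>Q p - x = (\<Sum>s\<in>S. (k - a s) *\<^sub>Q s)"
      by (simp add: p_def a(1) Q.scale_sum_right Q.scale_left_diff_distrib sum_subtractf)
    ultimately show ?thesis
      unfolding S(2) by (intro exI[of _ k] CollectI exI[of _ "\<lambda>s. k - a s"]) simp
  qed
  moreover have "p \<in> \<sigma>"
    unfolding S(2) p_def by (intro CollectI exI[of _ "\<lambda>s. 1"]) simp
  ultimately show thesis
    using that[of p] by (simp add: rint_def)
qed

lemma rint_scale:
  assumes "polyhedral_cone \<sigma>" "p \<in> rint \<sigma>" "0 < c"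
  shows "c *\<^sub>Q p \<in> rint \<sigma>"
proof -
  have "\<exists>k. k *\<^sub>Q c *\<^sub>Q p - x \<in> \<sigma>" if "x \<in> \<sigma>" for x
  proof -
    obtain k where "k *\<^sub>Q p - x \<in> \<sigma>"
      using assms(2) \<open>x \<in> \<sigma>\<close> by (auto simp: rint_def)
    then show ?thesis
      using assms(3) by (intro exI[of _ "k / c"]) (simp add: scaleQ_scaleQ)
  qed
  then show ?thesis
    using assms by (auto simp: rint_def intro: cone_scale)
qed

lemma rint_form_zero:
  assumes "p \<in> rint \<sigma>" "u \<in> dualQ" "\<forall>x\<in>\<sigma>. 0 \<le> u x" "u p = 0" "x \<in> \<sigma>"
  shows "u x = 0"
proof -
  obtain k where "k *\<^sub>Q p - x \<in> \<sigma>"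
    using assms(1,5) by (auto simp: rint_def)
  then have "0 \<le> u (k *\<^sub>Q p - x)"
    using assms(3) by blast
  then have "u x \<le> 0"
    using assms(2,4) by (simp add: dualQ_simps)
  then show ?thesis
    using assms(3,5) by force
qed

text \<open>Let \<open>y\<close> witness that \<open>x\<close> is not in
  \<open>rint \<sigma>\<close>. If \<open>- y\<close> were in the cone generated by
  \<open>\<sigma>\<close> and \<open>- x\<close>, a multiple of \<open>x\<close> minus
  \<open>y\<close> would lie in \<open>\<sigma>\<close>. The separating form is nonnegative on
  \<open>\<sigma>\<close> and at \<open>- x\<close>, hence zero at \<open>x\<close>.\<close>

lemma not_rint_form:
  assumes "polyhedral_cone \<sigma>" "x \<in> \<sigma>" "x \<notin> rint \<sigma>"
  obtains u y where "u \<in> dualQ" "\<forall>x\<in>\<sigma>. 0 \<le> u x" "u x = 0" "y \<in> \<sigma>" "0 < u y"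
proof -
  from assms(1) obtain S where S: "finite S" "\<sigma> = {\<Sum>s\<in>S. a s *\<^sub>Q s | a. \<forall>s\<in>S. 0 \<le> a s}"
    by (auto simp: polyhedral_cone_def)
  obtain y where y: "y \<in> \<sigma>" "\<And>k. k *\<^sub>Q x - y \<notin> \<sigma>"
    using assms(2,3) by (auto simp: rint_def)
  \<comment> \<open>Option indices keep \<open>- x\<close> apart from the generators, even if it
    equals one of them.\<close>
  define f where "f = case_option (- x) (\<lambda>s. s)"
  let ?I = "insert None (Some ` S)"
  have "(\<Sum>i\<in>?I. a i *\<^sub>Q f i) = - (a None *\<^sub>Q x) + (\<Sum>s\<in>S. a (Some s) *\<^sub>Q s)" for a
    using S(1) by (subst sum.insert) (auto simp: f_def sum.reindex)
  moreover have "- y \<noteq> - (a None *\<^sub>Q x) + (\<Sum>s\<in>S. a (Some s) *\<^sub>Q s)"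
    if "\<forall>i\<in>?I. 0 \<le> a i" for a :: "_ \<Rightarrow> rat"
  proof
    assume "- y = - (a None *\<^sub>Q x) + (\<Sum>s\<in>S. a (Some s) *\<^sub>Q s)"
    then have "a None *\<^sub>Q x - y = (\<Sum>s\<in>S. a (Some s) *\<^sub>Q s)" by (simp add: algebra_simps)
    also have "\<dots> \<in> \<sigma>"
      using that unfolding S(2) by (intro CollectI exI[of _ "a \<circ> Some"]) auto
    finally show False
      using y(2) by blast
  qed
  ultimately obtain u where u: "u \<in> dualQ" "\<forall>i\<in>?I. 0 \<le> u (f i)" "u (- y) < 0"
    using farkas[of ?I "- y" f] S(1) by auto
  have nonneg: "\<forall>x\<in>\<sigma>. 0 \<le> u x"
    using u(1,2) unfolding S(2) by (auto simp: dualQ_simps f_def intro!: sum_nonneg)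
  moreover have "0 \<le> u (- x)"
    using u(2) by (auto simp: f_def)
  ultimately have "u x = 0"
    using assms(2) u(1) by (fastforce simp: dualQ_simps)
  then show thesis
    using that[of u y] u nonneg y by (simp add: dualQ_simps)
qed

section \<open>Faces and fans\<close>

lemma face_subset: "face \<tau> \<sigma> \<Longrightarrow> \<tau> \<subseteq> \<sigma>"
  by (auto simp: face_def)

lemma facet_sub: "facet \<sigma> \<tau> \<Longrightarrow> \<sigma> \<subseteq> \<tau>"
  using face_subset by (auto simp: facet_def)

lemma face_add_left:
  assumes "face \<tau> \<sigma>" "x \<in> \<sigma>" "y \<in> \<sigma>" "x + y \<in> \<tau>"
  shows "x \<in> \<tau>"
proof -
  obtain u where u: "u \<in> dualQ" "\<forall>x\<in>\<sigma>. 0 \<le> u x" "\<tau> = {x \<in> \<sigma>. u x = 0}"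
    using assms(1) by (auto simp: face_def)
  have "u x + u y = 0" "0 \<le> u x" "0 \<le> u y"
    using u assms(2-4) by (auto simp: dualQ_simps)
  then show ?thesis
    using u(3) assms(2) by auto
qed

lemma face_rint_eq:
  assumes "face \<tau> \<sigma>" "p \<in> rint \<sigma>" "p \<in> \<tau>"
  shows "\<tau> = \<sigma>"
  using assms rint_form_zero unfolding face_def by blast

lemma face_span_Int:
  assumes "face \<tau> \<sigma>" "x \<in> \<sigma>" "x \<in> Q.span \<tau>"
  shows "x \<in> \<tau>"
proof -
  obtain u where u: "u \<in> dualQ" "\<tau> = {x \<in> \<sigma>. u x = 0}"
    using assms(1) by (auto simp: face_def)
  then have "u x = 0"
    using dualQ_span_zero[OF u(1) _ assms(3)] by blast
  then show ?thesis
    using u assms(2) by auto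
qed

lemma fan_finite: "fan \<Sigma> \<Longrightarrow> finite \<Sigma>"
  by (simp add: fan_def)

lemma fan_polyhedral: "fan \<Sigma> \<Longrightarrow> \<sigma> \<in> \<Sigma> \<Longrightarrow> polyhedral_cone \<sigma>"
  by (simp add: fan_def)

lemma fan_face: "fan \<Sigma> \<Longrightarrow> \<sigma> \<in> \<Sigma> \<Longrightarrow> face \<tau> \<sigma> \<Longrightarrow> \<tau> \<in> \<Sigma>"
  by (auto simp: fan_def)

lemma fan_Int_face: "fan \<Sigma> \<Longrightarrow> \<sigma> \<in> \<Sigma> \<Longrightarrow> \<tau> \<in> \<Sigma> \<Longrightarrow> face (\<sigma> \<inter> \<tau>) \<sigma>"
  by (auto simp: fan_def)

lemma fan_Int: "fan \<Sigma> \<Longrightarrow> \<sigma> \<in> \<Sigma> \<Longrightarrow> \<tau> \<in> \<Sigma> \<Longrightarrow> \<sigma> \<inter> \<tau> \<in> \<Sigma>"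
  using fan_face fan_Int_face by blast

lemma fan_subset_face: "fan \<Sigma> \<Longrightarrow> \<sigma> \<in> \<Sigma> \<Longrightarrow> \<tau> \<in> \<Sigma> \<Longrightarrow> \<sigma> \<subseteq> \<tau> \<Longrightarrow> face \<sigma> \<tau>"
  using fan_Int_face[of \<Sigma> \<tau> \<sigma>] by (simp add: inf_absorb2)

lemma fan_rint_subset:
  assumes "fan \<Sigma>" "\<sigma> \<in> \<Sigma>" "\<kappa> \<in> \<Sigma>" "p \<in> rint \<sigma>" "p \<in> \<kappa>"
  shows "\<sigma> \<subseteq> \<kappa>"
proof -
  have "p \<in> \<sigma> \<inter> \<kappa>"
    using assms by (simp add: rint_def)
  then show ?thesis
    using face_rint_eq[OF fan_Int_face[OF assms(1-3)] assms(4)] by blast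
qed

lemma fan_least_cone:
  assumes "fan \<Sigma>" "\<rho> \<in> \<Sigma>" "X \<subseteq> \<rho>"
  obtains \<gamma> where "\<gamma> \<in> \<Sigma>" "X \<subseteq> \<gamma>" "\<And>\<delta>. \<delta> \<in> \<Sigma> \<Longrightarrow> X \<subseteq> \<delta> \<Longrightarrow> \<gamma> \<subseteq> \<delta>"
proof -
  let ?A = "{\<delta> \<in> \<Sigma>. X \<subseteq> \<delta>}"
  have "finite ?A" "?A \<noteq> {}"
    using assms fan_finite[OF assms(1)] by auto
  then obtain \<gamma> where \<gamma>: "\<gamma> \<in> ?A" "\<And>\<delta>. \<delta> \<in> ?A \<Longrightarrow> \<delta> \<subseteq> \<gamma> \<Longrightarrow> \<gamma> = \<delta>"
    using finite_has_minimal[of ?A] by metis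
  show thesis
  proof (rule that)
    fix \<delta> assume "\<delta> \<in> \<Sigma>" "X \<subseteq> \<delta>"
    then have "\<gamma> \<inter> \<delta> \<in> ?A"
      using \<gamma>(1) fan_Int[OF assms(1)] by auto
    then show "\<gamma> \<subseteq> \<delta>"
      using \<gamma>(2) by blast
  qed (use \<gamma> in auto)
qed

lemma min_cone:
  assumes "fan \<Sigma>" "\<exists>\<sigma>\<in>\<Sigma>. \<phi> ` \<gamma>' \<subseteq> \<sigma>"
  shows "min_cone \<Sigma> \<phi> \<gamma>' \<in> \<Sigma>" "\<phi> ` \<gamma>' \<subseteq> min_cone \<Sigma> \<phi> \<gamma>'"
    "\<delta> \<in> \<Sigma> \<Longrightarrow> \<phi> ` \<gamma>' \<subseteq> \<delta> \<Longrightarrow> min_cone \<Sigma> \<phi> \<gamma>' \<subseteq> \<delta>"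
proof -
  obtain \<gamma> where \<gamma>: "\<gamma> \<in> \<Sigma>" "\<phi> ` \<gamma>' \<subseteq> \<gamma>" "\<And>\<delta>. \<delta> \<in> \<Sigma> \<Longrightarrow> \<phi> ` \<gamma>' \<subseteq> \<delta> \<Longrightarrow> \<gamma> \<subseteq> \<delta>"
    using fan_least_cone[OF assms(1)] assms(2) by blast
  then have "min_cone \<Sigma> \<phi> \<gamma>' = \<gamma>"
    unfolding min_cone_def by (intro Least_equality) auto
  then show "min_cone \<Sigma> \<phi> \<gamma>' \<in> \<Sigma>" "\<phi> ` \<gamma>' \<subseteq> min_cone \<Sigma> \<phi> \<gamma>'"
    "\<delta> \<in> \<Sigma> \<Longrightarrow> \<phi> ` \<gamma>' \<subseteq> \<delta> \<Longrightarrow> min_cone \<Sigma> \<phi> \<gamma>' \<subseteq> \<delta>"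
    using \<gamma> by auto
qed

text \<open>Otherwise a supporting form cuts out a face through \<open>x\<close> that misses a point
  of \<open>\<gamma>\<close>; this face belongs to the fan, against leastness.\<close>

lemma fan_least_rint:
  assumes "fan \<Sigma>" "\<gamma> \<in> \<Sigma>" "x \<in> \<gamma>" "\<And>\<delta>. \<delta> \<in> \<Sigma> \<Longrightarrow> x \<in> \<delta> \<Longrightarrow> \<gamma> \<subseteq> \<delta>"
  shows "x \<in> rint \<gamma>"
proof (rule ccontr)
  assume "x \<notin> rint \<gamma>"
  then obtain u y where u: "u \<in> dualQ" "\<forall>x\<in>\<gamma>. 0 \<le> u x" "u x = 0" "y \<in> \<gamma>" "0 < u y"
    using not_rint_form[OF fan_polyhedral[OF assms(1,2)] assms(3)] by metis
  then have "face {x \<in> \<gamma>. u x = 0} \<gamma>"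
    by (auto simp: face_def)
  then have "{x \<in> \<gamma>. u x = 0} \<in> \<Sigma>"
    using fan_face assms by blast
  then have "\<gamma> \<subseteq> {x \<in> \<gamma>. u x = 0}"
    using assms(3) u(3) by (intro assms(4)) auto
  then show False
    using u(4,5) by auto
qed

lemma fan_carrier:
  assumes "fan \<Sigma>" "x \<in> \<rho>" "\<rho> \<in> \<Sigma>"
  obtains \<kappa> where "\<kappa> \<in> \<Sigma>" "x \<in> rint \<kappa>" "\<kappa> \<subseteq> \<rho>"
proof -
  obtain \<gamma> where \<gamma>: "\<gamma> \<in> \<Sigma>" "{x} \<subseteq> \<gamma>" "\<And>\<delta>. \<delta> \<in> \<Sigma> \<Longrightarrow> {x} \<subseteq> \<delta> \<Longrightarrow> \<gamma> \<subseteq> \<delta>"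
    using fan_least_cone[OF assms(1,3), of "{x}"] assms(2) by blast
  then have "x \<in> rint \<gamma>"
    by (intro fan_least_rint[OF assms(1)]) auto
  then show thesis
    using that \<gamma> assms by blast
qed

text \<open>The form cutting out the face \<open>\<rho> \<inter> \<tau>\<close> of
  \<open>\<rho>\<close> pulls back to a form nonnegative on \<open>\<kappa>\<close>; vanishing at a
  relative interior point, it vanishes on all of \<open>\<kappa>\<close>.\<close>

lemma rint_image_subset:
  assumes "fan \<Sigma>" "\<rho> \<in> \<Sigma>" "\<tau> \<in> \<Sigma>" "qlinear \<phi>" "\<phi> ` \<kappa> \<subseteq> \<rho>" "z \<in> rint \<kappa>" "\<phi> z \<in> \<tau>"
  shows "\<phi> ` \<kappa> \<subseteq> \<tau>"
proof -
  obtain u where u: "u \<in> dualQ" "\<forall>x\<in>\<rho>. 0 \<le> u x" "\<rho> \<inter> \<tau> = {x \<in> \<rho>. u x = 0}"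
    using fan_Int_face[OF assms(1-3)] by (auto simp: face_def)
  have "z \<in> \<kappa>"
    using assms(6) by (simp add: rint_def)
  then have zero: "(u \<circ> \<phi>) z = 0"
    using u(3) assms(5,7) by auto
  have nonneg: "\<forall>x\<in>\<kappa>. 0 \<le> (u \<circ> \<phi>) x"
    using u(2) assms(5) by (simp add: image_subset_iff)
  show ?thesis
  proof (rule image_subsetI)
    fix x assume x: "x \<in> \<kappa>"
    have "(u \<circ> \<phi>) x = 0"
      by (rule rint_form_zero[OF assms(6) dualQ_compose[OF u(1) assms(4)] nonneg zero x])
    then have "\<phi> x \<in> {x \<in> \<rho>. u x = 0}"
      using x assms(5) by (simp add: image_subset_iff)
    then show "\<phi> x \<in> \<tau>"
      by (simp flip: u(3))
  qed
qed

lemma rint_min_cone: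
  assumes "fan \<Sigma>" "\<exists>\<sigma>\<in>\<Sigma>. \<phi> ` \<sigma>' \<subseteq> \<sigma>" "qlinear \<phi>" "p \<in> rint \<sigma>'"
  shows "\<phi> p \<in> rint (min_cone \<Sigma> \<phi> \<sigma>')"
proof (rule fan_least_rint[OF assms(1)])
  note mc = min_cone[OF assms(1,2)]
  show "min_cone \<Sigma> \<phi> \<sigma>' \<in> \<Sigma>" "\<phi> p \<in> min_cone \<Sigma> \<phi> \<sigma>'"
    using mc(1,2) assms(4) by (auto simp: rint_def)
  show "min_cone \<Sigma> \<phi> \<sigma>' \<subseteq> \<delta>" if "\<delta> \<in> \<Sigma>" "\<phi> p \<in> \<delta>" for \<delta>
    using mc(3) rint_image_subset[OF assms(1) mc(1) that(1) assms(3) mc(2) assms(4) that(2)] that(1)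
    by blast
qed

text \<open>Some cone contains infinitely many points \<open>v + k p\<close>, hence contains \<open>p\<close> as it is closed.\<close>

lemma fan_ray_cone:
  assumes "fan \<Sigma>" "\<And>k. k0 \<le> k \<Longrightarrow> v + k *\<^sub>Q p \<in> \<Union>\<Sigma>"
  obtains \<kappa> k where "\<kappa> \<in> \<Sigma>" "p \<in> \<kappa>" "v + k *\<^sub>Q p \<in> \<kappa>" "k0 \<le> k"
proof -
  define t :: "nat \<Rightarrow> rat" where "t = (\<lambda>i. k0 + of_nat i)"
  have "\<exists>\<kappa>\<in>\<Sigma>. v + t i *\<^sub>Q p \<in> \<kappa>" for i
    using assms(2)[of "t i"] by (simp add: t_def)
  then obtain C where C: "\<And>i. C i \<in> \<Sigma>" "\<And>i. v + t i *\<^sub>Q p \<in> C i"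
    by metis
  have "finite (range C)"
    using C(1) fan_finite[OF assms(1)] by (meson finite_subset image_subsetI)
  then obtain i0 where inf: "infinite {i. C i = C i0}"
    using pigeonhole_infinite[of UNIV C] by auto
  have "p \<in> C i0"
  proof (rule ccontr)
    assume "p \<notin> C i0"
    then obtain u where u: "u \<in> dualQ" "\<forall>x\<in>C i0. 0 \<le> u x" "u p < 0"
      using cone_separate[OF fan_polyhedral[OF assms(1) C(1)]] by metis
    \<comment> \<open>Since \<open>u p < 0\<close>, the form is negative at
      \<open>v + t i *\<^sub>Q p\<close> for all \<open>i > n\<close>, and the infinite index set
      contains such an \<open>i\<close>.\<close>
    obtain n :: nat where n: "(u v + k0 * u p) / (- u p) < of_nat n"
      using reals_Archimedean2 by blast
    obtain i where i: "n < i" "C i = C i0"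
      using inf by (auto simp: finite_nat_set_iff_bounded_le not_le)
    have "u v + k0 * u p < of_nat n * (- u p)"
      using n u(3) pos_divide_less_eq[of "- u p" "u v + k0 * u p" "of_nat n"] by linarith
    also have "\<dots> \<le> of_nat i * (- u p)"
      using i u(3) by (intro mult_right_mono) auto
    finally have "u (v + t i *\<^sub>Q p) < 0"
      using u(1) by (simp add: dualQ_simps t_def algebra_simps)
    then show False
      using u(2) C(2)[of i] i(2) by force
  qed
  then show thesis
    using that[of "C i0" "t i0"] C[of i0] by (simp add: t_def)
qed

section \<open>Lattices\<close>

lemma Ints_common_denominator:
  fixes f :: "'i \<Rightarrow> rat"
  assumes "finite I"
  obtains k :: int where "0 < k" "\<forall>i\<in>I. of_int k * f i \<in> \<int>"
proof -
  have "\<exists>k::int. 0 < k \<and> (\<forall>i\<in>I. of_int k * f i \<in> \<int>)"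
    using assms
  proof (induction I rule: finite_induct)
    case empty
    show ?case by (intro exI[of _ 1]) simp
  next
    case (insert j I)
    then obtain k where k: "0 < k" "\<forall>i\<in>I. of_int k * f i \<in> \<int>" by blast
    obtain a b where ab: "f j = of_int a / of_int b" "0 < b"
      by (metis quotient_of_div quotient_of_denom_pos surj_pair)
    have "of_int (k * b) * f i = of_int b * (of_int k * f i)" for i
      by simp
    then have "\<forall>i\<in>I. of_int (k * b) * f i \<in> \<int>"
      using k(2) by (metis Ints_mult Ints_of_int)
    moreover have "of_int (k * b) * f j = of_int (k * a)"
      using ab by simp
    then have "of_int (k * b) * f j \<in> \<int>"
      by (metis Ints_of_int)
    ultimately show ?case
      using k(1) ab(2) by (intro exI[of _ "k * b"]) auto
  qed
  then show thesis using that by blast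
qed

lemma bezout_sum:
  fixes k :: "'i \<Rightarrow> int"
  assumes "finite I"
  obtains a where "(\<Sum>i\<in>I. a i * k i) = Gcd (k ` I)"
proof -
  have "\<exists>a. (\<Sum>i\<in>I. a i * k i) = Gcd (k ` I)"
    using assms
  proof (induction I rule: finite_induct)
    case (insert j I)
    then obtain a where a: "(\<Sum>i\<in>I. a i * k i) = Gcd (k ` I)" by blast
    obtain s t where st: "s * k j + t * Gcd (k ` I) = gcd (k j) (Gcd (k ` I))"
      using bezout_int by blast
    have "(\<Sum>i\<in>I. ((\<lambda>i. t * a i)(j := s)) i * k i) = (\<Sum>i\<in>I. t * (a i * k i))"
      using insert.hyps by (intro sum.cong) auto
    then have "(\<Sum>i\<in>insert j I. ((\<lambda>i. t * a i)(j := s)) i * k i) = s * k j + t * Gcd (k ` I)"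
      using insert.hyps by (simp add: a[symmetric] sum_distrib_left)
    then show ?case
      using st by (intro exI[of _ "(\<lambda>i. t * a i)(j := s)"]) simp
  qed simp
  then show thesis using that by blast
qed

text \<open>The dual basis turns membership in \<open>N\<close> into integrality of finitely many
  forms; closure properties, denominators and gcds are all read off from these coordinates.\<close>

lemma lattice_coordinates:
  fixes N :: "'v::rat_vector set"
  assumes "is_lattice N"
  obtains B and c :: "'v \<Rightarrow> 'v \<Rightarrow> rat" where "finite B" "Q.independent B" "Q.span B = UNIV"
    "\<forall>b\<in>B. c b \<in> dualQ" "\<forall>x. x = (\<Sum>b\<in>B. c b x *\<^sub>Q b)"
    "\<forall>x. x \<in> N \<longleftrightarrow> (\<forall>b\<in>B. c b x \<in> \<int>)" "\<forall>b\<in>B. b \<in> N"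
proof -
  obtain B where B: "finite B" "Q.independent B" "Q.span B = UNIV"
    "N = {\<Sum>b\<in>B. of_int (k b) *\<^sub>Q b | k :: 'v \<Rightarrow> int. True}"
    using assms unfolding is_lattice_def by blast
  have "\<forall>b. \<exists>u\<in>dualQ. \<forall>b'\<in>B. u b' = (if b' = b then 1 else 0)"
  proof
    fix b
    show "\<exists>u\<in>dualQ. \<forall>b'\<in>B. u b' = (if b' = b then 1 else 0)"
      by (rule dualQ_extend[OF B(2), of "\<lambda>b'. if b' = b then 1 else 0"]) blast
  qed
  then obtain c where c: "\<And>b. c b \<in> dualQ" "\<And>b b'. b' \<in> B \<Longrightarrow> c b b' = (if b' = b then 1 else 0)"
    by metis
  have csum: "c b (\<Sum>b\<in>B. a b *\<^sub>Q b) = a b" if "b \<in> B" for a b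
  proof -
    have "c b (\<Sum>b\<in>B. a b *\<^sub>Q b) = (\<Sum>b'\<in>B. if b' = b then a b' else 0)"
      using c by (auto simp: dualQ_simps intro!: sum.cong)
    then show ?thesis
      using that B(1) by simp
  qed
  have rep: "x = (\<Sum>b\<in>B. c b x *\<^sub>Q b)" for x
  proof -
    obtain a where "x = (\<Sum>b\<in>B. a b *\<^sub>Q b)"
      using B(3) Q.span_finite[OF B(1)] by blast
    then show ?thesis
      using csum by (auto intro!: sum.cong)
  qed
  have N: "x \<in> N \<longleftrightarrow> (\<forall>b\<in>B. c b x \<in> \<int>)" for x
  proof
    assume "x \<in> N"
    then obtain k where "x = (\<Sum>b\<in>B. of_int (k b) *\<^sub>Q b)"
      unfolding B(4) by blast
    then show "\<forall>b\<in>B. c b x \<in> \<int>"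
      using csum[of _ "\<lambda>b. of_int (k b)"] by simp
  next
    assume "\<forall>b\<in>B. c b x \<in> \<int>"
    then have "(\<Sum>b\<in>B. of_int \<lfloor>c b x\<rfloor> *\<^sub>Q b) = (\<Sum>b\<in>B. c b x *\<^sub>Q b)"
      by (intro sum.cong) auto
    then show "x \<in> N"
      unfolding B(4) using rep[of x] by (intro CollectI exI[of _ "\<lambda>b. \<lfloor>c b x\<rfloor>"]) simp
  qed
  have "b \<in> N" if "b \<in> B" for b
    unfolding N using that c(2) by simp
  then show thesis
    using that[of B c] B c rep N by blast
qed

lemma
  assumes "is_lattice N"
  shows lattice_zero: "0 \<in> N"
    and lattice_add: "x \<in> N \<Longrightarrow> y \<in> N \<Longrightarrow> x + y \<in> N"
    and lattice_diff: "x \<in> N \<Longrightarrow> y \<in> N \<Longrightarrow> x - y \<in> N"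
    and lattice_scale: "x \<in> N \<Longrightarrow> of_int k *\<^sub>Q x \<in> N"
proof -
  obtain B c where B0: "finite B" "Q.independent B" "Q.span B = UNIV"
    "\<forall>b\<in>B. c b \<in> dualQ" "\<forall>x. x = (\<Sum>b\<in>B. c b x *\<^sub>Q b)"
    "\<forall>x. x \<in> N \<longleftrightarrow> (\<forall>b\<in>B. c b x \<in> \<int>)" "\<forall>b\<in>B. b \<in> N"
    using lattice_coordinates[OF assms] .
  note B = B0[rule_format]
  show "0 \<in> N" "x \<in> N \<Longrightarrow> y \<in> N \<Longrightarrow> x + y \<in> N" "x \<in> N \<Longrightarrow> y \<in> N \<Longrightarrow> x - y \<in> N"
    "x \<in> N \<Longrightarrow> of_int k *\<^sub>Q x \<in> N"
    using B(4,6) by (auto simp: dualQ_simps)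
qed

lemma lattice_multiple:
  assumes "is_lattice N"
  obtains k :: int where "0 < k" "of_int k *\<^sub>Q x \<in> N"
proof -
  obtain B c where B0: "finite B" "Q.independent B" "Q.span B = UNIV"
    "\<forall>b\<in>B. c b \<in> dualQ" "\<forall>x. x = (\<Sum>b\<in>B. c b x *\<^sub>Q b)"
    "\<forall>x. x \<in> N \<longleftrightarrow> (\<forall>b\<in>B. c b x \<in> \<int>)" "\<forall>b\<in>B. b \<in> N"
    using lattice_coordinates[OF assms] .
  note B = B0[rule_format]
  show thesis
    using Ints_common_denominator[OF B(1), of "\<lambda>b. c b x"] that B(4,6) by (metis dualQ_simps(5))
qed

lemma dual_lattice_multiple:
  assumes "is_lattice N" "u \<in> dualQ"
  obtains k :: int where "0 < k" "of_int k *\<^sub>Q u \<in> dual_lattice N"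
proof -
  obtain B c where B0: "finite B" "Q.independent B" "Q.span B = UNIV"
    "\<forall>b\<in>B. c b \<in> dualQ" "\<forall>x. x = (\<Sum>b\<in>B. c b x *\<^sub>Q b)"
    "\<forall>x. x \<in> N \<longleftrightarrow> (\<forall>b\<in>B. c b x \<in> \<int>)" "\<forall>b\<in>B. b \<in> N"
    using lattice_coordinates[OF assms(1)] .
  note B = B0[rule_format]
  obtain k :: int where k: "0 < k" "\<forall>b\<in>B. of_int k * u b \<in> \<int>"
    using Ints_common_denominator[OF B(1), of u] .
  have "of_int k * u x \<in> \<int>" if "x \<in> N" for x
  proof -
    have "u x = (\<Sum>b\<in>B. c b x * u b)"
      by (subst B(5)[of x]) (simp add: dualQ_simps assms(2))
    then have "of_int k * u x = (\<Sum>b\<in>B. c b x * (of_int k * u b))"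
      by (simp add: sum_distrib_left algebra_simps)
    also have "\<dots> \<in> \<int>"
    proof (rule Ints_sum)
      fix b assume b: "b \<in> B"
      have "c b x \<in> \<int>"
        using B(6) that b by blast
      then show "c b x * (of_int k * u b) \<in> \<int>"
        using k(2) b by (intro Ints_mult[of "c b x"]) auto
    qed
    finally show ?thesis .
  qed
  then show thesis
    using that[of k] k(1) Q.subspace_scale[OF subspace_dualQ assms(2)]
    by (auto simp: dual_lattice_def)
qed

text \<open>Division of the coordinates of \<open>y - P y\<close> by their gcd gives \<open>e\<close>, and Bezout gives \<open>u\<close>.\<close>

lemma lattice_retraction_step:
  fixes N :: "'v::rat_vector set"
  assumes "is_lattice N" "qlinear P" "P ` N \<subseteq> N" "range P \<subseteq> Q.span X"
    "\<forall>x\<in>Q.span X. P x = x" "y \<notin> Q.span X"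
  obtains e u where "e \<in> N" "e \<in> Q.span (insert y X)" "P e = 0" "u \<in> dual_lattice N" "u \<in> perp X" "u e = 1"
proof -
  obtain B c where B0: "finite B" "Q.independent B" "Q.span B = UNIV"
    "\<forall>b\<in>B. c b \<in> dualQ" "\<forall>x. x = (\<Sum>b\<in>B. c b x *\<^sub>Q b)"
    "\<forall>x. x \<in> N \<longleftrightarrow> (\<forall>b\<in>B. c b x \<in> \<int>)" "\<forall>b\<in>B. b \<in> N"
    using lattice_coordinates[OF assms(1)] .
  note B = B0[rule_format]
  have P: "P (a - b) = P a - P b" "P (r *\<^sub>Q a) = r *\<^sub>Q P a" "P (P a) = P a" for a b r
    using assms(2,4,5) by (auto simp: QQ.linear_diff QQ.linear_scale)
  obtain k :: int where k: "0 < k" "of_int k *\<^sub>Q (y - P y) \<in> N"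
    using lattice_multiple[OF assms(1)] .
  define e1 where "e1 = of_int k *\<^sub>Q (y - P y)"
  have Pe1: "P e1 = 0"
    by (simp add: e1_def P)
  have "y - P y \<noteq> 0"
    using assms(4,6) by (metis eq_iff_diff_eq_0 range_subsetD)
  then have "e1 \<noteq> 0"
    using k(1) by (simp add: e1_def)
  define m where "m = (\<lambda>b. \<lfloor>c b e1\<rfloor>)"
  have m: "c b e1 = of_int (m b)" if "b \<in> B" for b
    using B(6) k(2) that by (simp add: m_def e1_def)
  define g where "g = Gcd (m ` B)"
  have "g \<noteq> 0"
  proof
    assume "g = 0"
    then have "\<forall>b\<in>B. m b = 0"
      by (auto simp: g_def Gcd_0_iff)
    then have "e1 = 0"
      using B(5)[of e1] m by simp
    then show False
      using \<open>e1 \<noteq> 0\<close> by simp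
  qed
  obtain a where a: "(\<Sum>b\<in>B. a b * m b) = g"
    using bezout_sum[OF B(1)] unfolding g_def by blast
  define e where "e = (1 / of_int g) *\<^sub>Q e1"
  \<comment> \<open>Composing with \<open>x - P x\<close> makes the Bezout combination vanish on the
    span of \<open>X\<close>; it stays integral on \<open>N\<close> because \<open>P\<close>
    preserves \<open>N\<close>.\<close>
  define u where "u = (\<lambda>x. \<Sum>b\<in>B. of_int (a b) * c b (x - P x))"
  have "e \<in> N"
    unfolding B(6)
  proof
    fix b assume b: "b \<in> B"
    have "g dvd m b"
      using b by (auto simp: g_def)
    then obtain d where "m b = g * d" by blast
    then have "c b e = of_int d"
      using \<open>g \<noteq> 0\<close> m[OF b] B(4)[OF b] by (simp add: e_def dualQ_simps)
    then show "c b e \<in> \<int>" by simp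
  qed
  moreover have "P e = 0"
    by (simp add: e_def P Pe1)
  moreover have "e \<in> Q.span (insert y X)"
  proof -
    have "P y \<in> Q.span (insert y X)"
      using assms(4) Q.span_mono[of X "insert y X"] by blast
    moreover have "y \<in> Q.span (insert y X)"
      by (simp add: Q.span_base)
    ultimately show ?thesis
      unfolding e_def e1_def by (intro Q.span_scale Q.span_diff)
  qed
  moreover have u: "u \<in> dualQ"
  proof -
    have "u (x + y) = u x + u y" "u (r *\<^sub>Q x) = r * u x" for x y r
      using B(4) assms(2)
      by (simp_all add: u_def QQ.linear_add QQ.linear_scale dualQ_simps algebra_simps
          sum.distrib sum_subtractf sum_distrib_left)
    then show ?thesis
      by (simp add: dualQ_def Vector_Spaces.linear_iff Q.vector_space_axioms)
  qed
  moreover have "u \<in> dual_lattice N"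
    unfolding dual_lattice_def
  proof (intro CollectI conjI u ballI)
    fix x assume "x \<in> N"
    then have "x - P x \<in> N"
      using assms(3) by (intro lattice_diff[OF assms(1)]) auto
    then show "u x \<in> \<int>"
      unfolding u_def using B(6) by (intro Ints_sum Ints_mult) auto
  qed
  moreover have "u \<in> perp X"
    unfolding perp_def using u assms(5) B(4) by (auto simp: u_def Q.span_base dualQ_simps)
  moreover have "u e = 1"
  proof -
    have "u e = (\<Sum>b\<in>B. of_int (a b * m b)) / of_int g"
      unfolding u_def \<open>P e = 0\<close> sum_divide_distrib using m B(4)
      by (intro sum.cong) (auto simp: e_def dualQ_simps)
    also have "\<dots> = 1"
      unfolding of_int_sum[symmetric] a using \<open>g \<noteq> 0\<close> by simp
    finally show ?thesis .
  qed
  ultimately show thesis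
    using that by blast
qed

text \<open>The sublattice \<open>N \<inter> Q.span X\<close> is saturated, hence a direct summand.
  The retraction grows by one direction at a time: a primitive vector \<open>e\<close> for the new
  direction and its dual form \<open>u\<close> contribute the term
  \<open>u x *\<^sub>Q e\<close>.\<close>

lemma lattice_retraction:
  assumes "is_lattice N" "finite X"
  obtains P where "qlinear P" "P ` N \<subseteq> N" "range P \<subseteq> Q.span X" "\<forall>x\<in>Q.span X. P x = x"
proof -
  have "\<exists>P. qlinear P \<and> P ` N \<subseteq> N \<and> range P \<subseteq> Q.span X \<and> (\<forall>x\<in>Q.span X. P x = x)"
    using assms(2)
  proof (induction X rule: finite_induct)
    case empty
    show ?case
      by (intro exI[of _ "\<lambda>x. 0"])
        (auto simp: Vector_Spaces.linear_iff Q.vector_space_axioms lattice_zero[OF assms(1)])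
  next
    case (insert y X)
    then obtain P where P: "qlinear P" "P ` N \<subseteq> N" "range P \<subseteq> Q.span X" "\<forall>x\<in>Q.span X. P x = x"
      by blast
    show ?case
    proof (cases "y \<in> Q.span X")
      case True
      then show ?thesis
        using P by (auto simp: Q.span_redundant)
    next
      case False
      then obtain e u where eu: "e \<in> N" "e \<in> Q.span (insert y X)" "P e = 0"
        "u \<in> dual_lattice N" "u \<in> perp X" "u e = 1"
        using lattice_retraction_step[OF assms(1) P] by metis
      have u: "u \<in> dualQ"
        using eu by (simp add: perp_def)
      define P' where "P' = (\<lambda>x. P x + u x *\<^sub>Q e)"
      have lin: "qlinear P'"
        using P(1) u by (simp add: P'_def Vector_Spaces.linear_iff Q.vector_space_axioms
            dualQ_simps scaleQ_add_left scaleQ_add_right scaleQ_scaleQ)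
      have "P x + u x *\<^sub>Q e \<in> N" if "x \<in> N" for x
      proof -
        have "u x = of_int \<lfloor>u x\<rfloor>"
          using eu(4) that by (auto simp: dual_lattice_def)
        then show ?thesis
          using P(2) that eu(1) by (metis assms(1) image_subset_iff lattice_add lattice_scale)
      qed
      moreover have "range P' \<subseteq> Q.span (insert y X)"
        using P(3) eu(2) Q.span_mono[of X "insert y X"]
        by (auto simp: P'_def intro!: Q.span_add Q.span_scale)
      moreover have fixX: "P' x = x" if "x \<in> Q.span X" for x
        using that P(4) perp_span_zero[OF eu(5)] by (simp add: P'_def)
      moreover have "P' y = y"
      proof -
        \<comment> \<open>\<open>P'\<close> fixes \<open>e\<close> and the span of \<open>X\<close>,
          hence also \<open>y\<close>, because \<open>e\<close> is a nonzero multiple of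
          \<open>y\<close> modulo that span.\<close>
        obtain r where r: "e - r *\<^sub>Q y \<in> Q.span X"
          using eu(2) by (auto simp: Q.span_breakdown_eq)
        have "r \<noteq> 0"
        proof
          assume "r = 0"
          then have "u e = 0"
            using r perp_span_zero[OF eu(5)] by simp
          then show False
            using eu(6) by simp
        qed
        have "P' e = e"
          by (simp add: P'_def eu)
        moreover have "P' (e - r *\<^sub>Q y) = e - r *\<^sub>Q y"
          by (rule fixX[OF r])
        ultimately have "r *\<^sub>Q P' y = r *\<^sub>Q y"
          using lin by (simp add: QQ.linear_diff QQ.linear_scale)
        then show ?thesis
          using \<open>r \<noteq> 0\<close> by simp
      qed
      have "P' x = x" if x: "x \<in> Q.span (insert y X)" for x
      proof -
        obtain r where "x - r *\<^sub>Q y \<in> Q.span X"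
          using x by (auto simp: Q.span_breakdown_eq)
        then have "P' (x - r *\<^sub>Q y) = x - r *\<^sub>Q y"
          by (rule fixX)
        then show ?thesis
          using lin \<open>P' y = y\<close> by (simp add: QQ.linear_diff QQ.linear_scale)
      qed
      ultimately show ?thesis
        using lin by (intro exI[of _ P']) (auto simp: P'_def)
    qed
  qed
  then show thesis using that by blast
qed

lemma lattice_finite_span:
  assumes "is_lattice (N :: 'v::rat_vector set)"
  obtains X where "finite X" "X \<subseteq> \<sigma>" "Q.independent X" "Q.span X = Q.span (\<sigma> :: 'v set)"
proof -
  obtain B c where B0: "finite B" "Q.independent B" "Q.span B = UNIV"
    "\<forall>b\<in>B. c b \<in> dualQ" "\<forall>x. x = (\<Sum>b\<in>B. c b x *\<^sub>Q b)"
    "\<forall>x. x \<in> N \<longleftrightarrow> (\<forall>b\<in>B. c b x \<in> \<int>)" "\<forall>b\<in>B. b \<in> N"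
    using lattice_coordinates[OF assms] .
  note B = B0[rule_format]
  obtain X where X: "X \<subseteq> \<sigma>" "Q.independent X" "\<sigma> \<subseteq> Q.span X"
    using Q.maximal_independent_subset[of \<sigma>] by blast
  have "finite X"
    using Q.independent_span_bound[OF B(1) X(2)] B(3) by blast
  moreover have "Q.span X = Q.span \<sigma>"
    using X by (meson Q.span_mono Q.span_minimal Q.subspace_span subset_antisym)
  ultimately show thesis
    using that X by blast
qed

lemma lattice_span_retraction:
  assumes "is_lattice N"
  obtains P where "qlinear P" "P ` N \<subseteq> N" "range P \<subseteq> Q.span \<sigma>" "\<forall>x\<in>Q.span \<sigma>. P x = x"
proof -
  obtain X where "finite X" "Q.span X = Q.span \<sigma>"
    using lattice_finite_span[OF assms] by metis
  then show thesis
    using lattice_retraction[OF assms] that by metis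
qed

text \<open>The integral form \<open>u\<close> with \<open>u e = 1\<close> certifies that
  \<open>e\<close> is primitive modulo the span of \<open>\<sigma>\<close>; up to sign this is the
  lattice normal of a facet.\<close>

lemma lattice_primitive:
  assumes "is_lattice N" "y \<notin> Q.span \<sigma>"
  obtains e u where "e \<in> N" "e \<in> Q.span (insert y \<sigma>)" "u \<in> dual_lattice N" "u \<in> perp \<sigma>" "u e = 1"
proof -
  obtain P where P: "qlinear P" "P ` N \<subseteq> N" "range P \<subseteq> Q.span \<sigma>" "\<forall>x\<in>Q.span \<sigma>. P x = x"
    using lattice_span_retraction[OF assms(1)] .
  show thesis
    by (rule lattice_retraction_step[OF assms(1) P assms(2)]) (rule that)
qed

section \<open>Dimensions\<close>

text \<open>A \<open>rat_vector\<close> type may have infinite dimension; the basis of the lattice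
  supplies the finite-dimensional locale from which the facts about \<open>Q.dim\<close> are
  drawn.\<close>

lemma lattice_finite_dim:
  assumes "is_lattice (N :: 'v::rat_vector set)"
  obtains B where "finite_dimensional_vector_space (scaleQ :: rat \<Rightarrow> 'v \<Rightarrow> 'v) B"
proof -
  obtain B where B: "finite B" "Q.independent B" "Q.span B = (UNIV :: 'v set)"
    using assms unfolding is_lattice_def by blast
  then show thesis
    by (intro that[of B]) (unfold_locales, auto)
qed

lemma
  fixes N S T :: "'v::rat_vector set"
  assumes "is_lattice N"
  shows lattice_dim_mono: "S \<subseteq> Q.span T \<Longrightarrow> Q.dim S \<le> Q.dim T"
    and lattice_dim_insert: "x \<notin> Q.span S \<Longrightarrow> Q.dim (insert x S) = Q.dim S + 1"
    and lattice_span_eqI: "S \<subseteq> Q.span T \<Longrightarrow> Q.dim T \<le> Q.dim S \<Longrightarrow> Q.span S = Q.span T"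
    and lattice_dim_le_UNIV: "Q.dim S \<le> Q.dim (UNIV :: 'v set)"
proof -
  obtain B where "finite_dimensional_vector_space (scaleQ :: rat \<Rightarrow> 'v \<Rightarrow> 'v) B"
    using lattice_finite_dim[OF assms] .
  then interpret fd: finite_dimensional_vector_space "scaleQ :: rat \<Rightarrow> 'v \<Rightarrow> 'v" B .
  show mono: "S \<subseteq> Q.span T \<Longrightarrow> Q.dim S \<le> Q.dim T"
    by (rule fd.dim_mono)
  show "x \<notin> Q.span S \<Longrightarrow> Q.dim (insert x S) = Q.dim S + 1"
    by (simp add: fd.dim_insert)
  show "Q.span S = Q.span T" if "S \<subseteq> Q.span T" "Q.dim T \<le> Q.dim S"
    using that Q.span_minimal[OF that(1)] by (intro fd.subspace_dim_equal) auto
  show "Q.dim S \<le> Q.dim (UNIV :: 'v set)"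
    by (rule fd.dim_mono) simp
qed

lemma facet_span_insert:
  fixes N \<sigma> \<tau> :: "'v::rat_vector set"
  assumes "is_lattice N" "facet \<sigma> \<tau>" "t \<in> Q.span \<tau>" "t \<notin> Q.span \<sigma>"
  shows "Q.span (insert t \<sigma>) = Q.span \<tau>"
proof (rule lattice_span_eqI[OF assms(1)])
  have "\<sigma> \<subseteq> \<tau>"
    using assms(2) face_subset by (auto simp: facet_def)
  then show "insert t \<sigma> \<subseteq> Q.span \<tau>"
    using assms(3) Q.span_superset by auto
  show "Q.dim \<tau> \<le> Q.dim (insert t \<sigma>)"
    using assms lattice_dim_insert[OF assms(1,4)] by (simp add: facet_def)
qed

lemma facet_exceeds:
  fixes N \<sigma> \<tau> :: "'v::rat_vector set"
  assumes "is_lattice N" "facet \<sigma> \<tau>"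
  obtains t where "t \<in> \<tau>" "t \<notin> Q.span \<sigma>"
proof -
  have "\<not> \<tau> \<subseteq> Q.span \<sigma>"
    using lattice_dim_mono[OF assms(1), of \<tau> \<sigma>] assms(2) by (auto simp: facet_def)
  then show thesis using that by blast
qed

section \<open>Lattice normals of facets\<close>

text \<open>A large multiple of a lattice point \<open>q\<close> in the relative interior moves any
  lattice point \<open>x\<close> of the span into \<open>\<sigma>\<close>, so \<open>x\<close> is a
  difference of two lattice points of \<open>\<sigma>\<close>.\<close>

lemma cone_lattice_eq:
  assumes "is_lattice N" "polyhedral_cone \<sigma>"
  shows "cone_lattice N \<sigma> = N \<inter> Q.span \<sigma>"
proof
  have "subgrp (N \<inter> Q.span \<sigma>)"
    using lattice_zero[OF assms(1)] lattice_diff[OF assms(1)]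
    by (auto simp: subgrp_def Q.span_zero Q.span_diff)
  then show "cone_lattice N \<sigma> \<subseteq> N \<inter> Q.span \<sigma>"
    unfolding cone_lattice_def by (intro hull_minimal) (auto simp: Q.span_base)
  show "N \<inter> Q.span \<sigma> \<subseteq> cone_lattice N \<sigma>"
  proof
    fix x assume x: "x \<in> N \<inter> Q.span \<sigma>"
    obtain p where p: "p \<in> rint \<sigma>"
      using rint_nonempty[OF assms(2)] .
    obtain k :: int where k: "0 < k" "of_int k *\<^sub>Q p \<in> N"
      using lattice_multiple[OF assms(1)] .
    define q where "q = of_int k *\<^sub>Q p"
    have q: "q \<in> rint \<sigma>" "q \<in> N"
      using rint_scale[OF assms(2) p] k by (auto simp: q_def)
    obtain k0 where k0: "\<And>k. k0 \<le> k \<Longrightarrow> x + k *\<^sub>Q q \<in> \<sigma>"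
      using rint_absorb[OF assms(2) q(1)] x by blast
    \<comment> \<open>The maximum with 0 keeps the subtrahend \<open>of_int j *\<^sub>Q q\<close> in
      \<open>\<sigma>\<close> as well.\<close>
    define j where "j = max 0 \<lceil>k0\<rceil>"
    have "k0 \<le> of_int j"
      by (simp add: j_def) linarith
    then have "x + of_int j *\<^sub>Q q \<in> \<sigma> \<inter> N"
      using k0 x q(2) by (auto intro: lattice_add[OF assms(1)] lattice_scale[OF assms(1)])
    moreover have "of_int j *\<^sub>Q q \<in> \<sigma> \<inter> N"
      using q by (auto simp: j_def rint_def intro: cone_scale[OF assms(2)] lattice_scale[OF assms(1)])
    ultimately have "(x + of_int j *\<^sub>Q q) - of_int j *\<^sub>Q q \<in> H" if "subgrp H" "\<sigma> \<inter> N \<subseteq> H" for H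
      using that unfolding subgrp_def by blast
    then have "x \<in> H" if "subgrp H" "\<sigma> \<inter> N \<subseteq> H" for H
      using that by simp
    then show "x \<in> cone_lattice N \<sigma>"
      unfolding cone_lattice_def hull_def by simp
  qed
qed

lemma coset_eq:
  assumes "subgrp B" "a - b \<in> B"
  shows "a +o B = b +o B"
proof -
  have sub: "x +o B \<subseteq> y +o B" if "x - y \<in> B" for x y
  proof
    fix z assume "z \<in> x +o B"
    then have "z - x \<in> B"
      by (rule set_plus_imp_minus)
    moreover have "y - x \<in> B"
      using assms(1) that unfolding subgrp_def by (metis diff_0 minus_diff_eq)
    ultimately have "(z - x) - (y - x) \<in> B"
      using assms(1) unfolding subgrp_def by blast
    moreover have "(z - x) - (y - x) = z - y"
      by simp
    ultimately show "z \<in> y +o B"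
      by (simp add: set_minus_plus[symmetric])
  qed
  moreover have "b - a \<in> B"
    using assms unfolding subgrp_def by (metis diff_0 minus_diff_eq)
  ultimately show ?thesis
    using assms(2) by blast
qed

lemma coset_eqD:
  assumes "subgrp B" "a +o B = b +o B"
  shows "a - b \<in> B"
proof -
  have "a + 0 \<in> a +o B"
    using assms(1) by (intro set_plus_intro2) (simp add: subgrp_def)
  then show ?thesis
    using assms(2) by (simp add: set_minus_plus)
qed

lemma subgrp_uminus: "subgrp B \<Longrightarrow> x \<in> B \<Longrightarrow> - x \<in> B"
  unfolding subgrp_def by (metis diff_0)

lemma subgrp_add: "subgrp B \<Longrightarrow> x \<in> B \<Longrightarrow> y \<in> B \<Longrightarrow> x + y \<in> B"
  using subgrp_uminus[of B y] unfolding subgrp_def by (metis diff_minus_eq_add)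

lemma subgrp_scale_nat: "subgrp B \<Longrightarrow> x \<in> B \<Longrightarrow> of_nat n *\<^sub>Q x \<in> B"
  by (induction n) (auto simp: subgrp_def subgrp_add scaleQ_add_left scaleQ_one)

lemma subgrp_scale: 
  assumes "subgrp B" "x \<in> B" 
  shows "of_int n *\<^sub>Q x \<in> B"
proof (cases n)
  case (nonneg k)
  then show ?thesis using subgrp_scale_nat[OF assms, of k] by simp
next
  case (neg k)
  have "- (of_nat (Suc k) *\<^sub>Q x) \<in> B"
    by (intro subgrp_uminus subgrp_scale_nat assms)
  moreover have "of_int n *\<^sub>Q x = - (of_nat (Suc k) *\<^sub>Q x)"
    by (simp only: neg of_int_minus of_int_of_nat_eq Q.scale_minus_left)
  ultimately show ?thesis by simp
qed

lemma subgrp_sum: "subgrp B \<Longrightarrow> (\<And>i. i \<in> I \<Longrightarrow> h i \<in> B) \<Longrightarrow> sum h I \<in> B"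
  by (induction I rule: infinite_finite_induct) (auto simp: subgrp_def subgrp_add)

text \<open>Resolves the definite description once and for all. The form \<open>g\<close> is the
  integral coordinate on the quotient by the span of \<open>\<sigma>\<close>, dual to
  \<open>e\<close> and oriented towards \<open>\<tau>\<close>, so later arguments on normals become
  computations with \<open>e\<close> and \<open>g\<close>.\<close>

lemma normal_gen:
  assumes "is_lattice N" "polyhedral_cone \<sigma>" "polyhedral_cone \<tau>" "facet \<sigma> \<tau>"
  obtains e g s where "normal_gen N \<tau> \<sigma> = e +o cone_lattice N \<sigma>" "e \<in> N" "e \<in> Q.span \<tau>"
    "g \<in> dual_lattice N" "g \<in> perp \<sigma>" "g e = 1" "\<forall>x\<in>\<tau>. 0 \<le> g x"
    "\<forall>x\<in>Q.span \<tau>. x - g x *\<^sub>Q e \<in> Q.span \<sigma>" "s \<in> Q.span \<sigma>" "e + s \<in> \<tau>"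
proof -
  have sub: "\<sigma> \<subseteq> \<tau>" and face: "face \<sigma> \<tau>"
    using assms(4) face_subset by (auto simp: facet_def)
  obtain t where t: "t \<in> \<tau>" "t \<notin> Q.span \<sigma>"
    using facet_exceeds[OF assms(1,4)] .
  have spt: "Q.span (insert t \<sigma>) = Q.span \<tau>"
    using facet_span_insert[OF assms(1,4)] t Q.span_base by blast
  obtain e' g' where eg': "e' \<in> N" "e' \<in> Q.span (insert t \<sigma>)" "g' \<in> dual_lattice N"
    "g' \<in> perp \<sigma>" "g' e' = 1"
    using lattice_primitive[OF assms(1) t(2)] .
  obtain h where h: "h \<in> dualQ" "\<forall>x\<in>\<tau>. 0 \<le> h x" "\<sigma> = {x \<in> \<tau>. h x = 0}"
    using face by (auto simp: face_def)
  have h\<sigma>: "h \<in> perp \<sigma>"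
    using h by (auto simp: perp_def)
  have g'\<sigma>: "x \<in> Q.span \<sigma> \<Longrightarrow> g' x = 0" for x
    using perp_span_zero[OF eg'(4)] .
  have dl_neg: "- g' \<in> dual_lattice N" "- g' \<in> perp \<sigma>"
    using eg'(3) Q.subspace_neg[OF subspace_dualQ, of g'] Q.subspace_neg[OF subspace_perp eg'(4)]
    by (auto simp: dual_lattice_def)
  have g'd: "g' \<in> dualQ"
    using eg'(4) by (rule perp_dualQ)
  have "g' t \<noteq> 0"
  proof
    assume "g' t = 0"
    then have "\<forall>x\<in>insert t \<sigma>. g' x = 0"
      using g'\<sigma> Q.span_base by blast
    then have "g' e' = 0"
      using dualQ_span_zero[OF g'd _ eg'(2)] by blast
    then show False
      using eg'(5) by simp
  qed
  \<comment> \<open>The primitive vector is determined only up to sign; \<open>d\<close> picks the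
    sign making the form positive at \<open>t\<close>, that is, on the side of
    \<open>\<tau>\<close>.\<close>
  define d :: rat where "d = (if 0 < g' t then 1 else - 1)"
  define e where "e = d *\<^sub>Q e'"
  define g where "g = d *\<^sub>Q g'"
  have gd: "g \<in> dualQ" "g \<in> perp \<sigma>"
    unfolding g_def by (intro Q.subspace_scale subspace_dualQ g'd subspace_perp eg')+
  have eg: "e \<in> N" "e \<in> Q.span \<tau>" "g \<in> dual_lattice N" "g e = 1" "0 < g t"
  proof -
    show "e \<in> N"
      using lattice_scale[OF assms(1) eg'(1), of 1] lattice_scale[OF assms(1) eg'(1), of "- 1"]
      by (simp add: e_def d_def)
    show "e \<in> Q.span \<tau>"
      using eg'(2) by (simp add: e_def spt Q.span_scale)
    show "g \<in> dual_lattice N"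
      using eg'(3) dl_neg by (simp add: g_def d_def scaleQ_one)
    show "g e = 1" "0 < g t"
      using eg'(5) g'd \<open>g' t \<noteq> 0\<close> by (auto simp: g_def d_def e_def dualQ_simps)
  qed
  have decomp: "x - g x *\<^sub>Q e \<in> Q.span \<sigma>" if "x \<in> Q.span \<tau>" for x
  proof -
    have "e \<notin> Q.span \<sigma>"
      using perp_span_zero[OF gd(2)] eg(4) by auto
    then have "Q.span (insert e \<sigma>) = Q.span \<tau>"
      using facet_span_insert[OF assms(1,4)] eg(2) by blast
    then have "x \<in> Q.span (insert e \<sigma>)"
      using that by simp
    then obtain r where r: "x - r *\<^sub>Q e \<in> Q.span \<sigma>"
      by (auto simp: Q.span_breakdown_eq)
    then have "g (x - r *\<^sub>Q e) = 0"
      by (rule perp_span_zero[OF gd(2)])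
    then have "g x = r"
      using gd(1) eg(4) by (simp add: dualQ_simps)
    then show ?thesis using r by simp
  qed
  \<comment> \<open>Both forms vanish on \<open>\<sigma>\<close>, whose span is a hyperplane in that
    of \<open>\<tau>\<close>, so \<open>h\<close> is a multiple of \<open>g\<close> there. The
    values at \<open>t\<close> show that the multiple is positive, and \<open>g\<close> inherits
    nonnegativity on \<open>\<tau>\<close>.\<close>
  have hg: "h x = g x * h e" if "x \<in> Q.span \<tau>" for x
    using perp_span_zero[OF h\<sigma> decomp[OF that]] h(1) by (simp add: dualQ_simps)
  have "h t = g t * h e" "0 \<le> h t"
    using hg[OF Q.span_base[OF t(1)]] h(2) t(1) by auto
  moreover have "h t \<noteq> 0"
    using h(3) t Q.span_base[of t \<sigma>] by auto
  ultimately have "0 < g t * h e"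
    by linarith
  then have he: "0 < h e"
    using eg(5) zero_less_mult_pos by blast
  have nonneg: "0 \<le> g x" if "x \<in> \<tau>" for x
  proof -
    have "0 \<le> g x * h e"
      using hg[OF Q.span_base[OF that]] bspec[OF h(2) that] by simp
    then show ?thesis
      using he by (simp add: zero_le_mult_iff)
  qed
  \<comment> \<open>The coset of \<open>e\<close> must meet \<open>\<tau>\<close>: \<open>e\<close>
    differs from a positive multiple of \<open>t\<close> by a vector of the span of
    \<open>\<sigma>\<close>, which an integral multiple of the interior lattice point
    \<open>q\<close> absorbs without leaving the coset.\<close>
  obtain p where p: "p \<in> rint \<sigma>"
    using rint_nonempty[OF assms(2)] .
  obtain k :: int where k: "0 < k" "of_int k *\<^sub>Q p \<in> N"
    using lattice_multiple[OF assms(1)] .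
  define q where "q = of_int k *\<^sub>Q p"
  have q: "q \<in> rint \<sigma>" "q \<in> N"
    using rint_scale[OF assms(2) p] k by (auto simp: q_def)
  have "t - g t *\<^sub>Q e \<in> Q.span \<sigma>"
    using decomp t(1) Q.span_base by blast
  then have "e - (1 / g t) *\<^sub>Q t \<in> Q.span \<sigma>"
    using Q.span_scale[of "t - g t *\<^sub>Q e" \<sigma> "- (1 / g t)"] eg(5)
    by (simp add: Q.scale_right_diff_distrib scaleQ_scaleQ scaleQ_one)
  then obtain k0 where k0: "\<And>k. k0 \<le> k \<Longrightarrow> e - (1 / g t) *\<^sub>Q t + k *\<^sub>Q q \<in> \<sigma>"
    using rint_absorb[OF assms(2) q(1)] by blast
  define j where "j = \<lceil>k0\<rceil>"
  have "e - (1 / g t) *\<^sub>Q t + of_int j *\<^sub>Q q \<in> \<tau>"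
    using k0[of "of_int j"] sub by (auto simp: j_def)
  then have "(1 / g t) *\<^sub>Q t + (e - (1 / g t) *\<^sub>Q t + of_int j *\<^sub>Q q) \<in> \<tau>"
    using t(1) eg(5) by (intro cone_add[OF assms(3) cone_scale[OF assms(3)]]) auto
  then have mem: "e + of_int j *\<^sub>Q q \<in> \<tau>"
    by (simp add: algebra_simps)
  have qs: "of_int j *\<^sub>Q q \<in> N \<inter> Q.span \<sigma>"
    using q by (auto simp: rint_def intro: lattice_scale[OF assms(1)] Q.span_scale Q.span_base)
  note cl = cone_lattice_eq[OF assms(1,2)] cone_lattice_eq[OF assms(1,3)]
  have sg: "subgrp (N \<inter> Q.span \<sigma>)"
    using lattice_zero[OF assms(1)] lattice_diff[OF assms(1)]
    by (auto simp: subgrp_def Q.span_zero Q.span_diff)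
  have intg: "\<exists>k::int. g x = of_int k" if "x \<in> N" for x
    using eg(3) that by (auto simp: dual_lattice_def elim: Ints_cases)
  have "normal_gen N \<tau> \<sigma> = e +o cone_lattice N \<sigma>"
    unfolding normal_gen_def
  proof (rule the_equality)
    show "\<exists>v\<in>cone_lattice N \<tau>. e +o cone_lattice N \<sigma> = v +o cone_lattice N \<sigma> \<and>
        (\<forall>w\<in>cone_lattice N \<tau>. \<exists>k::int. w \<in> (of_int k *\<^sub>Q v) +o cone_lattice N \<sigma>) \<and>
        e +o cone_lattice N \<sigma> \<inter> \<tau> \<noteq> {}"
    proof (intro bexI[of _ e] conjI refl ballI)
      fix w assume w: "w \<in> cone_lattice N \<tau>"
      then obtain k :: int where k: "g w = of_int k"
        using intg[of w] cl by blast
      then have "w - of_int k *\<^sub>Q e \<in> N \<inter> Q.span \<sigma>"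
        using decomp[of w] w k cl eg(1)
        by (auto intro: lattice_diff[OF assms(1)] lattice_scale[OF assms(1)])
      then show "\<exists>k::int. w \<in> (of_int k *\<^sub>Q e) +o cone_lattice N \<sigma>"
        unfolding cl by (intro exI[of _ k]) (simp add: set_minus_plus[symmetric])
    next
      show "e +o cone_lattice N \<sigma> \<inter> \<tau> \<noteq> {}"
        using mem set_plus_intro2[OF qs, of e] unfolding cl by blast
      show "e \<in> cone_lattice N \<tau>"
        using eg cl by simp
    qed
  next
    fix C
    assume "\<exists>v\<in>cone_lattice N \<tau>. C = v +o cone_lattice N \<sigma> \<and>
        (\<forall>w\<in>cone_lattice N \<tau>. \<exists>k::int. w \<in> (of_int k *\<^sub>Q v) +o cone_lattice N \<sigma>) \<and>
        C \<inter> \<tau> \<noteq> {}"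
    then obtain v where v: "v \<in> N \<inter> Q.span \<tau>" "C = v +o (N \<inter> Q.span \<sigma>)"
      "\<forall>w\<in>N \<inter> Q.span \<tau>. \<exists>k::int. w \<in> (of_int k *\<^sub>Q v) +o (N \<inter> Q.span \<sigma>)" "C \<inter> \<tau> \<noteq> {}"
      unfolding cl by blast
    obtain k :: int where "e \<in> (of_int k *\<^sub>Q v) +o (N \<inter> Q.span \<sigma>)"
      using v(3) eg(1,2) by blast
    then have "e - of_int k *\<^sub>Q v \<in> Q.span \<sigma>"
      using set_plus_imp_minus by blast
    then have "g (e - of_int k *\<^sub>Q v) = 0"
      by (rule perp_span_zero[OF gd(2)])
    then have kv: "of_int k * g v = 1"
      using gd(1) eg(4) by (simp add: dualQ_simps)
    obtain x where "x \<in> C" "x \<in> \<tau>"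
      using v(4) by blast
    then have "x - v \<in> Q.span \<sigma>" 
      using set_plus_imp_minus[of x v] v(2) by blast
    then have "g (x - v) = 0"
      by (rule perp_span_zero[OF gd(2)])
    then have gv: "0 \<le> g v"
      using nonneg[OF \<open>x \<in> \<tau>\<close>] gd(1) by (simp add: dualQ_simps)
    obtain l :: int where l: "g v = of_int l"
      using intg v(1) by blast
    \<comment> \<open>Any generator has an invertible integer as its \<open>g\<close>-coordinate,
      and since its coset meets \<open>\<tau>\<close>, this integer is 1.\<close>
    have "k * l = 1"
      using kv unfolding l by (metis of_int_eq_1_iff of_int_mult)
    then have "l = 1"
      using gv unfolding l by (auto simp: zmult_eq_1_iff)
    then have "v - e \<in> Q.span \<sigma>"
      using decomp[of v] v(1) l by (simp add: scaleQ_one)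
    then have "v - e \<in> N \<inter> Q.span \<sigma>"
      using v(1) eg(1) lattice_diff[OF assms(1)] by simp
    then show "C = e +o cone_lattice N \<sigma>"
      unfolding cl v(2) by (rule coset_eq[OF sg])
  qed
  then show thesis
    using that[of e g "of_int j *\<^sub>Q q"] eg gd decomp nonneg mem qs by blast
qed

section \<open>Complements\<close>

text \<open>Restriction to a basis \<open>C\<close> of the span of \<open>\<sigma>\<close> has
  kernel \<open>perp \<sigma>\<close>, so it is injective on \<open>\<Psi> \<sigma>\<close>. The
  dimension of \<open>\<Psi> \<sigma>\<close> is \<open>card C\<close>, hence some \<open>p\<close>
  in it agrees with \<open>u\<close> on \<open>\<sigma>\<close>, and \<open>w\<close> is
  \<open>u - p\<close>.\<close>

lemma complement_exists:
  fixes N :: "'v::rat_vector set"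
  assumes "is_lattice N" "complements \<Sigma> \<Psi>" "\<sigma> \<in> \<Sigma>" "u \<in> dualQ"
  obtains w where "w \<in> perp (\<sigma> :: 'v set)" "u - w \<in> \<Psi> \<sigma>"
proof -
  have \<Psi>: "Q.subspace (\<Psi> \<sigma>)" "\<Psi> \<sigma> \<subseteq> dualQ" "Q.dim (\<Psi> \<sigma>) = Q.dim \<sigma>" "\<Psi> \<sigma> \<inter> perp \<sigma> = {0}"
    using assms(2,3) by (auto simp: complements_def)
  obtain C where C: "finite C" "C \<subseteq> \<sigma>" "Q.independent C" "Q.span C = Q.span \<sigma>"
    using lattice_finite_span[OF assms(1)] .
  obtain P where P: "P \<subseteq> \<Psi> \<sigma>" "Q.independent P" "\<Psi> \<sigma> \<subseteq> Q.span P" "card P = Q.dim (\<Psi> \<sigma>)"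
    using Q.basis_exists[of "\<Psi> \<sigma>"] by blast
  have spP: "Q.span P = \<Psi> \<sigma>"
    using P(1,3) \<Psi>(1) by (rule Q.span_subspace)
  \<comment> \<open>Extension by 0 outside \<open>C\<close> keeps restrictions in the type of
    functions on \<open>'v\<close>, inside the span of the indicator functions \<open>E\<close> of
    points of \<open>C\<close>.\<close>
  define R where "R = (\<lambda>(f :: 'v \<Rightarrow> rat) x. if x \<in> C then f x else 0)"
  have linR: "qlinear R"
    by (auto simp: R_def Vector_Spaces.linear_iff Q.vector_space_axioms)
  have R0: "f \<in> perp \<sigma>" if "f \<in> dualQ" "R f = 0" for f
  proof -
    have "\<forall>x\<in>C. f x = 0"
      using that(2) by (auto simp: R_def fun_eq_iff split: if_splits)
    then have "f \<in> perp C"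
      using that(1) by (simp add: perp_def)
    then show ?thesis
      using C(4) by (metis perp_span)
  qed
  have "inj_on R (Q.span P)"
  proof (rule inj_onI)
    fix f g assume fg: "f \<in> Q.span P" "g \<in> Q.span P" "R f = R g"
    then have "f - g \<in> \<Psi> \<sigma>"
      using \<Psi>(1) by (simp add: spP Q.subspace_diff)
    moreover have "R (f - g) = 0"
      using fg(3) linR by (simp add: QQ.linear_diff)
    ultimately have "f - g \<in> \<Psi> \<sigma> \<inter> perp \<sigma>"
      using R0 \<Psi>(2) by blast
    then show "f = g"
      using \<Psi>(4) by simp
  qed
  then have ind: "Q.independent (R ` P)" and inj: "inj_on R P"
    using QQ.linear_independent_injective_image[OF linR P(2)] inj_on_subset Q.span_superset
    by blast+
  define E where "E = (\<lambda>c x. if x = c then 1 else 0 :: rat) ` C"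
  have RE: "R f \<in> Q.span E" for f
  proof -
    have "R f = (\<Sum>c\<in>C. f c *\<^sub>Q (\<lambda>x. if x = c then 1 else 0))"
    proof
      fix x
      have "(\<Sum>c\<in>C. f c *\<^sub>Q (\<lambda>x. if x = c then 1 else 0)) x = (\<Sum>c\<in>C. if x = c then f c else 0)"
        by (auto simp: sum_fun_apply intro!: sum.cong)
      then show "R f x = (\<Sum>c\<in>C. f c *\<^sub>Q (\<lambda>x. if x = c then 1 else 0)) x"
        using C(1) by (simp add: R_def)
    qed
    moreover have "\<dots> \<in> Q.span E"
      by (rule Q.span_sum, rule Q.span_scale, rule Q.span_base, simp add: E_def)
    ultimately show ?thesis
      by (simp only:)
  qed
  have "card C = Q.dim \<sigma>"
    using Q.dim_eq_card_independent[OF C(3)] C(4) by (metis Q.dim_span)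
  then have cardE: "card E \<le> card P" "finite E"
    using P(4) \<Psi>(3) card_image_le[OF C(1)] C(1) by (auto simp: E_def)
  have "R u \<in> Q.span (R ` P)"
  proof (rule ccontr)
    \<comment> \<open>Then \<open>R u\<close> would enlarge the independent image of
      \<open>P\<close> to more than \<open>card E\<close> independent vectors in the span of
      \<open>E\<close>.\<close>
    assume not: "R u \<notin> Q.span (R ` P)"
    then have indu: "Q.independent (insert (R u) (R ` P))"
      using ind by (rule Q.independent_insertI)
    have "insert (R u) (R ` P) \<subseteq> Q.span E"
      by (intro insert_subsetI RE image_subsetI)
    then have fin: "finite (insert (R u) (R ` P))" and le: "card (insert (R u) (R ` P)) \<le> card E"
      using Q.independent_span_bound[OF cardE(2) indu] by simp_all
    have "R u \<notin> R ` P"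
      using not Q.span_base[of "R u" "R ` P"] by auto
    then have "card (insert (R u) (R ` P)) = card P + 1"
      using fin card_image[OF inj] by simp
    then show False
      using le cardE(1) by simp
  qed
  then have "R u \<in> R ` \<Psi> \<sigma>"
    by (simp only: QQ.linear_span_image[OF linR] spP)
  then obtain p where p: "p \<in> \<Psi> \<sigma>" "R u = R p"
    by blast
  have "R (u - p) = 0"
    using p(2) linR by (simp add: QQ.linear_diff)
  moreover have "u - p \<in> dualQ"
    using assms(4) p(1) \<Psi>(2) subspace_dualQ by (blast intro: Q.subspace_diff)
  ultimately show thesis
    using R0[of "u - p"] that[of "u - p"] p(1) by simp
qed

lemma proj_eqI:
  assumes "complements \<Sigma> \<Psi>" "\<sigma> \<in> \<Sigma>" "w \<in> perp \<sigma>" "u - w \<in> \<Psi> \<sigma>"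
  shows "proj \<Psi> \<sigma> u = w"
  unfolding proj_def
proof (rule the_equality)
  have \<Psi>: "Q.subspace (\<Psi> \<sigma>)" "\<Psi> \<sigma> \<inter> perp \<sigma> = {0}"
    using assms(1,2) by (auto simp: complements_def)
  fix w' assume w': "w' \<in> perp \<sigma> \<and> u - w' \<in> \<Psi> \<sigma>"
  have "(u - w) - (u - w') \<in> \<Psi> \<sigma>"
    using assms(4) w' by (blast intro: Q.subspace_diff[OF \<Psi>(1)])
  moreover have "w' - w \<in> perp \<sigma>"
    using assms(3) w' by (blast intro: Q.subspace_diff[OF subspace_perp])
  ultimately have "w' - w \<in> \<Psi> \<sigma> \<inter> perp \<sigma>"
    by simp
  then show "w' = w"
    using \<Psi>(2) by simp
qed (use assms in simp)

lemma
  fixes N \<sigma> :: "'v::rat_vector set"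
  assumes "is_lattice N" "complements \<Sigma> \<Psi>" "\<sigma> \<in> \<Sigma>" "u \<in> dualQ"
  shows proj_perp: "proj \<Psi> \<sigma> u \<in> perp \<sigma>" and proj_complement: "u - proj \<Psi> \<sigma> u \<in> \<Psi> \<sigma>"
proof -
  obtain w where w: "w \<in> perp \<sigma>" "u - w \<in> \<Psi> \<sigma>"
    using complement_exists[OF assms] .
  moreover have "proj \<Psi> \<sigma> u = w"
    by (rule proj_eqI[OF assms(2,3) w])
  ultimately show "proj \<Psi> \<sigma> u \<in> perp \<sigma>" "u - proj \<Psi> \<sigma> u \<in> \<Psi> \<sigma>"
    by auto
qed

text \<open>Changing \<open>u\<close> by \<open>r\<close> in \<open>perp \<tau>\<close> changes its
  projection by \<open>r\<close>, which vanishes on the span of \<open>\<tau>\<close>, and the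
  projection itself vanishes on \<open>cone_lattice N \<sigma>\<close>; so \<open>the_elem\<close>
  is applied to a singleton.\<close>

lemma pairing_proj:
  fixes N \<sigma> \<tau> :: "'v::rat_vector set"
  assumes "is_lattice N" "complements \<Sigma> \<Psi>" "\<sigma> \<in> \<Sigma>" "polyhedral_cone \<sigma>" "\<sigma> \<subseteq> \<tau>" "u \<in> dualQ"
    "e \<in> Q.span \<tau>"
  shows "pairing (proj \<Psi> \<sigma> ` (u +o perp \<tau>)) (e +o cone_lattice N \<sigma>) = proj \<Psi> \<sigma> u e"
proof -
  let ?w = "proj \<Psi> \<sigma> u"
  note w = proj_perp[OF assms(1-3,6)] proj_complement[OF assms(1-3,6)]
  have shift: "proj \<Psi> \<sigma> (u + r) = ?w + r" if "r \<in> perp \<tau>" for r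
  proof (rule proj_eqI[OF assms(2,3)])
    have "r \<in> perp \<sigma>"
      using that assms(5) by (auto simp: perp_def)
    then show "?w + r \<in> perp \<sigma>"
      using w(1) by (intro Q.subspace_add[OF subspace_perp])
    show "u + r - (?w + r) \<in> \<Psi> \<sigma>"
      using w(2) by simp
  qed
  have val: "proj \<Psi> \<sigma> (u + r) (e + s) = ?w e" if "r \<in> perp \<tau>" "s \<in> cone_lattice N \<sigma>" for r s
  proof -
    have s: "s \<in> Q.span \<sigma>"
      using that(2) cone_lattice_eq[OF assms(1,4)] by simp
    then have "s \<in> Q.span \<tau>"
      using assms(5) Q.span_mono by blast
    then have "r (e + s) = 0"
      using assms(7) by (intro perp_span_zero[OF that(1)] Q.span_add)
    moreover have "?w (e + s) = ?w e"
      using perp_span_zero[OF w(1) s] perp_dualQ[OF w(1)] by (simp add: dualQ_simps)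
    ultimately show ?thesis
      using shift[OF that(1)] by simp
  qed
  have "0 \<in> perp \<tau>" "0 \<in> cone_lattice N \<sigma>"
    using Q.subspace_0[OF subspace_perp] cone_lattice_eq[OF assms(1,4)] lattice_zero[OF assms(1)]
    by (auto simp: Q.span_zero)
  then have "{f v |f v. f \<in> proj \<Psi> \<sigma> ` (u +o perp \<tau>) \<and> v \<in> e +o cone_lattice N \<sigma>} = {?w e}"
    using val by (fastforce simp: elt_set_plus_def)
  then show ?thesis
    by (simp add: pairing_def)
qed

section \<open>Lattice indices\<close>

lemma subgrp_perp_dual_lattice: "subgrp (perp \<sigma> \<inter> dual_lattice N)"
  using Q.subspace_0[OF subspace_perp, of \<sigma>] Q.subspace_0[OF subspace_dualQ]
    Q.subspace_diff[OF subspace_perp, of _ \<sigma>] Q.subspace_diff[OF subspace_dualQ]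
  by (auto simp: subgrp_def dual_lattice_def)

lemma subgrp_dual_map:
  assumes "subgrp A"
  shows "subgrp (dual_map \<phi> ` A)"
proof -
  have "dual_map \<phi> 0 = 0" "dual_map \<phi> (a - b) = dual_map \<phi> a - dual_map \<phi> b" for a b
    by (auto simp: dual_map_def fun_eq_iff)
  note dm = this
  show ?thesis
    unfolding subgrp_def
  proof (intro conjI ballI)
    show "0 \<in> dual_map \<phi> ` A"
      using assms dm(1) unfolding subgrp_def by force
    fix x y assume "x \<in> dual_map \<phi> ` A" "y \<in> dual_map \<phi> ` A"
    then obtain a b where "a \<in> A" "b \<in> A" "x = dual_map \<phi> a" "y = dual_map \<phi> b"
      by blast
    then show "x - y \<in> dual_map \<phi> ` A"
      using assms dm(2)[of a b] unfolding subgrp_def by (auto intro!: image_eqI[of _ _ "a - b"])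
  qed
qed

text \<open>The index is multiplicative along the map of short exact sequences given by a homomorphism
  \<open>f\<close> from \<open>A\<close> onto \<open>\<int>\<close> that maps \<open>C\<close> onto \<open>m \<int>\<close>.\<close>

lemma lattice_index_mult:
  fixes A C :: "'a::rat_vector set" and f :: "'a \<Rightarrow> int"
  assumes A: "subgrp A" and C: "subgrp C" "C \<subseteq> A"
    and f: "\<And>x y. x \<in> A \<Longrightarrow> y \<in> A \<Longrightarrow> f (x + y) = f x + f y"
    and g: "g \<in> A" "f g = 1" and c: "c \<in> C" "f c = int m" "0 < m"
    and dvd: "\<And>x. x \<in> C \<Longrightarrow> int m dvd f x"
  defines "B \<equiv> {a \<in> A. f a = 0}"
  shows "lattice_index A C = m * lattice_index B (C \<inter> B)"
proof -
  have f0: "f 0 = 0"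
    using f[of 0 0] A by (simp add: subgrp_def)
  have fneg: "f (- x) = - f x" if "x \<in> A" for x
    using f[of x "- x"] that subgrp_uminus[OF A that] f0 by simp
  have fdiff: "f (x - y) = f x - f y" if "x \<in> A" "y \<in> A" for x y
    using f[of x "- y"] that subgrp_uminus[OF A] fneg by simp
  have fnat: "f (of_nat n *\<^sub>Q x) = int n * f x" if "x \<in> A" for n x
  proof (induction n)
    case (Suc n)
    then show ?case
      using f[OF that subgrp_scale_nat[OF A that, of n]]
      by (simp add: scaleQ_add_left scaleQ_one algebra_simps)
  qed (simp add: f0)
  have fint: "f (of_int n *\<^sub>Q x) = n * f x" if "x \<in> A" for n x
  proof (cases n)
    case (nonneg k)
    then show ?thesis using fnat[OF that, of k] by simp
  next
    case (neg k)
    have "of_int n *\<^sub>Q x = - (of_nat (Suc k) *\<^sub>Q x)"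
      by (simp only: neg of_int_minus of_int_of_nat_eq Q.scale_minus_left)
    then have "f (of_int n *\<^sub>Q x) = - f (of_nat (Suc k) *\<^sub>Q x)"
      using fneg[OF subgrp_scale_nat[OF A that, of "Suc k"]] by (simp only:)
    also have "\<dots> = n * f x"
      by (simp only: fnat[OF that] neg mult_minus_left)
    finally show ?thesis .
  qed
  have B: "subgrp B"
    using A f0 fdiff by (auto simp: subgrp_def B_def)
  have CB: "subgrp (C \<inter> B)"
    using C(1) B by (auto simp: subgrp_def)
  have scA: "of_int r *\<^sub>Q g \<in> A" for r
    by (rule subgrp_scale[OF A g(1)])
  have BA: "b \<in> A" "f b = 0" if "b \<in> B" for b
    using that by (auto simp: B_def)
  have absorb: "C \<inter> B + C = C"
  proof
    show "C \<inter> B + C \<subseteq> C"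
      using subgrp_add[OF C(1)] by (auto elim!: set_plus_elim)
    show "C \<subseteq> C \<inter> B + C"
      using CB by (intro set_zero_plus2) (simp add: subgrp_def)
  qed
  \<comment> \<open>A coset of \<open>C\<close> in \<open>A\<close> is encoded by the remainder
    \<open>r\<close> of its \<open>f\<close>-values modulo \<open>m\<close> and a coset in
    \<open>B\<close>, with \<open>g\<close> as a section of \<open>f\<close>. Working with whole
    sets avoids choosing representatives.\<close>
  define F where "F = (\<lambda>(X, r). (of_int r *\<^sub>Q g) +o (X + C))"
  have F: "F (b +o (C \<inter> B), r) = (of_int r *\<^sub>Q g + b) +o C" for b r
    by (simp add: F_def set_plus_rearrange3 set_plus_rearrange2 absorb)
  have "bij_betw F (cosets B (C \<inter> B) \<times> {0..<int m}) (cosets A C)"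
    unfolding bij_betw_def
  proof
    show "inj_on F (cosets B (C \<inter> B) \<times> {0..<int m})"
    proof (rule inj_onI, clarify)
      fix X Y r s
      assume X: "X \<in> cosets B (C \<inter> B)" and Y: "Y \<in> cosets B (C \<inter> B)"
        and rs: "r \<in> {0..<int m}" "s \<in> {0..<int m}" and eq: "F (X, r) = F (Y, s)"
      obtain x y where xy: "x \<in> B" "X = x +o (C \<inter> B)" "y \<in> B" "Y = y +o (C \<inter> B)"
        using X Y by (auto simp: cosets_def)
      have inC: "(of_int r *\<^sub>Q g + x) - (of_int s *\<^sub>Q g + y) \<in> C"
        using eq unfolding xy F by (rule coset_eqD[OF C(1)])
      have "f ((of_int r *\<^sub>Q g + x) - (of_int s *\<^sub>Q g + y)) = r - s"
        using BA[OF xy(1)] BA[OF xy(3)] scA subgrp_add[OF A] by (simp add: fdiff f fint g)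
      then have "int m dvd r - s"
        using dvd[OF inC] by simp
      then have "r mod int m = s mod int m"
        by (simp add: mod_eq_dvd_iff)
      then have "r = s"
        using rs by simp
      then have "x - y \<in> C \<inter> B"
        using inC xy B by (simp add: subgrp_def)
      then show "X = Y \<and> r = s"
        using \<open>r = s\<close> coset_eq[OF CB] xy by simp
    qed
    show "F ` (cosets B (C \<inter> B) \<times> {0..<int m}) = cosets A C"
    proof (intro equalityI subsetI)
      fix Z assume "Z \<in> F ` (cosets B (C \<inter> B) \<times> {0..<int m})"
      then obtain b r where "b \<in> B" "Z = F (b +o (C \<inter> B), r)"
        by (auto simp: cosets_def)
      then show "Z \<in> cosets A C"
        using scA BA(1) subgrp_add[OF A] by (auto simp: F cosets_def)
    next
      fix Z assume "Z \<in> cosets A C"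
      then obtain a where a: "a \<in> A" "Z = a +o C"
        by (auto simp: cosets_def)
      define q where "q = f a div int m"
      define r where "r = f a mod int m"
      \<comment> \<open>Since \<open>f a = r + q * int m\<close>, subtracting these multiples of
        \<open>g\<close> and \<open>c\<close> lands in the kernel \<open>B\<close>; the multiple of
        \<open>c\<close> does not change the coset of \<open>C\<close>.\<close>
      define b where "b = a - (of_int r *\<^sub>Q g + of_int q *\<^sub>Q c)"
      have qc: "of_int q *\<^sub>Q c \<in> C"
        by (rule subgrp_scale[OF C(1) c(1)])
      then have "of_int r *\<^sub>Q g + of_int q *\<^sub>Q c \<in> A"
        using C(2) scA subgrp_add[OF A] by blast
      moreover have "f (of_int r *\<^sub>Q g + of_int q *\<^sub>Q c) = r + q * int m"
        using C(2) c scA qc g by (subst f) (auto simp: fint)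
      ultimately have "b \<in> B"
        using a(1) A unfolding b_def B_def
        by (auto simp: fdiff q_def r_def subgrp_def)
      moreover have "Z = F (b +o (C \<inter> B), r)"
        unfolding a(2) F b_def using qc by (intro coset_eq[OF C(1)]) simp
      moreover have "r \<in> {0..<int m}"
        using c(3) by (simp add: r_def)
      ultimately show "Z \<in> F ` (cosets B (C \<inter> B) \<times> {0..<int m})"
        by (auto simp: cosets_def)
    qed
  qed
  \<comment> \<open>The bijection also covers infinite index, where \<open>card\<close> is 0 on both
    sides.\<close>
  then have "card (cosets A C) = card (cosets B (C \<inter> B) \<times> {0..<int m})"
    by (simp add: bij_betw_same_card)
  then show ?thesis
    by (simp add: lattice_index_def card_cartesian_product)
qed

text \<open>Pigeonhole: two natural multiples of \<open>a\<close> fall into the same one of finitely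
  many cosets.\<close>

lemma lattice_index_nonzero_multiple:
  fixes A C :: "'a::rat_vector set"
  assumes "subgrp A" "subgrp C" "lattice_index A C \<noteq> 0" "a \<in> A"
  obtains k :: int where "0 < k" "of_int k *\<^sub>Q a \<in> C"
proof -
  have "finite (cosets A C)"
    using assms(3) unfolding lattice_index_def by (metis card.infinite)
  moreover have "range (\<lambda>n::nat. (of_nat n *\<^sub>Q a) +o C) \<subseteq> cosets A C"
    using subgrp_scale_nat[OF assms(1,4)] by (auto simp: cosets_def)
  ultimately have "finite (range (\<lambda>n::nat. (of_nat n *\<^sub>Q a) +o C))"
    using finite_subset by blast
  then have "\<not> inj (\<lambda>n::nat. (of_nat n *\<^sub>Q a) +o C)"
    by (metis finite_imageD infinite_UNIV_nat)
  then obtain m n :: nat where "m < n" "(of_nat n *\<^sub>Q a) +o C = (of_nat m *\<^sub>Q a) +o C"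
    unfolding inj_def by (metis linorder_neqE_nat)
  then have "of_nat n *\<^sub>Q a - of_nat m *\<^sub>Q a \<in> C"
    using coset_eqD[OF assms(2)] by blast
  then have "of_int (int n - int m) *\<^sub>Q a \<in> C"
    by (simp add: Q.scale_left_diff_distrib)
  then show thesis
    using that[of "int n - int m"] \<open>m < n\<close> by simp
qed

text \<open>Reducing the integral coefficients modulo \<open>k\<close> changes an element only by
  \<open>C\<close>, so the finitely many coefficient vectors with entries in \<open>{0..<k}\<close>
  represent all cosets.\<close>

lemma lattice_index_nonzero:
  fixes A C :: "'a::rat_vector set"
  assumes A: "subgrp A" and C: "subgrp C" and I: "finite I"
    and gen: "\<And>a. a \<in> A \<Longrightarrow> \<exists>z :: 'i \<Rightarrow> int. a = (\<Sum>i\<in>I. of_int (z i) *\<^sub>Q h i)"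
    and k: "0 < (k :: int)" "\<And>i. i \<in> I \<Longrightarrow> of_int k *\<^sub>Q h i \<in> C"
  shows "lattice_index A C \<noteq> 0"
proof -
  let ?Z = "PiE I (\<lambda>_. {0..<k})"
  have "cosets A C \<subseteq> (\<lambda>z. (\<Sum>i\<in>I. of_int (z i) *\<^sub>Q h i) +o C) ` ?Z"
  proof
    fix X assume "X \<in> cosets A C"
    then obtain a where a: "a \<in> A" "X = a +o C"
      by (auto simp: cosets_def)
    obtain z where z: "a = (\<Sum>i\<in>I. of_int (z i) *\<^sub>Q h i)"
      using gen[OF a(1)] by blast
    define y where "y = (\<lambda>i\<in>I. z i mod k)"
    have y: "y \<in> ?Z"
      using k(1) by (auto simp: y_def)
    have "a - (\<Sum>i\<in>I. of_int (y i) *\<^sub>Q h i) = (\<Sum>i\<in>I. of_int (z i - y i) *\<^sub>Q h i)"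
      by (simp add: z Q.scale_left_diff_distrib sum_subtractf)
    also have "\<dots> \<in> C"
    proof (rule subgrp_sum[OF C])
      fix i assume i: "i \<in> I"
      have "z i - y i = (z i div k) * k"
        using i by (simp add: y_def minus_mod_eq_div_mult)
      then have "of_int (z i - y i) *\<^sub>Q h i = of_int (z i div k) *\<^sub>Q of_int k *\<^sub>Q h i"
        by (simp only: scaleQ_scaleQ of_int_mult)
      then show "of_int (z i - y i) *\<^sub>Q h i \<in> C"
        using subgrp_scale[OF C k(2)[OF i]] by (simp only:)
    qed
    finally have "X = (\<Sum>i\<in>I. of_int (y i) *\<^sub>Q h i) +o C"
      unfolding a(2) by (rule coset_eq[OF C])
    then show "X \<in> (\<lambda>z. (\<Sum>i\<in>I. of_int (z i) *\<^sub>Q h i) +o C) ` ?Z"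
      using y by blast
  qed
  then have "finite (cosets A C)"
    using I by (meson finite_PiE finite_atLeastLessThan_int finite_imageI finite_subset)
  moreover have "cosets A C \<noteq> {}"
    using A by (auto simp: cosets_def subgrp_def)
  ultimately show ?thesis
    by (simp add: lattice_index_def)
qed

section \<open>Toric maps\<close>

lemma linear_span_mem:
  assumes "qlinear \<phi>" "\<phi> ` S \<subseteq> Q.span T" "x \<in> Q.span S"
  shows "\<phi> x \<in> Q.span T"
  using assms(3)
  by (induction rule: Q.span_induct_alt)
    (use assms(1,2) in \<open>auto simp: QQ.linear_0 QQ.linear_add QQ.linear_scale Q.span_zero
      intro!: Q.span_add Q.span_scale\<close>)

text \<open>Adding a multiple of a relative interior point of \<open>\<sigma>\<close> to
  \<open>x2\<close> gives a point \<open>y\<close> common to both cones and outside the span of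
  \<open>\<sigma>\<close>. Hence the face \<open>\<tau>1 \<inter> \<tau>2\<close> has the span of
  either cone, and a face contains every point of its cone that lies in its span.\<close>

lemma facet_same_side_unique:
  fixes N :: "'v::rat_vector set"
  assumes N: "is_lattice N" and \<Sigma>: "fan \<Sigma>" and mem: "\<sigma> \<in> \<Sigma>" "\<tau>1 \<in> \<Sigma>" "\<tau>2 \<in> \<Sigma>"
    and facets: "facet \<sigma> \<tau>1" "facet \<sigma> \<tau>2"
    and x: "x1 \<in> \<tau>1" "x1 \<notin> Q.span \<sigma>" "x2 \<in> (\<tau>2 :: 'v set)" "0 < r" "x2 - r *\<^sub>Q x1 \<in> Q.span \<sigma>"
  shows "\<tau>1 = \<tau>2"
proof -
  have sub: "\<sigma> \<subseteq> \<tau>1" "\<sigma> \<subseteq> \<tau>2"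
    using facets face_subset by (auto simp: facet_def)
  note poly = fan_polyhedral[OF \<Sigma> mem(1)] fan_polyhedral[OF \<Sigma> mem(2)] fan_polyhedral[OF \<Sigma> mem(3)]
  obtain p where p: "p \<in> rint \<sigma>"
    using rint_nonempty[OF poly(1)] .
  then have p\<sigma>: "p \<in> \<sigma>"
    by (simp add: rint_def)
  obtain k0 where k0: "\<And>k. k0 \<le> k \<Longrightarrow> x2 - r *\<^sub>Q x1 + k *\<^sub>Q p \<in> \<sigma>"
    using rint_absorb[OF poly(1) p x(5)] by blast
  define k where "k = max k0 0"
  define y where "y = x2 + k *\<^sub>Q p"
  have kp: "k *\<^sub>Q p \<in> \<sigma>"
    using p\<sigma> by (auto simp: k_def intro: cone_scale[OF poly(1)])
  then have "y \<in> \<tau>2"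
    using sub(2) x(3) by (auto simp: y_def intro: cone_add[OF poly(3)])
  have "r *\<^sub>Q x1 + (x2 - r *\<^sub>Q x1 + k *\<^sub>Q p) \<in> \<tau>1"
    using k0[of k] sub(1) x by (intro cone_add[OF poly(2) cone_scale[OF poly(2)]]) (auto simp: k_def)
  then have "y \<in> \<tau>1"
    by (simp add: y_def algebra_simps)
  have y: "y \<notin> Q.span \<sigma>"
  proof
    assume "y \<in> Q.span \<sigma>"
    then have "y - k *\<^sub>Q p - (x2 - r *\<^sub>Q x1) \<in> Q.span \<sigma>"
      by (rule Q.span_diff[OF Q.span_diff[OF _ Q.span_base[OF kp]] x(5)])
    then have "r *\<^sub>Q x1 \<in> Q.span \<sigma>"
      by (simp add: y_def)
    then have "(1 / r) *\<^sub>Q r *\<^sub>Q x1 \<in> Q.span \<sigma>"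
      by (rule Q.span_scale)
    then show False
      using x(2,4) by (simp add: scaleQ_scaleQ scaleQ_one)
  qed
  have "\<tau> \<subseteq> \<tau>1 \<inter> \<tau>2" if "facet \<sigma> \<tau>" "y \<in> \<tau>" "face (\<tau>1 \<inter> \<tau>2) \<tau>" for \<tau>
  proof
    fix x assume x: "x \<in> \<tau>"
    have "insert y \<sigma> \<subseteq> \<tau>1 \<inter> \<tau>2"
      using sub \<open>y \<in> \<tau>1\<close> \<open>y \<in> \<tau>2\<close> by blast
    then have "Q.span (insert y \<sigma>) \<subseteq> Q.span (\<tau>1 \<inter> \<tau>2)"
      by (rule Q.span_mono)
    moreover have "Q.span (insert y \<sigma>) = Q.span \<tau>"
      using facet_span_insert[OF N that(1) _ y] that(2) Q.span_base[OF that(2)] by blast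
    ultimately have "x \<in> Q.span (\<tau>1 \<inter> \<tau>2)"
      using Q.span_base[OF x] by blast
    then show "x \<in> \<tau>1 \<inter> \<tau>2"
      by (rule face_span_Int[OF that(3) x])
  qed
  then show ?thesis
    using fan_Int_face[OF \<Sigma> mem(2,3)] fan_Int_face[OF \<Sigma> mem(3,2)] facets \<open>y \<in> \<tau>1\<close> \<open>y \<in> \<tau>2\<close>
    by (simp add: Int_commute) blast
qed

text \<open>The preimage of the span of \<open>\<gamma>\<close> lies in the span of
  \<open>C\<close>, so vectors independent modulo \<open>C\<close> have images independent modulo
  \<open>\<gamma>\<close>.\<close>

lemma dim_Un_image:
  fixes N :: "'v::rat_vector set" and \<phi> :: "'w::rat_vector \<Rightarrow> 'v"
  assumes N: "is_lattice N" and \<phi>: "qlinear \<phi>"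
    and pre: "\<And>x. \<phi> x \<in> Q.span \<gamma> \<Longrightarrow> x \<in> Q.span C"
    and "finite E" "C \<inter> E = {}" "Q.independent (C \<union> E)"
  shows "Q.dim (\<gamma> \<union> \<phi> ` E) = Q.dim \<gamma> + card E"
  using assms(4-6)
proof (induction E rule: finite_induct)
  case (insert e E)
  have ind: "Q.independent (C \<union> E)"
    using insert.prems(2) by (rule Q.independent_mono) auto
  have "\<phi> e \<notin> Q.span (\<gamma> \<union> \<phi> ` E)"
  proof
    assume "\<phi> e \<in> Q.span (\<gamma> \<union> \<phi> ` E)"
    then obtain s y where sy: "s \<in> Q.span \<gamma>" "y \<in> Q.span E" "\<phi> e = s + \<phi> y"
      using QQ.linear_span_image[OF \<phi>, of E] by (auto simp: Q.span_Un)
    then have "\<phi> (e - y) \<in> Q.span \<gamma>"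
      using \<phi> by (simp add: QQ.linear_diff)
    then have "e - y \<in> Q.span (C \<union> E)"
      using pre Q.span_mono[of C "C \<union> E"] by blast
    moreover have "y \<in> Q.span (C \<union> E)"
      using sy(2) Q.span_mono[of E "C \<union> E"] by blast
    ultimately have "e \<in> Q.span (C \<union> E)"
      using Q.span_add[of "e - y" _ y] by simp
    moreover have "insert e (C \<union> E) - {e} = C \<union> E"
      using insert.hyps insert.prems(1) by blast
    ultimately show False
      using insert.prems(2) unfolding Q.dependent_def by (metis Un_insert_right insertI1)
  qed
  then show ?case
    using lattice_dim_insert[OF N] insert ind by simp
qed simp

text \<open>A basis of the span of \<open>\<sigma>'\<close> is completed by a set \<open>E\<close>
  of \<open>codim \<sigma>'\<close> vectors. Their images are independent modulo
  \<open>\<gamma>\<close>, and together with \<open>\<gamma>\<close> they span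
  \<open>range \<phi> + Q.span \<gamma>\<close>.\<close>

lemma
  fixes N :: "'v::rat_vector set" and \<phi> :: "'w::rat_vector \<Rightarrow> 'v" and \<sigma>' :: "'w set"
  assumes N: "is_lattice N" and N': "is_lattice (N' :: 'w set)" and \<phi>: "qlinear \<phi>"
    and pre: "\<And>x. \<phi> x \<in> Q.span \<gamma> \<Longrightarrow> x \<in> Q.span \<sigma>'" and im: "\<phi> ` \<sigma>' \<subseteq> Q.span \<gamma>"
  shows codim_le_of_preimage: "codim \<sigma>' \<le> codim \<gamma>"
    and range_plus_span_iff: "range \<phi> + Q.span \<gamma> = UNIV \<longleftrightarrow> codim \<gamma> = codim \<sigma>'"
proof -
  obtain C where C: "finite C" "C \<subseteq> \<sigma>'" "Q.independent C" "Q.span C = Q.span \<sigma>'"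
    using lattice_finite_span[OF N'] .
  obtain B where B: "C \<subseteq> B" "Q.independent B" "UNIV \<subseteq> Q.span B"
    using Q.maximal_independent_subset_extend[OF subset_UNIV C(3)] by metis
  obtain B0 where B0: "finite B0" "Q.span B0 = (UNIV :: 'w set)"
    using N' unfolding is_lattice_def by blast
  have finB: "finite B"
    using Q.independent_span_bound[OF B0(1) B(2)] B0(2) by blast
  define E where "E = B - C"
  have E: "finite E" "C \<inter> E = {}" "C \<union> E = B"
    using finB B(1) by (auto simp: E_def)
  have cards: "card B = Q.dim (UNIV :: 'w set)" "card C = Q.dim \<sigma>'"
    using Q.dim_span_eq_card_independent[OF B(2)] Q.dim_span_eq_card_independent[OF C(3)]
      top.extremum_uniqueI[OF B(3)] C(4)
    by (metis, metis Q.dim_span)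
  have "card B = card C + card E"
    using card_Un_disjoint[OF C(1) E(1,2)] E(3) by simp
  then have cE: "card E = codim \<sigma>'"
    using cards by (simp add: codim_def)
  have dim: "Q.dim (\<gamma> \<union> \<phi> ` E) = Q.dim \<gamma> + codim \<sigma>'"
    using dim_Un_image[OF N \<phi> _ E(1,2)] pre C(4) E(3) B(2) cE by simp
  have le: "Q.dim (\<gamma> \<union> \<phi> ` E) \<le> Q.dim (UNIV :: 'v set)" "Q.dim \<gamma> \<le> Q.dim (UNIV :: 'v set)"
    by (rule lattice_dim_le_UNIV[OF N])+
  then show c: "codim \<sigma>' \<le> codim \<gamma>"
    using dim by (simp add: codim_def)
  have sp: "Q.span (\<gamma> \<union> \<phi> ` E) = range \<phi> + Q.span \<gamma>"
  proof
    have "\<phi> ` E \<subseteq> range \<phi> + Q.span \<gamma>" "\<gamma> \<subseteq> range \<phi> + Q.span \<gamma>"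
      using set_plus_intro[of "\<phi> _" "range \<phi>" 0 "Q.span \<gamma>"]
        set_plus_intro[of "\<phi> 0" "range \<phi>" _ "Q.span \<gamma>"] QQ.linear_0[OF \<phi>]
      by (auto simp: Q.span_zero Q.span_base)
    moreover have "Q.subspace (range \<phi> + Q.span \<gamma>)"
    proof -
      have "range \<phi> + Q.span \<gamma> = {x + y |x y. x \<in> range \<phi> \<and> y \<in> Q.span \<gamma>}"
        by (auto simp: set_plus_def)
      then show ?thesis
        using Q.subspace_sums[OF QQ.linear_subspace_image[OF \<phi> Q.subspace_UNIV] Q.subspace_span]
        by simp
    qed
    ultimately show "Q.span (\<gamma> \<union> \<phi> ` E) \<subseteq> range \<phi> + Q.span \<gamma>"
      by (intro Q.span_minimal) auto
    have "\<phi> x \<in> Q.span (\<gamma> \<union> \<phi> ` E)" for x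
    proof (rule linear_span_mem[OF \<phi>])
      show "x \<in> Q.span (C \<union> E)"
        using B(3) E(3) by blast
      have "\<phi> ` C \<subseteq> Q.span (\<gamma> \<union> \<phi> ` E)"
        using C(2) im Q.span_mono[of \<gamma> "\<gamma> \<union> \<phi> ` E"] by blast
      moreover have "\<phi> ` E \<subseteq> Q.span (\<gamma> \<union> \<phi> ` E)"
        using Q.span_superset[of "\<gamma> \<union> \<phi> ` E"] by blast
      ultimately show "\<phi> ` (C \<union> E) \<subseteq> Q.span (\<gamma> \<union> \<phi> ` E)"
        by (simp add: image_Un)
    qed
    then show "range \<phi> + Q.span \<gamma> \<subseteq> Q.span (\<gamma> \<union> \<phi> ` E)"
      using Q.span_mono[of \<gamma> "\<gamma> \<union> \<phi> ` E"] by (auto elim!: set_plus_elim intro!: Q.span_add)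
  qed
  show "range \<phi> + Q.span \<gamma> = UNIV \<longleftrightarrow> codim \<gamma> = codim \<sigma>'"
  proof
    assume "range \<phi> + Q.span \<gamma> = UNIV"
    then have "Q.dim (\<gamma> \<union> \<phi> ` E) = Q.dim (UNIV :: 'v set)"
      using sp by (metis Q.dim_span)
    then show "codim \<gamma> = codim \<sigma>'"
      using dim by (simp add: codim_def)
  next
    assume "codim \<gamma> = codim \<sigma>'"
    then have "Q.dim (UNIV :: 'v set) \<le> Q.dim (\<gamma> \<union> \<phi> ` E)"
      using dim le by (simp add: codim_def)
    then have "Q.span (\<gamma> \<union> \<phi> ` E) = Q.span UNIV"
      by (intro lattice_span_eqI[OF N]) auto
    then show "range \<phi> + Q.span \<gamma> = UNIV"
      using sp by simp
  qed
qed

text \<open>The kernel of \<open>\<phi>\<close> modulo the span of \<open>\<gamma>\<close> lies in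
  the span of \<open>\<sigma>'\<close>, where \<open>u\<close> vanishes. \<open>R\<close> divides
  out the span of \<open>\<gamma>\<close>, and \<open>g\<close> is a linear section of
  \<open>R \<circ> \<phi>\<close> over its range.\<close>

lemma factor_through_image:
  fixes N :: "'v::rat_vector set" and \<phi> :: "'w::rat_vector \<Rightarrow> 'v"
  assumes N: "is_lattice N" and \<phi>: "qlinear \<phi>"
    and pre: "\<And>x. \<phi> x \<in> Q.span \<gamma> \<Longrightarrow> x \<in> Q.span \<sigma>'" and u: "u \<in> perp \<sigma>'"
  obtains w where "w \<in> perp \<gamma>" "w \<circ> \<phi> = u"
proof -
  obtain P where P: "qlinear P" "range P \<subseteq> Q.span \<gamma>" "\<forall>x\<in>Q.span \<gamma>. P x = x"
    using lattice_span_retraction[OF N] .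
  define R where "R = (\<lambda>x. x - P x)"
  have R: "qlinear R"
    using P(1) by (simp add: R_def Vector_Spaces.linear_iff Q.vector_space_axioms
        Q.scale_right_diff_distrib)
  define f where "f = R \<circ> \<phi>"
  have f: "qlinear f"
    unfolding f_def by (rule Vector_Spaces.linear_compose[OF \<phi> R])
  obtain g where g: "qlinear g" "\<forall>v\<in>range f. f (g v) = v"
    using QQ.linear_exists_right_inverse_on[OF f Q.subspace_UNIV] by blast
  have ker: "u x = 0" if "f x = 0" for x
  proof -
    have "\<phi> x = P (\<phi> x)"
      using that by (simp add: f_def R_def)
    then have "\<phi> x \<in> Q.span \<gamma>"
      using P(2) by (metis range_subsetD)
    then show ?thesis
      using perp_span_zero[OF u] pre by blast
  qed
  have ud: "u \<in> dualQ"
    using u by (rule perp_dualQ)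
  show thesis
  proof (rule that[of "u \<circ> (g \<circ> R)"])
    have "u \<circ> (g \<circ> R) \<in> dualQ"
      by (rule dualQ_compose[OF ud Vector_Spaces.linear_compose[OF R g(1)]])
    moreover have "(u \<circ> (g \<circ> R)) x = 0" if "x \<in> \<gamma>" for x
      using P(3) that g(1) ud by (simp add: R_def Q.span_base QQ.linear_0 dualQ_simps)
    ultimately show "u \<circ> (g \<circ> R) \<in> perp \<gamma>"
      by (simp add: perp_def)
    show "u \<circ> (g \<circ> R) \<circ> \<phi> = u"
    proof
      fix x
      have "f (g (f x) - x) = 0"
        using g(2) f by (simp add: QQ.linear_diff)
      then have "u (g (f x) - x) = 0"
        by (rule ker)
      then show "(u \<circ> (g \<circ> R) \<circ> \<phi>) x = u x"
        using ud by (simp add: f_def dualQ_simps)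
    qed
  qed
qed

section \<open>Proper toric maps: lifting of cones and finiteness of degrees\<close>

locale toric_map =
  fixes N :: "'v::rat_vector set" and \<Sigma> :: "'v set set"
    and N' :: "'w::rat_vector set" and \<Sigma>' :: "'w set set" and \<phi> :: "'w \<Rightarrow> 'v"
  assumes N: "is_lattice N" and N': "is_lattice N'" and \<Sigma>: "fan \<Sigma>" and \<Sigma>': "fan \<Sigma>'"
    and proper: "proper_fan_map N' \<Sigma>' N \<Sigma> \<phi>"
begin

abbreviation mc :: "'w set \<Rightarrow> 'v set" where
  "mc \<equiv> min_cone \<Sigma> \<phi>"

text \<open>The index is taken without regard to codimensions. As an infinite index is 0, a nonzero
  value says that the orbit of \<open>\<gamma>'\<close> maps with finite degree onto its
  image.\<close>

definition deg :: "'w set \<Rightarrow> nat" where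
  "deg \<gamma>' = lattice_index (perp \<gamma>' \<inter> dual_lattice N') (dual_map \<phi> ` (perp (mc \<gamma>') \<inter> dual_lattice N))"

lemma linear: "qlinear \<phi>" and maps_lattice: "\<phi> ` N' \<subseteq> N" and preimage: "\<phi> -` (\<Union>\<Sigma>) = \<Union>\<Sigma>'"
  and in_cone: "\<sigma>' \<in> \<Sigma>' \<Longrightarrow> \<exists>\<sigma>\<in>\<Sigma>. \<phi> ` \<sigma>' \<subseteq> \<sigma>"
  using proper by (auto simp: proper_fan_map_def fan_map_def)

lemmas poly = fan_polyhedral[OF \<Sigma>] and poly' = fan_polyhedral[OF \<Sigma>']

lemma
  assumes "\<sigma>' \<in> \<Sigma>'"
  shows mc_in: "mc \<sigma>' \<in> \<Sigma>" and mc_image: "\<phi> ` \<sigma>' \<subseteq> mc \<sigma>'"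
    and mc_least: "\<delta> \<in> \<Sigma> \<Longrightarrow> \<phi> ` \<sigma>' \<subseteq> \<delta> \<Longrightarrow> mc \<sigma>' \<subseteq> \<delta>"
  using min_cone[OF \<Sigma> in_cone[OF assms]] by auto

lemma mc_mono:
  assumes "\<sigma>' \<in> \<Sigma>'" "\<tau>' \<in> \<Sigma>'" "\<sigma>' \<subseteq> \<tau>'"
  shows "mc \<sigma>' \<subseteq> mc \<tau>'"
  using mc_least[OF assms(1) mc_in[OF assms(2)]] mc_image[OF assms(2)] assms(3) by blast

lemma mc_face: "\<sigma>' \<in> \<Sigma>' \<Longrightarrow> \<tau>' \<in> \<Sigma>' \<Longrightarrow> \<sigma>' \<subseteq> \<tau>' \<Longrightarrow> face (mc \<sigma>') (mc \<tau>')"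
  by (rule fan_subset_face[OF \<Sigma> mc_in mc_in mc_mono])

lemma mc_span: "\<sigma>' \<in> \<Sigma>' \<Longrightarrow> x \<in> Q.span \<sigma>' \<Longrightarrow> \<phi> x \<in> Q.span (mc \<sigma>')"
  using mc_image Q.span_superset[of "mc \<sigma>'"] by (intro linear_span_mem[OF linear, of \<sigma>']) blast+

text \<open>The geometric use of properness. Far along the direction of an interior point
  \<open>p\<close> of \<open>\<sigma>'\<close>, the points \<open>v + k *\<^sub>Q p\<close> map into
  \<open>\<tau>\<close>, as \<open>\<phi> p\<close> absorbs \<open>- s\<close>; so they lie in the
  support of \<open>\<Sigma>'\<close>, and one cone contains such a point together with
  \<open>p\<close>. A carrier inside this cone contains \<open>\<sigma>'\<close> and maps into
  \<open>\<tau>\<close>; the last assumption bounds its dimension, making \<open>\<sigma>'\<close> a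
  facet.\<close>

lemma lift_cone:
  assumes \<sigma>': "\<sigma>' \<in> \<Sigma>'" and \<tau>: "\<tau> \<in> \<Sigma>" "mc \<sigma>' \<subseteq> \<tau>"
    and v: "v \<notin> Q.span \<sigma>'" "\<phi> v = t - s" "t \<in> \<tau>" "s \<in> Q.span (mc \<sigma>')"
    and pre: "\<And>x. \<phi> x \<in> Q.span \<tau> \<Longrightarrow> x \<in> Q.span (insert v \<sigma>')"
  obtains \<kappa> s' where "\<kappa> \<in> \<Sigma>'" "facet \<sigma>' \<kappa>" "\<phi> ` \<kappa> \<subseteq> \<tau>" "s' \<in> Q.span \<sigma>'" "v + s' \<in> \<kappa>"
proof -
  obtain p where p: "p \<in> rint \<sigma>'"
    using rint_nonempty[OF poly'[OF \<sigma>']] .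
  then have p\<sigma>: "p \<in> \<sigma>'"
    by (simp add: rint_def)
  have \<phi>p: "\<phi> p \<in> rint (mc \<sigma>')"
    by (rule rint_min_cone[OF \<Sigma> in_cone[OF \<sigma>'] linear p])
  obtain k0 where k0: "\<And>k. k0 \<le> k \<Longrightarrow> - s + k *\<^sub>Q \<phi> p \<in> mc \<sigma>'"
    using rint_absorb[OF poly[OF mc_in[OF \<sigma>']] \<phi>p Q.span_neg[OF v(4)]] by blast
  have \<phi>vk: "\<phi> (v + k *\<^sub>Q p) \<in> \<tau>" if "k0 \<le> k" for k
  proof -
    have "t + (- s + k *\<^sub>Q \<phi> p) \<in> \<tau>"
      using k0[OF that] \<tau>(2) by (intro cone_add[OF poly[OF \<tau>(1)] v(3)]) blast
    moreover have "\<phi> (v + k *\<^sub>Q p) = t + (- s + k *\<^sub>Q \<phi> p)"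
      using linear v(2) by (simp add: QQ.linear_add QQ.linear_scale)
    ultimately show ?thesis by simp
  qed
  then have "v + k *\<^sub>Q p \<in> \<Union>\<Sigma>'" if "k0 \<le> k" for k
    using that \<tau>(1) preimage by blast
  then obtain \<kappa>1 k where \<kappa>1: "\<kappa>1 \<in> \<Sigma>'" "p \<in> \<kappa>1" "v + k *\<^sub>Q p \<in> \<kappa>1" "k0 \<le> k"
    using fan_ray_cone[OF \<Sigma>', of k0 v p] by blast
  define y where "y = v + k *\<^sub>Q p"
  \<comment> \<open>Adding \<open>p\<close> once more puts both \<open>y\<close> and
    \<open>p\<close> into the carrier, since a face contains the summands of its points.\<close>
  have "y + p \<in> \<kappa>1"
    using \<kappa>1 by (auto simp: y_def intro: cone_add[OF poly'])
  then obtain \<kappa> where \<kappa>: "\<kappa> \<in> \<Sigma>'" "y + p \<in> rint \<kappa>" "\<kappa> \<subseteq> \<kappa>1"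
    using fan_carrier[OF \<Sigma>' _ \<kappa>1(1)] by blast
  have face: "face \<kappa> \<kappa>1"
    by (rule fan_subset_face[OF \<Sigma>' \<kappa>(1) \<kappa>1(1) \<kappa>(3)])
  have mem: "y + p \<in> \<kappa>"
    using \<kappa>(2) by (simp add: rint_def)
  have y\<kappa>: "y \<in> \<kappa>"
    using \<kappa>1 mem by (intro face_add_left[OF face, of y p]) (auto simp: y_def)
  have p\<kappa>: "p \<in> \<kappa>"
    using \<kappa>1 mem by (intro face_add_left[OF face, of p y]) (auto simp: y_def add.commute)
  have \<sigma>\<kappa>: "\<sigma>' \<subseteq> \<kappa>"
    by (rule fan_rint_subset[OF \<Sigma>' \<sigma>' \<kappa>(1) p p\<kappa>])
  have "\<phi> p \<in> \<tau>"
    using mc_image[OF \<sigma>'] p\<sigma> \<tau>(2) by blast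
  then have "\<phi> y + \<phi> p \<in> \<tau>"
    using \<phi>vk[OF \<kappa>1(4)] by (intro cone_add[OF poly[OF \<tau>(1)]]) (auto simp: y_def)
  then have "\<phi> (y + p) \<in> \<tau>"
    using linear by (simp add: QQ.linear_add)
  then have im: "\<phi> ` \<kappa> \<subseteq> \<tau>"
    by (rule rint_image_subset[OF \<Sigma> mc_in[OF \<kappa>(1)] \<tau>(1) linear mc_image[OF \<kappa>(1)] \<kappa>(2)])
  have kp: "k *\<^sub>Q p \<in> Q.span \<sigma>'"
    using p\<sigma> by (intro Q.span_scale Q.span_base)
  have "\<kappa> \<subseteq> Q.span (insert v \<sigma>')"
    using im pre Q.span_base by blast
  then have "Q.dim \<kappa> \<le> Q.dim \<sigma>' + 1"
    using lattice_dim_mono[OF N', of \<kappa> "insert v \<sigma>'"] lattice_dim_insert[OF N' v(1)] by simp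
  moreover have "y \<notin> Q.span \<sigma>'"
    using v(1) kp Q.span_diff[of y \<sigma>' "k *\<^sub>Q p"] by (auto simp: y_def)
  then have "Q.dim (insert y \<sigma>') = Q.dim \<sigma>' + 1"
    by (rule lattice_dim_insert[OF N'])
  moreover have "insert y \<sigma>' \<subseteq> Q.span \<kappa>"
    using y\<kappa> \<sigma>\<kappa> Q.span_superset[of \<kappa>] by blast
  then have "Q.dim (insert y \<sigma>') \<le> Q.dim \<kappa>"
    by (rule lattice_dim_mono[OF N'])
  ultimately have "facet \<sigma>' \<kappa>"
    using fan_subset_face[OF \<Sigma>' \<sigma>' \<kappa>(1) \<sigma>\<kappa>] by (simp add: facet_def)
  then show thesis
    using that[OF \<kappa>(1) _ im kp] y\<kappa> by (simp add: y_def)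
qed

text \<open>A form in \<open>perp \<sigma>'\<close> with value 1 at \<open>x\<close> would have a
  positive multiple pulled back from \<open>perp (mc \<sigma>')\<close>, and such pullbacks vanish
  at \<open>x\<close>.\<close>

lemma deg_nonzero_preimage:
  assumes "\<sigma>' \<in> \<Sigma>'" "deg \<sigma>' \<noteq> 0" "\<phi> x \<in> Q.span (mc \<sigma>')"
  shows "x \<in> Q.span \<sigma>'"
proof (rule ccontr)
  assume "x \<notin> Q.span \<sigma>'"
  then obtain u where u: "u \<in> perp \<sigma>'" "u x = 1"
    by (rule separate_subspace)
  obtain k :: int where k: "0 < k" "of_int k *\<^sub>Q u \<in> dual_lattice N'"
    using dual_lattice_multiple[OF N' perp_dualQ[OF u(1)]] .
  have "of_int k *\<^sub>Q u \<in> perp \<sigma>' \<inter> dual_lattice N'"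
    using k(2) u(1) by (simp add: Q.subspace_scale[OF subspace_perp])
  then obtain l :: int where l: "0 < l"
    "of_int l *\<^sub>Q of_int k *\<^sub>Q u \<in> dual_map \<phi> ` (perp (mc \<sigma>') \<inter> dual_lattice N)"
    using lattice_index_nonzero_multiple[OF subgrp_perp_dual_lattice
        subgrp_dual_map[OF subgrp_perp_dual_lattice] assms(2)[unfolded deg_def]] by blast
  then obtain w where w: "w \<in> perp (mc \<sigma>')" "of_int l *\<^sub>Q of_int k *\<^sub>Q u = dual_map \<phi> w"
    by blast
  have "w (\<phi> x) = 0"
    by (rule perp_span_zero[OF w(1) assms(3)])
  moreover have "w (\<phi> x) = of_int l * of_int k"
    using fun_cong[OF w(2), of x] u(2) by (simp add: dual_map_def)
  ultimately show False
    using k(1) l(1) by simp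
qed

text \<open>With \<open>R\<close> removing the component in the span of \<open>\<sigma>'\<close>,
  every element of \<open>perp \<sigma>' \<inter> dual_lattice N'\<close> is an integer combination
  of the forms \<open>c b \<circ> R\<close>. Each of these factors through \<open>\<phi>\<close> and
  so has a positive multiple in the image; the product of the multiples is a common
  exponent.\<close>

lemma deg_nonzero:
  assumes "\<sigma>' \<in> \<Sigma>'" and pre: "\<And>x. \<phi> x \<in> Q.span (mc \<sigma>') \<Longrightarrow> x \<in> Q.span \<sigma>'"
  shows "deg \<sigma>' \<noteq> 0"
proof -
  let ?C = "dual_map \<phi> ` (perp (mc \<sigma>') \<inter> dual_lattice N)"
  have C: "subgrp ?C"
    by (rule subgrp_dual_map[OF subgrp_perp_dual_lattice])
  obtain P where P: "qlinear P" "P ` N' \<subseteq> N'" "range P \<subseteq> Q.span \<sigma>'" "\<forall>x\<in>Q.span \<sigma>'. P x = x"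
    using lattice_span_retraction[OF N'] .
  obtain B c where B0: "finite B" "Q.independent B" "Q.span B = UNIV"
    "\<forall>b\<in>B. c b \<in> dualQ" "\<forall>x. x = (\<Sum>b\<in>B. c b x *\<^sub>Q b)"
    "\<forall>x. x \<in> N' \<longleftrightarrow> (\<forall>b\<in>B. c b x \<in> \<int>)" "\<forall>b\<in>B. b \<in> N'"
    using lattice_coordinates[OF N'] .
  note B = B0[rule_format]
  define R where "R = (\<lambda>x. x - P x)"
  have R: "qlinear R"
    using P(1) by (simp add: R_def Vector_Spaces.linear_iff Q.vector_space_axioms
        Q.scale_right_diff_distrib)
  define h where "h = (\<lambda>b. c b \<circ> R)"
  have hp: "h b \<in> perp \<sigma>'" if "b \<in> B" for b
  proof -
    have "h b \<in> dualQ"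
      unfolding h_def by (rule dualQ_compose[OF B(4)[OF that] R])
    moreover have "h b x = 0" if "x \<in> \<sigma>'" for x
      using P(4) Q.span_base[OF that] B(4)[OF \<open>b \<in> B\<close>] by (simp add: h_def R_def dualQ_simps)
    ultimately show ?thesis
      by (simp add: perp_def)
  qed
  have "\<exists>k::int. 0 < k \<and> of_int k *\<^sub>Q h b \<in> ?C" if b: "b \<in> B" for b
  proof -
    obtain w where w: "w \<in> perp (mc \<sigma>')" "w \<circ> \<phi> = h b"
      using factor_through_image[OF N linear _ hp[OF b]] pre by blast
    obtain k :: int where k: "0 < k" "of_int k *\<^sub>Q w \<in> dual_lattice N"
      using dual_lattice_multiple[OF N perp_dualQ[OF w(1)]] .
    have "of_int k *\<^sub>Q h b = dual_map \<phi> (of_int k *\<^sub>Q w)"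
      unfolding w(2)[symmetric] by (auto simp: dual_map_def)
    then show ?thesis
      using k w(1) by (auto simp: Q.subspace_scale[OF subspace_perp])
  qed
  then obtain K :: "'w \<Rightarrow> int" where K: "\<And>b. b \<in> B \<Longrightarrow> 0 < K b" "\<And>b. b \<in> B \<Longrightarrow> of_int (K b) *\<^sub>Q h b \<in> ?C"
    by metis
  show ?thesis
    unfolding deg_def
  proof (rule lattice_index_nonzero[OF subgrp_perp_dual_lattice C B(1)])
    show "0 < (\<Prod>b\<in>B. K b)"
      using K(1) by (simp add: prod_pos)
    show "of_int (\<Prod>b\<in>B. K b) *\<^sub>Q h b \<in> ?C" if b: "b \<in> B" for b
    proof -
      have "of_int (\<Prod>b\<in>B. K b) *\<^sub>Q h b = of_int (\<Prod>b\<in>B - {b}. K b) *\<^sub>Q of_int (K b) *\<^sub>Q h b"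
        using prod.remove[OF B(1) b, of K] by (simp only: scaleQ_scaleQ of_int_mult mult.commute)
      then show ?thesis
        using subgrp_scale[OF C K(2)[OF b], of "\<Prod>b\<in>B - {b}. K b"] by (simp only:)
    qed
    fix u assume u: "u \<in> perp \<sigma>' \<inter> dual_lattice N'"
    then have ud: "u \<in> dualQ"
      by (simp add: perp_def)
    have "u x = (\<Sum>b\<in>B. of_int \<lfloor>u b\<rfloor> *\<^sub>Q h b) x" for x
    proof -
      have "u (P x) = 0"
        using u P(3) perp_span_zero[of u \<sigma>' "P x"] by blast
      then have "u x = u (R x)"
        using ud by (simp add: R_def dualQ_simps)
      also have "\<dots> = (\<Sum>b\<in>B. c b (R x) * u b)"
        by (subst B(5)[of "R x"]) (simp add: dualQ_simps ud)
      also have "\<dots> = (\<Sum>b\<in>B. of_int \<lfloor>u b\<rfloor> * h b x)"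
      proof (rule sum.cong)
        fix b assume "b \<in> B"
        then have "u b \<in> \<int>"
          using u B(7) by (auto simp: dual_lattice_def)
        then show "c b (R x) * u b = of_int \<lfloor>u b\<rfloor> * h b x"
          by (simp add: h_def)
      qed simp
      finally show ?thesis
        by (simp add: sum_fun_apply)
    qed
    then show "\<exists>z. u = (\<Sum>b\<in>B. of_int (z b) *\<^sub>Q h b)"
      by (intro exI[of _ "\<lambda>b. \<lfloor>u b\<rfloor>"] ext)
  qed
qed

lemma pushforward_eq:
  "V_pushforward N' N \<Sigma> \<phi> \<gamma>' =
    (if codim (mc \<gamma>') < codim \<gamma>' then 0
     else if codim (mc \<gamma>') = codim \<gamma>' then of_nat (deg \<gamma>') *\<^sub>Q V_cycle (mc \<gamma>')
     else of_nat (deg \<gamma>') *\<^sub>Q prime_cycle (mc \<gamma>') (range \<phi> + Q.span (mc \<gamma>')))"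
  by (simp add: V_pushforward_def deg_def Let_def)

lemma pushforward_zero: "deg \<gamma>' = 0 \<Longrightarrow> V_pushforward N' N \<Sigma> \<phi> \<gamma>' = 0"
  by (simp add: pushforward_eq)

end

section \<open>Action, push forward and pullback on representatives\<close>

lemma V_cycle_apply: "V_cycle \<sigma> (\<tau>, L) = (if \<tau> = \<sigma> \<and> L = UNIV then 1 else 0)"
  by (simp add: V_cycle_def prime_cycle_def)

lemma action_V_cycle:
  assumes "finite \<Sigma>" "\<sigma> \<in> \<Sigma>"
  shows "action N \<Sigma> \<Psi> D (a *\<^sub>Q V_cycle \<sigma>) = a *\<^sub>Q V_action N \<Sigma> \<Psi> D \<sigma>"
proof -
  have "action N \<Sigma> \<Psi> D (a *\<^sub>Q V_cycle \<sigma>) =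
      (\<Sum>\<tau>\<in>\<Sigma>. if \<tau> = \<sigma> then a *\<^sub>Q V_action N \<Sigma> \<Psi> D \<tau> else 0)"
    unfolding action_def by (intro sum.cong) (auto simp: V_cycle_apply)
  then show ?thesis
    using assms by simp
qed

lemma action_zero: "action N \<Sigma> \<Psi> D 0 = 0"
  by (simp add: action_def)

lemma pushforward_sum_V_cycle:
  assumes "finite \<Sigma>'" "T \<subseteq> \<Sigma>'"
  shows "pushforward N' \<Sigma>' N \<Sigma> \<phi> (\<Sum>\<tau>\<in>T. A \<tau> *\<^sub>Q V_cycle \<tau>) = (\<Sum>\<tau>\<in>T. A \<tau> *\<^sub>Q V_pushforward N' N \<Sigma> \<phi> \<tau>)"
proof -
  have fin: "finite T"
    using assms finite_subset by blast
  have "(\<Sum>\<tau>\<in>T. A \<tau> *\<^sub>Q V_cycle \<tau>) (\<gamma>, UNIV) = (if \<gamma> \<in> T then A \<gamma> else 0)" for \<gamma>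
  proof -
    have "(\<Sum>\<tau>\<in>T. A \<tau> *\<^sub>Q V_cycle \<tau>) (\<gamma>, UNIV) = (\<Sum>\<tau>\<in>T. if \<tau> = \<gamma> then A \<tau> else 0)"
      by (auto simp: sum_fun_apply V_cycle_apply intro!: sum.cong)
    then show ?thesis
      using fin by simp
  qed
  then have "pushforward N' \<Sigma>' N \<Sigma> \<phi> (\<Sum>\<tau>\<in>T. A \<tau> *\<^sub>Q V_cycle \<tau>) =
      (\<Sum>\<gamma>\<in>\<Sigma>'. if \<gamma> \<in> T then A \<gamma> *\<^sub>Q V_pushforward N' N \<Sigma> \<phi> \<gamma> else 0)"
    unfolding pushforward_def by (intro sum.cong) auto
  also have "\<dots> = (\<Sum>\<tau>\<in>\<Sigma>' \<inter> T. A \<tau> *\<^sub>Q V_pushforward N' N \<Sigma> \<phi> \<tau>)"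
    by (rule sum.inter_restrict[OF assms(1), symmetric])
  finally show ?thesis
    using assms(2) by (simp add: inf_absorb2)
qed

text \<open>Forms vanishing on the smallest cone of \<open>\<gamma>'\<close> pull back into
  \<open>perp \<gamma>'\<close>, so the choice of representative of \<open>D\<close> is
  absorbed.\<close>

lemma pullback_coset:
  assumes "\<phi> ` \<gamma>' \<subseteq> min_cone \<Sigma> \<phi> \<gamma>'" "qlinear \<phi>" "D (min_cone \<Sigma> \<phi> \<gamma>') = u +o perp (min_cone \<Sigma> \<phi> \<gamma>')"
  shows "pullback \<Sigma> \<phi> D \<gamma>' = (u \<circ> \<phi>) +o perp \<gamma>'"
proof
  let ?\<gamma> = "min_cone \<Sigma> \<phi> \<gamma>'"
  show "pullback \<Sigma> \<phi> D \<gamma>' \<subseteq> (u \<circ> \<phi>) +o perp \<gamma>'"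
  proof
    fix f assume "f \<in> pullback \<Sigma> \<phi> D \<gamma>'"
    then obtain r s where rs: "r \<in> perp ?\<gamma>" "s \<in> perp \<gamma>'" "f = dual_map \<phi> (u + r) + s"
      unfolding pullback_def assms(3) by (auto simp: elt_set_plus_def elim!: set_plus_elim)
    have r\<phi>: "r \<circ> \<phi> \<in> perp \<gamma>'"
      using rs(1) assms(1) dualQ_compose[OF perp_dualQ[OF rs(1)] assms(2)] by (auto simp: perp_def)
    have "(r \<circ> \<phi>) + s \<in> perp \<gamma>'"
      by (rule Q.subspace_add[OF subspace_perp r\<phi> rs(2)])
    moreover have "f = (u \<circ> \<phi>) + ((r \<circ> \<phi>) + s)"
      using rs(3) by (auto simp: dual_map_def)
    ultimately show "f \<in> (u \<circ> \<phi>) +o perp \<gamma>'"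
      by auto
  qed
  have "u + 0 \<in> u +o perp ?\<gamma>"
    by (intro set_plus_intro2 Q.subspace_0[OF subspace_perp])
  then have "u \<circ> \<phi> \<in> dual_map \<phi> ` D ?\<gamma>"
    unfolding assms(3) by (auto simp: dual_map_def)
  then show "(u \<circ> \<phi>) +o perp \<gamma>' \<subseteq> pullback \<Sigma> \<phi> D \<gamma>'"
    unfolding pullback_def by (rule set_plus_mono3)
qed

section \<open>The projection formula\<close>

locale toric_action = toric_map N \<Sigma> N' \<Sigma>' \<phi>
  for N :: "'v::rat_vector set" and \<Sigma> and N' :: "'w::rat_vector set" and \<Sigma>' and \<phi> +
  fixes \<Psi> D :: "'v set \<Rightarrow> ('v \<Rightarrow> rat) set" and \<Psi>' :: "'w set \<Rightarrow> ('w \<Rightarrow> rat) set"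
  assumes \<Psi>: "complements \<Sigma> \<Psi>" and \<Psi>': "complements \<Sigma>' \<Psi>'"
    and compat: "\<And>\<tau>' \<tau>. \<tau>' \<in> \<Sigma>' \<Longrightarrow> \<tau> \<in> \<Sigma> \<Longrightarrow> \<phi> ` \<tau>' \<subseteq> \<tau> \<Longrightarrow> codim \<tau>' = codim \<tau> \<Longrightarrow>
           dual_map \<phi> ` \<Psi> \<tau> \<subseteq> \<Psi>' \<tau>'"
    and D: "q_cartier \<Sigma> D"
begin

definition coeff :: "'v set \<Rightarrow> 'v set \<Rightarrow> rat" where
  "coeff \<sigma> \<tau> = pairing (proj \<Psi> \<sigma> ` D \<tau>) (normal_gen N \<tau> \<sigma>)"

definition coeff' :: "'w set \<Rightarrow> 'w set \<Rightarrow> rat" where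
  "coeff' \<sigma>' \<tau>' = pairing (proj \<Psi>' \<sigma>' ` pullback \<Sigma> \<phi> D \<tau>') (normal_gen N' \<tau>' \<sigma>')"

lemma local_equation:
  assumes "\<sigma> \<in> \<Sigma>"
  obtains u where "u \<in> dualQ" "D \<sigma> = u +o perp \<sigma>"
  using D assms unfolding q_cartier_def cosets_def by blast

lemma coeff_eq:
  assumes "\<sigma> \<in> \<Sigma>" "\<tau> \<in> \<Sigma>" "facet \<sigma> \<tau>" "u \<in> dualQ" "D \<tau> = u +o perp \<tau>"
    "normal_gen N \<tau> \<sigma> = e +o cone_lattice N \<sigma>" "e \<in> Q.span \<tau>"
  shows "coeff \<sigma> \<tau> = proj \<Psi> \<sigma> u e"
  unfolding coeff_def assms(5,6)
  by (rule pairing_proj[OF N \<Psi> assms(1) poly[OF assms(1)] facet_sub[OF assms(3)] assms(4,7)])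

lemma coeff'_eq:
  assumes "\<sigma>' \<in> \<Sigma>'" "\<tau>' \<in> \<Sigma>'" "facet \<sigma>' \<tau>'" "u \<in> dualQ" "D (mc \<tau>') = u +o perp (mc \<tau>')"
    "normal_gen N' \<tau>' \<sigma>' = e +o cone_lattice N' \<sigma>'" "e \<in> Q.span \<tau>'"
  shows "coeff' \<sigma>' \<tau>' = proj \<Psi>' \<sigma>' (u \<circ> \<phi>) e"
  unfolding coeff'_def assms(6) pullback_coset[where D = D, OF mc_image[OF assms(2)] linear assms(5)]
  by (rule pairing_proj[OF N' \<Psi>' assms(1) poly'[OF assms(1)] facet_sub[OF assms(3)]
        dualQ_compose[OF assms(4) linear] assms(7)])

abbreviation push :: "'w set \<Rightarrow> 'v cycle" where
  "push \<equiv> V_pushforward N' N \<Sigma> \<phi>"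

abbreviation star :: "'w set \<Rightarrow> 'w set set" where
  "star \<sigma>' \<equiv> {\<tau>'. \<tau>' \<in> \<Sigma>' \<and> facet \<sigma>' \<tau>'}"

section \<open>Cancellation over contracted subvarieties\<close>

lemma opposite_coeff:
  assumes \<sigma>': "\<sigma>' \<in> \<Sigma>'" and mem: "\<tau>1 \<in> \<Sigma>'" "\<tau>2 \<in> \<Sigma>'"
    and facets: "facet \<sigma>' \<tau>1" "facet \<sigma>' \<tau>2" and same: "Q.span \<tau>1 = Q.span \<tau>2" "mc \<tau>1 = mc \<tau>2"
    and x: "x \<in> \<tau>1" "x \<notin> Q.span \<sigma>'" "- x + s \<in> \<tau>2" "s \<in> Q.span \<sigma>'"
  shows "\<tau>1 \<noteq> \<tau>2" "coeff' \<sigma>' \<tau>2 = - coeff' \<sigma>' \<tau>1"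
proof -
  obtain e1 g1 s1 where 1: "normal_gen N' \<tau>1 \<sigma>' = e1 +o cone_lattice N' \<sigma>'" "e1 \<in> N'" "e1 \<in> Q.span \<tau>1"
    "g1 \<in> dual_lattice N'" "g1 \<in> perp \<sigma>'" "g1 e1 = 1" "\<forall>x\<in>\<tau>1. 0 \<le> g1 x"
    "\<forall>x\<in>Q.span \<tau>1. x - g1 x *\<^sub>Q e1 \<in> Q.span \<sigma>'" "s1 \<in> Q.span \<sigma>'" "e1 + s1 \<in> \<tau>1"
    using normal_gen[OF N' poly'[OF \<sigma>'] poly'[OF mem(1)] facets(1)] .
  obtain e2 g2 s2 where 2: "normal_gen N' \<tau>2 \<sigma>' = e2 +o cone_lattice N' \<sigma>'" "e2 \<in> N'" "e2 \<in> Q.span \<tau>2"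
    "g2 \<in> dual_lattice N'" "g2 \<in> perp \<sigma>'" "g2 e2 = 1" "\<forall>x\<in>\<tau>2. 0 \<le> g2 x"
    "\<forall>x\<in>Q.span \<tau>2. x - g2 x *\<^sub>Q e2 \<in> Q.span \<sigma>'" "s2 \<in> Q.span \<sigma>'" "e2 + s2 \<in> \<tau>2"
    using normal_gen[OF N' poly'[OF \<sigma>'] poly'[OF mem(2)] facets(2)] .
  have d: "g1 \<in> dualQ" "g2 \<in> dualQ"
    using 1(5) 2(5) perp_dualQ by auto
  have "g1 x \<noteq> 0"
    using bspec[OF 1(8) Q.span_base[OF x(1)]] x(2) by auto
  then have g1x: "0 < g1 x"
    using bspec[OF 1(7) x(1)] by linarith
  then have neg: "g1 (- x + s) < 0"
    using perp_span_zero[OF 1(5) x(4)] d by (simp add: dualQ_simps)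
  then show "\<tau>1 \<noteq> \<tau>2"
    using 1(7) x(3) by fastforce
  obtain j :: int where j: "g1 e2 = of_int j"
    using 1(4) 2(2) by (auto simp: dual_lattice_def elim: Ints_cases)
  obtain i :: int where i: "g2 e1 = of_int i"
    using 2(4) 1(2) by (auto simp: dual_lattice_def elim: Ints_cases)
  \<comment> \<open>On the common span \<open>g1\<close> is the multiple \<open>j\<close> of
    \<open>g2\<close>. Integrality of \<open>g1 e2\<close> and \<open>g2 e1\<close> makes
    \<open>j\<close> a unit, and the cones lying on opposite sides makes it \<open>- 1\<close>;
    hence \<open>e2 + e1\<close> lies in the span of \<open>\<sigma>'\<close>.\<close>
  have expand: "g1 y = g2 y * of_int j" if "y \<in> Q.span \<tau>2" for y
    using perp_span_zero[OF 1(5) bspec[OF 2(8) that]] d j by (simp add: dualQ_simps)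
  have "1 = of_int i * (of_int j :: rat)"
    using expand[of e1] 1(3,6) same(1) i by simp
  then have "i * j = 1"
    by (metis of_int_eq_1_iff of_int_mult)
  moreover have "j < 0"
  proof (rule ccontr)
    assume "\<not> j < 0"
    then have "0 \<le> g2 (- x + s) * of_int j"
      using bspec[OF 2(7) x(3)] by simp
    then show False
      using expand[OF Q.span_base[OF x(3)]] neg by simp
  qed
  ultimately have "j = - 1"
    by (auto simp: zmult_eq_1_iff)
  then have sum: "e2 + e1 \<in> Q.span \<sigma>'"
    using bspec[OF 1(8), of e2] 2(3) same(1) j by (simp add: scaleQ_one)
  \<comment> \<open>One local equation serves both cones because their smallest cones agree, and its
    projection vanishes on \<open>e2 + e1\<close>.\<close>
  obtain u where u: "u \<in> dualQ" "D (mc \<tau>1) = u +o perp (mc \<tau>1)"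
    using local_equation[OF mc_in[OF mem(1)]] .
  have w: "proj \<Psi>' \<sigma>' (u \<circ> \<phi>) \<in> perp \<sigma>'"
    by (rule proj_perp[OF N' \<Psi>' \<sigma>' dualQ_compose[OF u(1) linear]])
  have "proj \<Psi>' \<sigma>' (u \<circ> \<phi>) e2 + proj \<Psi>' \<sigma>' (u \<circ> \<phi>) e1 = 0"
    using perp_span_zero[OF w sum] perp_dualQ[OF w] by (simp add: dualQ_simps)
  then show "coeff' \<sigma>' \<tau>2 = - coeff' \<sigma>' \<tau>1"
    using coeff'_eq[OF \<sigma>' mem(1) facets(1) u 1(1,3)]
      coeff'_eq[OF \<sigma>' mem(2) facets(2) u(1) _ 2(1,3)] u(2) same(2) by simp
qed

text \<open>If \<open>V(\<sigma>')\<close> is contracted, then the cones contributing to the pushforward span the preimage of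
  the span of \<open>mc \<sigma>'\<close>. By properness there are exactly two of them or none, and they lie on opposite
  sides of \<open>\<sigma>'\<close>.\<close>

lemma contracted_sum:
  assumes \<sigma>': "\<sigma>' \<in> \<Sigma>'" and x0: "\<phi> x0 \<in> Q.span (mc \<sigma>')" "x0 \<notin> Q.span \<sigma>'"
  shows "(\<Sum>\<tau>'\<in>star \<sigma>'. coeff' \<sigma>' \<tau>' *\<^sub>Q push \<tau>') = 0"
proof -
  define T where "T = {\<tau>'\<in>star \<sigma>'. push \<tau>' \<noteq> 0}"
  have fin: "finite (star \<sigma>')"
    using fan_finite[OF \<Sigma>'] by simp
  have Tmem: "\<tau>' \<in> \<Sigma>'" "facet \<sigma>' \<tau>'" "push \<tau>' \<noteq> 0" if "\<tau>' \<in> T" for \<tau>'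
    using that by (auto simp: T_def)
  have mc_eq: "mc \<tau>' = mc \<sigma>'" if "\<tau>' \<in> \<Sigma>'" "facet \<sigma>' \<tau>'" "\<phi> ` \<tau>' \<subseteq> mc \<sigma>'" for \<tau>'
    using mc_least[OF that(1) mc_in[OF \<sigma>'] that(3)] mc_mono[OF \<sigma>' that(1) facet_sub[OF that(2)]]
    by (rule subset_antisym)
  have Tspan: "Q.span (insert x0 \<sigma>') = Q.span \<tau>'" "mc \<tau>' = mc \<sigma>'" "\<And>x. \<phi> x \<in> Q.span (mc \<sigma>') \<longleftrightarrow> x \<in> Q.span \<tau>'"
    if "\<tau>' \<in> T" for \<tau>'
  proof -
    note mem = Tmem[OF that]
    \<comment> \<open>A nonzero push forward forces a nonzero index, so the span of
      \<open>\<tau>'\<close> contains the preimage of the span of \<open>mc \<sigma>'\<close>. This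
      preimage contains \<open>x0\<close>, and since \<open>\<sigma>'\<close> is a facet there is no
      room for more.\<close>
    have "deg \<tau>' \<noteq> 0"
      using mem(3) pushforward_zero by blast
    moreover have sub: "mc \<sigma>' \<subseteq> mc \<tau>'"
      by (rule mc_mono[OF \<sigma>' mem(1) facet_sub[OF mem(2)]])
    ultimately have pre: "\<phi> x \<in> Q.span (mc \<sigma>') \<Longrightarrow> x \<in> Q.span \<tau>'" for x
      using deg_nonzero_preimage[OF mem(1)] Q.span_mono[OF sub] by blast
    then show sp: "Q.span (insert x0 \<sigma>') = Q.span \<tau>'"
      using x0 by (intro facet_span_insert[OF N' mem(2)]) auto
    have "\<phi> ` insert x0 \<sigma>' \<subseteq> Q.span (mc \<sigma>')"
      using x0(1) mc_image[OF \<sigma>'] Q.span_superset[of "mc \<sigma>'"] by blast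
    then have im: "\<phi> x \<in> Q.span (mc \<sigma>')" if "x \<in> Q.span \<tau>'" for x
      using linear_span_mem[OF linear] that sp by blast
    then show "\<And>x. \<phi> x \<in> Q.span (mc \<sigma>') \<longleftrightarrow> x \<in> Q.span \<tau>'"
      using pre by blast
    have "\<phi> x \<in> mc \<sigma>'" if "x \<in> \<tau>'" for x
      using face_span_Int[OF mc_face[OF \<sigma>' mem(1) facet_sub[OF mem(2)]]] im[OF Q.span_base[OF that]]
        mc_image[OF mem(1)] that by blast
    then show "mc \<tau>' = mc \<sigma>'"
      using mc_eq mem by blast
  qed
  show ?thesis
  proof (cases "T = {}")
    case True
    then show ?thesis
      by (intro sum.neutral ballI) (auto simp: T_def)
  next
    case False
    then obtain \<tau>1 where \<tau>1: "\<tau>1 \<in> T" by blast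
    note mem1 = Tmem[OF \<tau>1] and sp1 = Tspan[OF \<tau>1]
    obtain x1 where x1: "x1 \<in> \<tau>1" "x1 \<notin> Q.span \<sigma>'"
      using facet_exceeds[OF N' mem1(2)] .
    have x1s: "Q.span (insert x1 \<sigma>') = Q.span \<tau>1"
      by (rule facet_span_insert[OF N' mem1(2) Q.span_base[OF x1(1)] x1(2)])
    have mx1: "- x1 \<notin> Q.span \<sigma>'"
      using x1(2) Q.span_neg[of "- x1" \<sigma>'] by auto
    have mx1s: "Q.span (insert (- x1) \<sigma>') = Q.span \<tau>1"
      using mx1 by (intro facet_span_insert[OF N' mem1(2)] Q.span_neg Q.span_base[OF x1(1)])
    have "\<phi> x1 \<in> Q.span (mc \<sigma>')"
      using sp1(3) Q.span_base[OF x1(1)] by blast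
    moreover have "\<phi> (- x1) = 0 - \<phi> x1"
      using linear by (simp add: QQ.linear_neg)
    moreover have "0 \<in> mc \<sigma>'"
      by (rule cone_zero[OF poly[OF mc_in[OF \<sigma>']]])
    moreover have "\<phi> x \<in> Q.span (mc \<sigma>') \<Longrightarrow> x \<in> Q.span (insert (- x1) \<sigma>')" for x
      using sp1(3) mx1s by simp
    \<comment> \<open>The lift is applied to the direction \<open>- x1\<close>, with target
      \<open>mc \<sigma>'\<close> and \<open>t = 0\<close>: properness supplies the cone opposite to
      \<open>\<tau>1\<close>.\<close>
    ultimately obtain \<kappa> s where \<kappa>: "\<kappa> \<in> \<Sigma>'" "facet \<sigma>' \<kappa>" "\<phi> ` \<kappa> \<subseteq> mc \<sigma>'" "s \<in> Q.span \<sigma>'" "- x1 + s \<in> \<kappa>"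
      using lift_cone[OF \<sigma>' mc_in[OF \<sigma>'] subset_refl mx1] by metis
    have mc\<kappa>: "mc \<kappa> = mc \<sigma>'"
      by (rule mc_eq[OF \<kappa>(1-3)])
    have "s \<in> Q.span \<kappa>"
      using \<kappa>(4) Q.span_mono[OF facet_sub[OF \<kappa>(2)]] by blast
    then have "s - (- x1 + s) \<in> Q.span \<kappa>"
      by (intro Q.span_diff Q.span_base[OF \<kappa>(5)])
    then have "x1 \<in> Q.span \<kappa>" by simp
    then have sp\<kappa>: "Q.span \<tau>1 = Q.span \<kappa>"
      using facet_span_insert[OF N' \<kappa>(2) _ x1(2)] x1s by simp
    have dim: "Q.dim \<kappa> = Q.dim \<tau>1"
      by (rule Q.span_eq_dim[OF sp\<kappa>[symmetric]])
    have "perp \<kappa> = perp \<tau>1"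
      using sp\<kappa> perp_span by metis
    moreover have "codim \<kappa> = codim \<tau>1"
      using dim by (simp add: codim_def)
    \<comment> \<open>The push forward depends on a cone only through its span and its smallest cone
      in \<open>\<Sigma>\<close>.\<close>
    ultimately have push: "push \<kappa> = push \<tau>1"
      using mc\<kappa> sp1(2) by (simp only: V_pushforward_def)
    note opp = opposite_coeff[OF \<sigma>' mem1(1) \<kappa>(1) mem1(2) \<kappa>(2) sp\<kappa> _ x1 \<kappa>(5,4)]
    \<comment> \<open>Modulo the span of \<open>\<sigma>'\<close> the common span is a line; the
      sign of \<open>r\<close> decides on which of its two rays \<open>\<tau>'\<close> lies, and
      each ray carries only one cone.\<close>
    have T2: "\<tau>' = \<tau>1 \<or> \<tau>' = \<kappa>" if \<tau>': "\<tau>' \<in> T" for \<tau>'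
    proof -
      note mem' = Tmem[OF \<tau>'] and sp' = Tspan[OF \<tau>']
      obtain x where x: "x \<in> \<tau>'" "x \<notin> Q.span \<sigma>'"
        using facet_exceeds[OF N' mem'(2)] .
      have "x \<in> Q.span (insert x1 \<sigma>')"
        using Q.span_base[OF x(1)] sp'(1) sp1(1) x1s by simp
      then obtain r where r: "x - r *\<^sub>Q x1 \<in> Q.span \<sigma>'"
        by (auto simp: Q.span_breakdown_eq)
      have "r \<noteq> 0"
        using r x(2) by auto
      then consider "0 < r" | "0 < - r" by linarith
      then show ?thesis
      proof cases
        case 1
        then have "\<tau>1 = \<tau>'"
          by (rule facet_same_side_unique[OF N' \<Sigma>' \<sigma>' mem1(1) mem'(1) mem1(2) mem'(2) x1 x(1) _ r])
        then show ?thesis by simp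
      next
        case 2
        have "- x1 + s \<notin> Q.span \<sigma>'"
          using mx1 Q.span_diff[OF _ \<kappa>(4), of "- x1 + s"] by auto
        moreover have "x - (- r) *\<^sub>Q (- x1 + s) \<in> Q.span \<sigma>'"
        proof -
          have "x - r *\<^sub>Q x1 + r *\<^sub>Q s \<in> Q.span \<sigma>'"
            by (intro Q.span_add r Q.span_scale \<kappa>(4))
          then show ?thesis
            by (simp add: scaleQ_add_right algebra_simps)
        qed
        ultimately have "\<kappa> = \<tau>'"
          using 2 by (intro facet_same_side_unique[OF N' \<Sigma>' \<sigma>' \<kappa>(1) mem'(1) \<kappa>(2) mem'(2) \<kappa>(5) _ x(1)])
        then show ?thesis by simp
      qed
    qed
    have "(\<Sum>\<tau>'\<in>star \<sigma>'. coeff' \<sigma>' \<tau>' *\<^sub>Q push \<tau>') = (\<Sum>\<tau>'\<in>{\<tau>1, \<kappa>}. coeff' \<sigma>' \<tau>' *\<^sub>Q push \<tau>')"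
      using T2 mem1 \<kappa> by (intro sum.mono_neutral_right[OF fin]) (auto simp: T_def)
    also have "\<dots> = coeff' \<sigma>' \<tau>1 *\<^sub>Q push \<tau>1 + coeff' \<sigma>' \<kappa> *\<^sub>Q push \<kappa>"
      using opp(1) mc\<kappa> sp1(2) by simp
    also have "\<dots> = 0"
      using opp(2) mc\<kappa> sp1(2) push by simp
    finally show ?thesis .
  qed
qed

section \<open>Subvarieties with image of the same dimension\<close>

text \<open>Here \<open>m\<close> is the index with which \<open>\<phi>\<close> maps the lattice normal of \<open>\<tau>'\<close> to that of \<open>mc \<tau>'\<close>; it
  is the factor relating both the coefficients and the degrees.\<close>

lemma coeff_deg:
  assumes \<sigma>': "\<sigma>' \<in> \<Sigma>'" and \<tau>': "\<tau>' \<in> \<Sigma>'" and facet': "facet \<sigma>' \<tau>'" and facet: "facet (mc \<sigma>') (mc \<tau>')"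
    and pre: "\<And>x. \<phi> x \<in> Q.span (mc \<sigma>') \<Longrightarrow> x \<in> Q.span \<sigma>'" and codim: "codim \<sigma>' = codim (mc \<sigma>')"
  shows "coeff' \<sigma>' \<tau>' * of_nat (deg \<tau>') = of_nat (deg \<sigma>') * coeff (mc \<sigma>') (mc \<tau>')"
proof -
  let ?\<gamma> = "mc \<sigma>'" and ?\<tau> = "mc \<tau>'"
  note \<gamma> = mc_in[OF \<sigma>'] and \<tau> = mc_in[OF \<tau>']
  obtain e g s where n: "normal_gen N ?\<tau> ?\<gamma> = e +o cone_lattice N ?\<gamma>" "e \<in> N" "e \<in> Q.span ?\<tau>"
    "g \<in> dual_lattice N" "g \<in> perp ?\<gamma>" "g e = 1" "\<forall>x\<in>?\<tau>. 0 \<le> g x"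
    "\<forall>x\<in>Q.span ?\<tau>. x - g x *\<^sub>Q e \<in> Q.span ?\<gamma>" "s \<in> Q.span ?\<gamma>" "e + s \<in> ?\<tau>"
    using normal_gen[OF N poly[OF \<gamma>] poly[OF \<tau>] facet] .
  obtain e' g' s' where n': "normal_gen N' \<tau>' \<sigma>' = e' +o cone_lattice N' \<sigma>'" "e' \<in> N'" "e' \<in> Q.span \<tau>'"
    "g' \<in> dual_lattice N'" "g' \<in> perp \<sigma>'" "g' e' = 1" "\<forall>x\<in>\<tau>'. 0 \<le> g' x"
    "\<forall>x\<in>Q.span \<tau>'. x - g' x *\<^sub>Q e' \<in> Q.span \<sigma>'" "s' \<in> Q.span \<sigma>'" "e' + s' \<in> \<tau>'"
    using normal_gen[OF N' poly'[OF \<sigma>'] poly'[OF \<tau>'] facet'] .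
  have gd: "g \<in> dualQ" "g' \<in> dualQ"
    using n(5) n'(5) perp_dualQ by auto
  have \<phi>e: "\<phi> e' \<in> Q.span ?\<tau>" "\<phi> e' \<in> N"
    using mc_span[OF \<tau>' n'(3)] maps_lattice n'(2) by auto
  obtain i :: int where i: "g (\<phi> e') = of_int i"
    using n(4) \<phi>e(2) by (auto simp: dual_lattice_def elim: Ints_cases)
  have e's: "e' \<notin> Q.span \<sigma>'"
    using perp_span_zero[OF n'(5)] n'(6) by auto
  have dec: "\<phi> e' - of_int i *\<^sub>Q e \<in> Q.span ?\<gamma>"
    using bspec[OF n(8) \<phi>e(1)] i by simp
  \<comment> \<open>For \<open>i = 0\<close> the vector \<open>\<phi> e'\<close> would lie in the
    span of \<open>mc \<sigma>'\<close>, against \<open>pre\<close>. The sign comes from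
    \<open>e' + s'\<close>, which lies in \<open>\<tau>'\<close> and so maps to where
    \<open>g\<close> is nonnegative.\<close>
  have "i \<noteq> 0"
    using dec pre e's by auto
  moreover have "0 \<le> g (\<phi> (e' + s'))"
    using n(7) mc_image[OF \<tau>'] n'(10) by blast
  then have "0 \<le> i"
    using perp_span_zero[OF n(5) mc_span[OF \<sigma>' n'(9)]] i gd linear
    by (simp add: QQ.linear_add dualQ_simps)
  ultimately obtain m :: nat where m: "0 < m" "i = int m"
    by (metis nat_eq_iff2 zero_less_nat_eq order_le_imp_less_or_eq)
  obtain u where u: "u \<in> dualQ" "D ?\<tau> = u +o perp ?\<tau>"
    using local_equation[OF \<tau>] .
  let ?w = "proj \<Psi> ?\<gamma> u"
  note w = proj_perp[OF N \<Psi> \<gamma> u(1)] proj_complement[OF N \<Psi> \<gamma> u(1)]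
  \<comment> \<open>Compatibility of the complements at \<open>\<sigma>'\<close> and
    \<open>mc \<sigma>'\<close>, whose codimensions agree, makes projection commute with
    \<open>dual_map \<phi>\<close>.\<close>
  have "proj \<Psi>' \<sigma>' (u \<circ> \<phi>) = ?w \<circ> \<phi>"
  proof (rule proj_eqI[OF \<Psi>' \<sigma>'])
    show "?w \<circ> \<phi> \<in> perp \<sigma>'"
      using dualQ_compose[OF perp_dualQ[OF w(1)] linear] w(1) mc_image[OF \<sigma>'] by (auto simp: perp_def)
    have "dual_map \<phi> (u - ?w) \<in> \<Psi>' \<sigma>'"
      using compat[OF \<sigma>' \<gamma> mc_image[OF \<sigma>'] codim] w(2) by blast
    moreover have "dual_map \<phi> (u - ?w) = (u \<circ> \<phi>) - (?w \<circ> \<phi>)"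
      by (auto simp: dual_map_def)
    ultimately show "(u \<circ> \<phi>) - (?w \<circ> \<phi>) \<in> \<Psi>' \<sigma>'"
      by simp
  qed
  then have "coeff' \<sigma>' \<tau>' = ?w (\<phi> e')"
    using coeff'_eq[OF \<sigma>' \<tau>' facet' u n'(1,3)] by simp
  also have "\<dots> = of_nat m * ?w e"
    using perp_span_zero[OF w(1) dec] perp_dualQ[OF w(1)] m by (simp add: dualQ_simps)
  also have "?w e = coeff ?\<gamma> ?\<tau>"
    by (rule coeff_eq[OF \<gamma> \<tau> facet u n(1,3), symmetric])
  finally have coeffs: "coeff' \<sigma>' \<tau>' = of_nat m * coeff ?\<gamma> ?\<tau>" .
  let ?A = "perp \<sigma>' \<inter> dual_lattice N'" and ?C = "dual_map \<phi> ` (perp ?\<gamma> \<inter> dual_lattice N)"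
  \<comment> \<open>Evaluation at \<open>e'\<close> is integral on \<open>?A\<close>, so the floor
    only changes its type. Its kernels in \<open>?A\<close> and \<open>?C\<close> are the two
    lattices defining \<open>deg \<tau>'\<close>; it is 1 at \<open>g'\<close> and a multiple of
    \<open>m\<close> on \<open>?C\<close>.\<close>
  let ?f = "\<lambda>u. \<lfloor>u e'\<rfloor>"
  have int: "a e' = of_int \<lfloor>a e'\<rfloor>" if "a \<in> ?A" for a
    using that n'(2) by (auto simp: dual_lattice_def)
  have CA: "dual_map \<phi> a \<in> ?A" if "a \<in> perp ?\<gamma> \<inter> dual_lattice N" for a
  proof -
    have "a \<circ> \<phi> \<in> dualQ"
      using that by (intro dualQ_compose[OF _ linear]) (simp add: perp_def)
    then show ?thesis
      using that mc_image[OF \<sigma>'] maps_lattice by (auto simp: perp_def dual_lattice_def dual_map_def)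
  qed
  have Ce: "dual_map \<phi> a e' = of_nat m * a e" if "a \<in> perp ?\<gamma>" for a
    using perp_span_zero[OF that dec] perp_dualQ[OF that] m by (simp add: dualQ_simps dual_map_def)
  have inta: "\<exists>k::int. a e = of_int k" if "a \<in> dual_lattice N" for a
    using that n(2) by (auto simp: dual_lattice_def elim: Ints_cases)
  have "lattice_index ?A ?C = m * lattice_index {a \<in> ?A. ?f a = 0} (?C \<inter> {a \<in> ?A. ?f a = 0})"
  proof (rule lattice_index_mult)
    show "subgrp ?A" "subgrp ?C"
      by (intro subgrp_dual_map subgrp_perp_dual_lattice)+
    show "?C \<subseteq> ?A"
      using CA by blast
    show "?f (x + y) = ?f x + ?f y" if "x \<in> ?A" "y \<in> ?A" for x y
      using int[OF that(1)] int[OF that(2)] by (metis floor_of_int of_int_add plus_fun_apply)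
    show "g' \<in> ?A" "?f g' = 1"
      using n' by auto
    show "dual_map \<phi> g \<in> ?C" "0 < m"
      using n m by auto
    show "?f (dual_map \<phi> g) = int m"
      using Ce[OF n(5)] n(6) by simp
    fix x assume "x \<in> ?C"
    then obtain a k where "a \<in> perp ?\<gamma>" "x = dual_map \<phi> a" "a e = of_int k"
      using inta by blast
    then have "x e' = of_int (int m * k)"
      using Ce by simp
    then show "int m dvd ?f x"
      by (simp only: floor_of_int dvd_triv_left)
  qed
  moreover have B: "{a \<in> ?A. ?f a = 0} = perp \<tau>' \<inter> dual_lattice N'"
  proof (intro equalityI subsetI)
    fix a assume a: "a \<in> {a \<in> ?A. ?f a = 0}"
    then have a0: "a e' = 0" "a \<in> perp \<sigma>'"
      using int[of a] by auto
    have "a x = 0" if "x \<in> \<tau>'" for x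
      using perp_span_zero[OF a0(2) bspec[OF n'(8) Q.span_base[OF that]]] perp_dualQ[OF a0(2)] a0(1)
      by (simp add: dualQ_simps)
    then show "a \<in> perp \<tau>' \<inter> dual_lattice N'"
      using a by (auto simp: perp_def)
  next
    fix a assume a: "a \<in> perp \<tau>' \<inter> dual_lattice N'"
    then have "a \<in> perp \<sigma>'" "a e' = 0"
      using facet_sub[OF facet'] perp_span_zero[OF _ n'(3)] by (auto simp: perp_def)
    then show "a \<in> {a \<in> ?A. ?f a = 0}"
      using a by auto
  qed
  moreover have "?C \<inter> (perp \<tau>' \<inter> dual_lattice N') = dual_map \<phi> ` (perp ?\<tau> \<inter> dual_lattice N)"
  proof (intro equalityI subsetI)
    fix x assume x: "x \<in> ?C \<inter> (perp \<tau>' \<inter> dual_lattice N')"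
    then obtain a where a: "a \<in> perp ?\<gamma>" "a \<in> dual_lattice N" "x = dual_map \<phi> a"
      by blast
    have "x e' = 0"
      using x perp_span_zero[OF _ n'(3)] by blast
    then have a0: "a e = 0"
      using Ce[OF a(1)] a(3) m(1) by simp
    have "a y = 0" if "y \<in> ?\<tau>" for y
      using perp_span_zero[OF a(1) bspec[OF n(8) Q.span_base[OF that]]] perp_dualQ[OF a(1)] a0
      by (simp add: dualQ_simps)
    then have "a \<in> perp ?\<tau>"
      using a(1) by (simp add: perp_def)
    then show "x \<in> dual_map \<phi> ` (perp ?\<tau> \<inter> dual_lattice N)"
      using a by blast
  next
    fix x assume "x \<in> dual_map \<phi> ` (perp ?\<tau> \<inter> dual_lattice N)"
    then obtain a where a: "a \<in> perp ?\<tau>" "a \<in> dual_lattice N" "x = dual_map \<phi> a"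
      by blast
    have a\<gamma>: "a \<in> perp ?\<gamma>"
      using a(1) facet_sub[OF facet] by (auto simp: perp_def)
    have "a e = 0"
      by (rule perp_span_zero[OF a(1) n(3)])
    then have "x e' = 0"
      using Ce[OF a\<gamma>] a(3) by simp
    then have "x \<in> {a \<in> ?A. ?f a = 0}"
      using CA[of a] a a\<gamma> by simp
    then show "x \<in> ?C \<inter> (perp \<tau>' \<inter> dual_lattice N')"
      using a a\<gamma> unfolding B by blast
  qed
  ultimately have "deg \<sigma>' = m * deg \<tau>'"
    by (simp add: deg_def)
  then show ?thesis
    using coeffs by simp
qed

end

context toric_action
begin

text \<open>Injective: the coordinate normal to \<open>mc \<sigma>'\<close> is positive on images of
  points outside the span of \<open>\<sigma>'\<close>, so two cones with equal \<open>mc\<close> lie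
  on the same side of \<open>\<sigma>'\<close>. Surjective: \<open>onto\<close> lifts a point of
  \<open>\<tau>\<close>, modulo the span of \<open>mc \<sigma>'\<close>, to a direction in which
  properness yields a cone.\<close>

lemma mc_bij_betw:
  assumes \<sigma>': "\<sigma>' \<in> \<Sigma>'" and pre: "\<And>x. \<phi> x \<in> Q.span (mc \<sigma>') \<Longrightarrow> x \<in> Q.span \<sigma>'"
    and onto: "range \<phi> + Q.span (mc \<sigma>') = UNIV"
  shows "bij_betw mc {\<tau>' \<in> star \<sigma>'. facet (mc \<sigma>') (mc \<tau>')} {\<tau> \<in> \<Sigma>. facet (mc \<sigma>') \<tau>}"
proof -
  let ?\<gamma> = "mc \<sigma>'" and ?S = "{\<tau>' \<in> star \<sigma>'. facet (mc \<sigma>') (mc \<tau>')}"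
  note \<gamma> = mc_in[OF \<sigma>']
  have "inj_on mc ?S"
  proof (rule inj_onI)
    fix \<tau>1 \<tau>2 assume "\<tau>1 \<in> ?S" "\<tau>2 \<in> ?S" and eq: "mc \<tau>1 = mc \<tau>2"
    then have 1: "\<tau>1 \<in> \<Sigma>'" "facet \<sigma>' \<tau>1" and 2: "\<tau>2 \<in> \<Sigma>'" "facet \<sigma>' \<tau>2"
      and facet: "facet ?\<gamma> (mc \<tau>1)"
      by auto
    obtain e g s where n: "normal_gen N (mc \<tau>1) ?\<gamma> = e +o cone_lattice N ?\<gamma>" "e \<in> N" "e \<in> Q.span (mc \<tau>1)"
      "g \<in> dual_lattice N" "g \<in> perp ?\<gamma>" "g e = 1" "\<forall>x\<in>mc \<tau>1. 0 \<le> g x"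
      "\<forall>x\<in>Q.span (mc \<tau>1). x - g x *\<^sub>Q e \<in> Q.span ?\<gamma>" "s \<in> Q.span ?\<gamma>" "e + s \<in> mc \<tau>1"
      using normal_gen[OF N poly[OF \<gamma>] poly[OF mc_in[OF 1(1)]] facet] .
    obtain x1 where x1: "x1 \<in> \<tau>1" "x1 \<notin> Q.span \<sigma>'"
      using facet_exceeds[OF N' 1(2)] .
    obtain x2 where x2: "x2 \<in> \<tau>2" "x2 \<notin> Q.span \<sigma>'"
      using facet_exceeds[OF N' 2(2)] .
    have pos: "0 < g (\<phi> x)" if "\<phi> x \<in> mc \<tau>1" "x \<notin> Q.span \<sigma>'" for x
    proof -
      have "g (\<phi> x) \<noteq> 0"
        using bspec[OF n(8) Q.span_base[OF that(1)]] pre that(2) by auto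
      then show ?thesis
        using bspec[OF n(7) that(1)] by linarith
    qed
    have mem: "\<phi> x1 \<in> mc \<tau>1" "\<phi> x2 \<in> mc \<tau>1"
      using mc_image[OF 1(1)] mc_image[OF 2(1)] x1(1) x2(1) eq by auto
    \<comment> \<open>The ratio of normal coordinates: it makes the image of
      \<open>x2 - r *\<^sub>Q x1\<close> have coordinate 0, so \<open>pre\<close> applies to
      it.\<close>
    define r where "r = g (\<phi> x2) / g (\<phi> x1)"
    have r: "0 < r" "r * g (\<phi> x1) = g (\<phi> x2)"
      using pos[OF mem(1) x1(2)] pos[OF mem(2) x2(2)] by (auto simp: r_def)
    have "(\<phi> x2 - g (\<phi> x2) *\<^sub>Q e) - r *\<^sub>Q (\<phi> x1 - g (\<phi> x1) *\<^sub>Q e) \<in> Q.span ?\<gamma>"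
      by (rule Q.span_diff[OF _ Q.span_scale])
        (intro bspec[OF n(8)] Q.span_base mem)+
    then have "\<phi> (x2 - r *\<^sub>Q x1) \<in> Q.span ?\<gamma>"
      using linear r(2)
      by (simp add: QQ.linear_diff QQ.linear_scale Q.scale_right_diff_distrib scaleQ_scaleQ)
    then show "\<tau>1 = \<tau>2"
      by (intro facet_same_side_unique[OF N' \<Sigma>' \<sigma>' 1(1) 2(1) 1(2) 2(2) x1 x2(1) r(1) pre])
  qed
  moreover have "\<tau> \<in> mc ` ?S" if \<tau>: "\<tau> \<in> \<Sigma>" "facet ?\<gamma> \<tau>" for \<tau>
  proof -
    obtain t where t: "t \<in> \<tau>" "t \<notin> Q.span ?\<gamma>"
      using facet_exceeds[OF N \<tau>(2)] .
    have "t \<in> range \<phi> + Q.span ?\<gamma>"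
      using onto by simp
    then obtain v s where v: "t = \<phi> v + s" "s \<in> Q.span ?\<gamma>"
      by (auto elim!: set_plus_elim)
    have \<phi>v: "\<phi> v \<notin> Q.span ?\<gamma>"
      using t(2) v Q.span_add by blast
    then have v\<sigma>: "v \<notin> Q.span \<sigma>'"
      using mc_span[OF \<sigma>'] by blast
    have spt: "Q.span (insert t ?\<gamma>) = Q.span \<tau>"
      by (rule facet_span_insert[OF N \<tau>(2) Q.span_base[OF t(1)] t(2)])
    have pre\<tau>: "x \<in> Q.span (insert v \<sigma>')" if "\<phi> x \<in> Q.span \<tau>" for x
    proof -
      obtain r where "\<phi> x - r *\<^sub>Q t \<in> Q.span ?\<gamma>"
        using \<open>\<phi> x \<in> Q.span \<tau>\<close> spt Q.span_breakdown_eq by blast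
      then have "\<phi> x - r *\<^sub>Q t + r *\<^sub>Q s \<in> Q.span ?\<gamma>"
        by (intro Q.span_add Q.span_scale v(2))
      then have "\<phi> (x - r *\<^sub>Q v) \<in> Q.span ?\<gamma>"
        using linear by (simp add: v(1) QQ.linear_diff QQ.linear_scale scaleQ_add_right)
      then have "x - r *\<^sub>Q v \<in> Q.span \<sigma>'"
        by (rule pre)
      then show ?thesis
        using Q.span_breakdown_eq by blast
    qed
    have "\<phi> v = t - s"
      using v(1) by simp
    then obtain \<kappa> s' where \<kappa>: "\<kappa> \<in> \<Sigma>'" "facet \<sigma>' \<kappa>" "\<phi> ` \<kappa> \<subseteq> \<tau>" "s' \<in> Q.span \<sigma>'" "v + s' \<in> \<kappa>"
      using lift_cone[OF \<sigma>' \<tau>(1) facet_sub[OF \<tau>(2)] v\<sigma> _ t(1) v(2) pre\<tau>] by metis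
    have sub: "mc \<kappa> \<subseteq> \<tau>"
      by (rule mc_least[OF \<kappa>(1) \<tau>(1) \<kappa>(3)])
    have "\<phi> (v + s') \<in> mc \<kappa>"
      using mc_image[OF \<kappa>(1)] \<kappa>(5) by blast
    moreover have "\<phi> (v + s') \<notin> Q.span ?\<gamma>"
      using pre[of "v + s'"] v\<sigma> \<kappa>(4) Q.span_diff[of "v + s'" \<sigma>' s'] by auto
    \<comment> \<open>A point of \<open>mc \<kappa>\<close> off the hyperplane spanned by the facet
      makes this face of \<open>\<tau>\<close> span everything, hence equal
      \<open>\<tau>\<close>.\<close>
    ultimately have "Q.span \<tau> \<subseteq> Q.span (mc \<kappa>)"
      using facet_span_insert[OF N \<tau>(2) Q.span_base[of "\<phi> (v + s')" \<tau>]] sub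
        mc_mono[OF \<sigma>' \<kappa>(1) facet_sub[OF \<kappa>(2)]] Q.span_mono[of "insert (\<phi> (v + s')) ?\<gamma>" "mc \<kappa>"]
      by auto
    then have "mc \<kappa> = \<tau>"
      using face_span_Int[OF fan_subset_face[OF \<Sigma> mc_in[OF \<kappa>(1)] \<tau>(1) sub]] sub Q.span_base by blast
    then show ?thesis
      using \<kappa>(1,2) \<tau>(2) by blast
  qed
  then have "mc ` ?S = {\<tau> \<in> \<Sigma>. facet ?\<gamma> \<tau>}"
    using mc_in by auto
  ultimately show ?thesis
    by (simp add: bij_betw_def)
qed

text \<open>By \<open>pre\<close> some point of \<open>\<tau>'\<close> maps outside the span of
  \<open>mc \<sigma>'\<close>, so \<open>mc \<tau>'\<close> has larger dimension. One dimension more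
  gives equal codimensions; a bigger jump makes the image too small to count. A non-invariant image
  cannot occur.\<close>

lemma push_star:
  assumes \<sigma>': "\<sigma>' \<in> \<Sigma>'" and pre: "\<And>x. \<phi> x \<in> Q.span (mc \<sigma>') \<Longrightarrow> x \<in> Q.span \<sigma>'"
    and codim: "codim \<sigma>' = codim (mc \<sigma>')" and \<tau>': "\<tau>' \<in> \<Sigma>'" "facet \<sigma>' \<tau>'"
  shows "push \<tau>' = (if facet (mc \<sigma>') (mc \<tau>') then of_nat (deg \<tau>') *\<^sub>Q V_cycle (mc \<tau>') else 0)"
proof -
  let ?\<gamma> = "mc \<sigma>'" and ?\<tau> = "mc \<tau>'"
  have dims: "Q.dim \<tau>' = Q.dim \<sigma>' + 1" "Q.dim \<tau>' \<le> Q.dim (UNIV :: 'w set)"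
    "Q.dim ?\<gamma> \<le> Q.dim (UNIV :: 'v set)" "Q.dim ?\<tau> \<le> Q.dim (UNIV :: 'v set)"
    using \<tau>'(2) lattice_dim_le_UNIV[OF N', of \<tau>'] lattice_dim_le_UNIV[OF N, of ?\<gamma>]
      lattice_dim_le_UNIV[OF N, of ?\<tau>]
    by (simp_all add: facet_def)
  obtain x where x: "x \<in> \<tau>'" "x \<notin> Q.span \<sigma>'"
    using facet_exceeds[OF N' \<tau>'(2)] .
  have "\<phi> x \<notin> Q.span ?\<gamma>"
    using pre x(2) by blast
  moreover have "insert (\<phi> x) ?\<gamma> \<subseteq> Q.span ?\<tau>"
    using mc_image[OF \<tau>'(1)] x(1) mc_mono[OF \<sigma>' \<tau>'(1) facet_sub[OF \<tau>'(2)]]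
      Q.span_superset[of ?\<tau>] by blast
  ultimately have le: "Q.dim ?\<gamma> + 1 \<le> Q.dim ?\<tau>"
    using lattice_dim_mono[OF N, of "insert (\<phi> x) ?\<gamma>" ?\<tau>] lattice_dim_insert[OF N] by simp
  have "facet ?\<gamma> ?\<tau> \<longleftrightarrow> Q.dim ?\<tau> = Q.dim ?\<gamma> + 1"
    using mc_face[OF \<sigma>' \<tau>'(1) facet_sub[OF \<tau>'(2)]] by (simp add: facet_def)
  moreover have "codim ?\<tau> = codim \<tau>'" if "Q.dim ?\<tau> = Q.dim ?\<gamma> + 1"
    using that dims codim by (simp add: codim_def)
  moreover have "codim ?\<tau> < codim \<tau>'" if "Q.dim ?\<tau> \<noteq> Q.dim ?\<gamma> + 1"
    using that le dims codim by (simp add: codim_def)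
  ultimately show ?thesis
    by (auto simp: pushforward_eq)
qed

lemma projection_formula:
  assumes \<sigma>': "\<sigma>' \<in> \<Sigma>'" and inv: "invariant_cycle \<Sigma> (push \<sigma>')"
  shows "(\<Sum>\<tau>'\<in>star \<sigma>'. coeff' \<sigma>' \<tau>' *\<^sub>Q push \<tau>') = action N \<Sigma> \<Psi> D (push \<sigma>')"
proof (cases "\<forall>x. \<phi> x \<in> Q.span (mc \<sigma>') \<longrightarrow> x \<in> Q.span \<sigma>'")
  case False
  then obtain x0 where x0: "\<phi> x0 \<in> Q.span (mc \<sigma>')" "x0 \<notin> Q.span \<sigma>'"
    by blast
  then have "deg \<sigma>' = 0"
    using deg_nonzero_preimage[OF \<sigma>'] by blast
  then show ?thesis
    using contracted_sum[OF \<sigma>' x0] by (simp add: pushforward_zero action_zero)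
next
  case True
  let ?\<gamma> = "mc \<sigma>'"
  have pre: "\<And>x. \<phi> x \<in> Q.span ?\<gamma> \<Longrightarrow> x \<in> Q.span \<sigma>'"
    using True by blast
  have im: "\<phi> ` \<sigma>' \<subseteq> Q.span ?\<gamma>"
    using mc_image[OF \<sigma>'] Q.span_superset by blast
  note le = codim_le_of_preimage[OF N N' linear pre im]
    and range_iff = range_plus_span_iff[OF N N' linear pre im]
  \<comment> \<open>The degree is nonzero here, so a larger codimension of
    \<open>mc \<sigma>'\<close> would leave a nonzero coefficient at a pair
    \<open>(\<gamma>, L)\<close>; invariance makes \<open>L\<close> the whole space, which requires
    equal codimensions.\<close>
  have codim: "codim ?\<gamma> = codim \<sigma>'"
  proof (rule ccontr)
    assume ne: "codim ?\<gamma> \<noteq> codim \<sigma>'"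
    then have "push \<sigma>' = of_nat (deg \<sigma>') *\<^sub>Q prime_cycle ?\<gamma> (range \<phi> + Q.span ?\<gamma>)"
      using le by (simp add: pushforward_eq)
    then have "push \<sigma>' (?\<gamma>, range \<phi> + Q.span ?\<gamma>) \<noteq> 0"
      using deg_nonzero[OF \<sigma>' pre] by (simp add: prime_cycle_def)
    then have "range \<phi> + Q.span ?\<gamma> = UNIV"
      using inv by (auto simp: invariant_cycle_def)
    then show False
      using range_iff ne by blast
  qed
  let ?S = "{\<tau>' \<in> star \<sigma>'. facet ?\<gamma> (mc \<tau>')}"
  have "(\<Sum>\<tau>'\<in>star \<sigma>'. coeff' \<sigma>' \<tau>' *\<^sub>Q push \<tau>') =
      (\<Sum>\<tau>'\<in>star \<sigma>'. if facet ?\<gamma> (mc \<tau>')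
        then (of_nat (deg \<sigma>') * coeff ?\<gamma> (mc \<tau>')) *\<^sub>Q V_cycle (mc \<tau>') else 0)"
  proof (rule sum.cong[OF refl])
    fix \<tau>' assume \<tau>': "\<tau>' \<in> star \<sigma>'"
    then show "coeff' \<sigma>' \<tau>' *\<^sub>Q push \<tau>' = (if facet ?\<gamma> (mc \<tau>')
        then (of_nat (deg \<sigma>') * coeff ?\<gamma> (mc \<tau>')) *\<^sub>Q V_cycle (mc \<tau>') else 0)"
      using push_star[OF \<sigma>' pre codim[symmetric]] coeff_deg[OF \<sigma>' _ _ _ pre codim[symmetric], of \<tau>']
      by (simp add: scaleQ_scaleQ)
  qed
  also have "\<dots> = (\<Sum>\<tau>'\<in>?S. (of_nat (deg \<sigma>') * coeff ?\<gamma> (mc \<tau>')) *\<^sub>Q V_cycle (mc \<tau>'))"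
    using fan_finite[OF \<Sigma>'] by (intro sum.inter_filter[symmetric]) simp
  also have "\<dots> = (\<Sum>\<tau> | \<tau> \<in> \<Sigma> \<and> facet ?\<gamma> \<tau>. (of_nat (deg \<sigma>') * coeff ?\<gamma> \<tau>) *\<^sub>Q V_cycle \<tau>)"
    using range_iff codim
    by (intro sum.reindex_bij_betw[OF mc_bij_betw[OF \<sigma>' pre]]) auto
  also have "\<dots> = of_nat (deg \<sigma>') *\<^sub>Q V_action N \<Sigma> \<Psi> D ?\<gamma>"
    by (simp add: V_action_def coeff_def Q.scale_sum_right scaleQ_scaleQ)
  also have "\<dots> = action N \<Sigma> \<Psi> D (push \<sigma>')"
    using codim by (simp add: pushforward_eq action_V_cycle[OF fan_finite[OF \<Sigma>] mc_in[OF \<sigma>']])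
  finally show ?thesis .
qed

end

text \<open>The push forward of \<open>V(\<sigma>')\<close> may be a multiple of a pair
  \<open>(\<gamma>, L)\<close> with proper \<open>L\<close>, on which divisors do not act; the last
  hypothesis is what gives the right-hand side its meaning.\<close>

theorem theorem7p1:
  fixes N :: "'v::rat_vector set" and N' :: "'w::rat_vector set"
    and \<Sigma> :: "'v set set" and \<Sigma>' :: "'w set set"
    and \<phi> :: "'w \<Rightarrow> 'v"
    and \<Psi> D :: "'v set \<Rightarrow> ('v \<Rightarrow> rat) set"
    and \<Psi>' :: "'w set \<Rightarrow> ('w \<Rightarrow> rat) set"
    and \<sigma>' :: "'w set"
  assumes "is_lattice N" and "is_lattice N'"
    and "fan \<Sigma>" and "fan \<Sigma>'"
    and "proper_fan_map N' \<Sigma>' N \<Sigma> \<phi>"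
    and "complements \<Sigma> \<Psi>" and "complements \<Sigma>' \<Psi>'"
    and "\<And>\<tau>' \<tau>. \<tau>' \<in> \<Sigma>' \<Longrightarrow> \<tau> \<in> \<Sigma> \<Longrightarrow> \<phi> ` \<tau>' \<subseteq> \<tau> \<Longrightarrow> codim \<tau>' = codim \<tau> \<Longrightarrow>
           dual_map \<phi> ` \<Psi> \<tau> \<subseteq> \<Psi>' \<tau>'"
    and "q_cartier \<Sigma> D"
    and "\<sigma>' \<in> \<Sigma>'"
    and "invariant_cycle \<Sigma> (pushforward N' \<Sigma>' N \<Sigma> \<phi> (V_cycle \<sigma>'))"
  shows "pushforward N' \<Sigma>' N \<Sigma> \<phi> (action N' \<Sigma>' \<Psi>' (pullback \<Sigma> \<phi> D) (V_cycle \<sigma>'))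
       = action N \<Sigma> \<Psi> D (pushforward N' \<Sigma>' N \<Sigma> \<phi> (V_cycle \<sigma>'))"
proof -
  interpret toric_action N \<Sigma> N' \<Sigma>' \<phi> \<Psi> D \<Psi>'
    using assms(1-9) by unfold_locales
  have fin: "finite \<Sigma>'"
    by (rule fan_finite[OF assms(4)])
  have push: "pushforward N' \<Sigma>' N \<Sigma> \<phi> (V_cycle \<sigma>') = push \<sigma>'"
    using pushforward_sum_V_cycle[OF fin, of "{\<sigma>'}" N' N \<Sigma> \<phi> "\<lambda>_. 1"] assms(10)
    by (simp add: scaleQ_one)
  have "action N' \<Sigma>' \<Psi>' (pullback \<Sigma> \<phi> D) (V_cycle \<sigma>') = V_action N' \<Sigma>' \<Psi>' (pullback \<Sigma> \<phi> D) \<sigma>'"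
    using action_V_cycle[OF fin assms(10), of N' \<Psi>' "pullback \<Sigma> \<phi> D" 1] by (simp add: scaleQ_one)
  also have "\<dots> = (\<Sum>\<tau>'\<in>star \<sigma>'. coeff' \<sigma>' \<tau>' *\<^sub>Q V_cycle \<tau>')"
    by (simp add: V_action_def coeff'_def)
  finally have "pushforward N' \<Sigma>' N \<Sigma> \<phi> (action N' \<Sigma>' \<Psi>' (pullback \<Sigma> \<phi> D) (V_cycle \<sigma>')) =
      (\<Sum>\<tau>'\<in>star \<sigma>'. coeff' \<sigma>' \<tau>' *\<^sub>Q push \<tau>')"
    using pushforward_sum_V_cycle[OF fin, of "star \<sigma>'"] by auto
  then show ?thesis
    using projection_formula[OF assms(10)] assms(11) push by simp
qed

end
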